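(* Every non-abelian Schur $2$-group of order at least $32$ is dihedral; that is, if $G$ is a finite non-abelian $2$-group with $|G|\ge 32$ and $G$ is a Schur group, then $G$ is a dihedral group.
   Context: Let $D$ be a finite group with identity $e$. For $X\subseteq D$ put $\underline{X}=\sum_{x\in X}x\in\mathbb{Z}D$. A subring $\mathcal{A}$ of the group ring $\mathbb{Z}D$ is an S-ring (Schur ring) over $D$ if there is a partition $\mathcal{S}=\mathcal{S}(\mathcal{A})$ of $D$ such that $\{e\}\in\mathcal{S}$; $X\in\mathcal{S}$ implies $X^{-1}\in\mathcal{S}$; and $\mathcal{A}$ is the $\mathbb{Z}$-span of $\{\underline{X}: X\in\mathcal{S}\}$. An S-ring $\mathcal{A}$ over $D$ is schurian if there is a subgroup $G\le\mathrm{Sym}(D)$ containing all right translations of $D$ such that $\mathcal{S}(\mathcal{A})$ is the set of orbits on $D$ of the stabilizer $G_e$. A finite group $D$ is a Schur group if every S-ring over $D$ is schurian. *)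

theory Defs
  imports "HOL-Algebra.Group_Action" "HOL-Algebra.Subrings" "HOL-Algebra.Generated_Groups"
    "HOL-Library.Disjoint_Sets" "HOL-Library.Indicator_Function"
begin

section \<open>The integral group ring of a finite group\<close>

text \<open>
  An element of the group ring is represented by its coefficient function, which vanishes
  outside the carrier. Since the convolution is a sum over pairs, this is the group ring
  only if the carrier is finite.
\<close>

definition group_ring :: "('a, 'b) monoid_scheme \<Rightarrow> ('a \<Rightarrow> int) ring" where
  "group_ring D =
    \<lparr>carrier = {f. \<forall>x. x \<notin> carrier D \<longrightarrow> f x = 0},
     mult = (\<lambda>f g z. \<Sum>(x, y) \<in> {(x, y) \<in> carrier D \<times> carrier D. x \<otimes>\<^bsub>D\<^esub> y = z}. f x * g y),
     one = (\<lambda>x. if x = \<one>\<^bsub>D\<^esub> then 1 else 0),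
     zero = (\<lambda>x. 0),
     add = (\<lambda>f g x. f x + g x)\<rparr>"

definition basis_elt :: "'a \<Rightarrow> 'a \<Rightarrow> int" where
  "basis_elt x = (\<lambda>y. if y = x then 1 else 0)"

definition set_sum :: "('a, 'b) monoid_scheme \<Rightarrow> 'a set \<Rightarrow> 'a \<Rightarrow> int" where
  "set_sum D X = (\<Oplus>\<^bsub>group_ring D\<^esub>x\<in>X. basis_elt x)"

lemma group_ring_simps [simp]:
  "carrier (group_ring D) = {f. \<forall>x. x \<notin> carrier D \<longrightarrow> f x = 0}"
  "\<zero>\<^bsub>group_ring D\<^esub> = (\<lambda>x. 0)"
  "f \<oplus>\<^bsub>group_ring D\<^esub> g = (\<lambda>x. f x + g x)"
  "\<one>\<^bsub>group_ring D\<^esub> = basis_elt \<one>\<^bsub>D\<^esub>"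
  by (simp_all add: group_ring_def basis_elt_def)

lemma (in group) group_ring_mult:
  assumes fin: "finite (carrier G)"
  shows "(f \<otimes>\<^bsub>group_ring G\<^esub> g) z =
    (if z \<in> carrier G then \<Sum>x\<in>carrier G. f x * g (inv x \<otimes> z) else 0)"
proof (cases "z \<in> carrier G")
  case True
  have "(\<Sum>(x, y) \<in> {(x, y) \<in> carrier G \<times> carrier G. x \<otimes> y = z}. f x * g y) =
      (\<Sum>x\<in>carrier G. f x * g (inv x \<otimes> z))"
    by (rule sum.reindex_bij_witness[where i = "\<lambda>x. (x, inv x \<otimes> z)" and j = fst])
       (use True in \<open>auto simp: m_assoc[symmetric]\<close>)
  with True show ?thesis by (simp add: group_ring_def)
next
  case False
  then have "{(x, y) \<in> carrier G \<times> carrier G. x \<otimes> y = z} = {}" by auto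
  with False show ?thesis unfolding group_ring_def monoid.simps by (metis (no_types, lifting) sum.empty)
qed

lemma (in group) group_ring_abelian_group: "abelian_group (group_ring G)"
proof (rule abelian_groupI)
  fix f assume "f \<in> carrier (group_ring G)"
  then show "\<exists>g\<in>carrier (group_ring G). g \<oplus>\<^bsub>group_ring G\<^esub> f = \<zero>\<^bsub>group_ring G\<^esub>"
    by (intro bexI[of _ "\<lambda>x. - f x"]) auto
qed (auto simp: fun_eq_iff)

lemma (in group) group_ring_ring:
  assumes fin: "finite (carrier G)"
  shows "ring (group_ring G)"
proof (rule ringI)
  show "abelian_group (group_ring G)" by (rule group_ring_abelian_group)
  show "Group.monoid (group_ring G)"
  proof (rule monoidI)
    fix f g h :: "'a \<Rightarrow> int"
    have "(\<Sum>x\<in>carrier G. (\<Sum>w\<in>carrier G. f w * g (inv w \<otimes> x)) * h (inv x \<otimes> z)) =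
          (\<Sum>w\<in>carrier G. f w * (\<Sum>x\<in>carrier G. g x * h (inv x \<otimes> (inv w \<otimes> z))))"
      if z: "z \<in> carrier G" for z
    proof -
      have inv_cancel: "w \<otimes> (inv w \<otimes> x) = x" "inv w \<otimes> (w \<otimes> x) = x"
        if "w \<in> carrier G" "x \<in> carrier G" for w x
        using that by (simp_all flip: m_assoc)
      have "(\<Sum>x\<in>carrier G. g (inv w \<otimes> x) * h (inv x \<otimes> z)) =
            (\<Sum>x\<in>carrier G. g x * h (inv x \<otimes> (inv w \<otimes> z)))" if w: "w \<in> carrier G" for w
        by (rule sum.reindex_bij_witness[where i = "\<lambda>x. w \<otimes> x" and j = "\<lambda>x. inv w \<otimes> x"])
           (use w z inv_cancel in \<open>auto simp: m_assoc inv_mult_group\<close>)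
      then show ?thesis
        by (simp add: sum_distrib_left sum_distrib_right mult.assoc
            sum.swap[of _ "carrier G" "carrier G"] flip: sum_distrib_left)
    qed
    then show "f \<otimes>\<^bsub>group_ring G\<^esub> g \<otimes>\<^bsub>group_ring G\<^esub> h = f \<otimes>\<^bsub>group_ring G\<^esub> (g \<otimes>\<^bsub>group_ring G\<^esub> h)"
      by (auto simp: fun_eq_iff group_ring_mult[OF fin] intro!: sum.cong)
  next
    fix f assume f: "f \<in> carrier (group_ring G)"
    have "basis_elt \<one> x * f (inv x \<otimes> z) = (if x = \<one> then f z else 0)"
      if "x \<in> carrier G" "z \<in> carrier G" for x z
      using that by (auto simp: basis_elt_def)
    with f show "\<one>\<^bsub>group_ring G\<^esub> \<otimes>\<^bsub>group_ring G\<^esub> f = f"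
      by (auto simp: fun_eq_iff group_ring_mult[OF fin] fin)
    have "f x * basis_elt \<one> (inv x \<otimes> z) = (if x = z then f z else 0)"
      if "x \<in> carrier G" "z \<in> carrier G" for x z
      using that by (auto simp: basis_elt_def dest: inv_solve_left[THEN iffD1, rotated -1])
         (metis inv_closed inv_equality inv_inv l_inv)+
    with f show "f \<otimes>\<^bsub>group_ring G\<^esub> \<one>\<^bsub>group_ring G\<^esub> = f"
      by (auto simp: fun_eq_iff group_ring_mult[OF fin] fin)
  qed (auto simp: group_ring_mult[OF fin] basis_elt_def)
qed (auto simp: fun_eq_iff group_ring_mult[OF fin] sum.distrib distrib_left distrib_right)

lemma (in group) set_sum_eq_indicator:
  assumes "finite X" "X \<subseteq> carrier G"
  shows "set_sum G X = indicator X"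
proof -
  interpret abelian_group "group_ring G" by (rule group_ring_abelian_group)
  show ?thesis
    using assms unfolding set_sum_def
  proof (induction X rule: finite_induct)
    case (insert a F)
    then have "(\<Oplus>\<^bsub>group_ring G\<^esub>x\<in>insert a F. basis_elt x) =
        basis_elt a \<oplus>\<^bsub>group_ring G\<^esub> (\<Oplus>\<^bsub>group_ring G\<^esub>x\<in>F. basis_elt x)"
      by (intro finsum_insert) (auto simp: basis_elt_def)
    with insert show ?case by (auto simp: fun_eq_iff basis_elt_def indicator_def)
  qed (auto simp: fun_eq_iff)
qed


section \<open>Schur rings\<close>

text \<open>The \<open>\<int>\<close>-span of a set is the additive subgroup it generates.\<close>

definition schur_partition ::
    "('a, 'b) monoid_scheme \<Rightarrow> ('a \<Rightarrow> int) set \<Rightarrow> 'a set set \<Rightarrow> bool" where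
  "schur_partition D A S \<longleftrightarrow>
     partition_on (carrier D) S \<and>
     {\<one>\<^bsub>D\<^esub>} \<in> S \<and>
     (\<forall>X\<in>S. set_inv\<^bsub>D\<^esub> X \<in> S) \<and>
     A = generate (add_monoid (group_ring D)) (set_sum D ` S)"

definition S_ring :: "('a, 'b) monoid_scheme \<Rightarrow> ('a \<Rightarrow> int) set \<Rightarrow> bool" where
  "S_ring D A \<longleftrightarrow> subring A (group_ring D) \<and> (\<exists>S. schur_partition D A S)"

text \<open>Existence and uniqueness of the partition are shown in \<open>schur_partition_basic_sets\<close>.\<close>

definition basic_sets :: "('a, 'b) monoid_scheme \<Rightarrow> ('a \<Rightarrow> int) set \<Rightarrow> 'a set set" where
  "basic_sets D A = (THE S. schur_partition D A S)"

lemma (in group) schur_partition_const: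
  assumes fin: "finite (carrier G)" and S: "schur_partition G A S"
    and f: "f \<in> A" and X: "X \<in> S" "x \<in> X" "y \<in> X"
  shows "f x = f y"
proof -
  interpret R: abelian_group "group_ring G" by (rule group_ring_abelian_group)
  have ind: "set_sum G Y = indicator Y" "Y \<subseteq> carrier G" if "Y \<in> S" for Y
    using that S fin set_sum_eq_indicator[of Y]
    by (auto simp: schur_partition_def partition_on_def intro: finite_subset)
  have iff: "x \<in> Y \<longleftrightarrow> y \<in> Y" if "Y \<in> S" for Y
    using that S X by (auto simp: schur_partition_def partition_on_def disjoint_def)
  have sub: "set_sum G ` S \<subseteq> carrier (group_ring G)"
    using ind(1) ind(2) by (fastforce simp: indicator_def)
  have "f \<in> generate (add_monoid (group_ring G)) (set_sum G ` S)"
    using f S by (simp add: schur_partition_def)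
  then show ?thesis
  proof (induction rule: generate.induct)
    case one
    then show ?case by simp
  next
    case (incl h)
    then show ?case using ind iff by (auto simp: indicator_def)
  next
    case (inv h)
    then have h: "h \<in> carrier (group_ring G)" using sub by blast
    then have "\<ominus>\<^bsub>group_ring G\<^esub> h = (\<lambda>x. - h x)"
      by (intro R.minus_equality) auto
    then show ?case using inv ind iff by (auto simp: a_inv_def indicator_def)
  next
    case (eng h1 h2)
    then show ?case by simp
  qed
qed

lemma (in group) schur_partition_refines:
  assumes fin: "finite (carrier G)" and S: "schur_partition G A S" and T: "schur_partition G A T"
    and XY: "X \<in> S" "Y \<in> T" "x \<in> X" "x \<in> Y"
  shows "Y \<subseteq> X"
proof
  fix y assume y: "y \<in> Y"
  have "X \<subseteq> carrier G" using S XY by (auto simp: schur_partition_def partition_on_def)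
  then have "set_sum G X = indicator X" using fin by (auto intro: set_sum_eq_indicator finite_subset)
  moreover have "set_sum G X \<in> A"
    using S XY by (auto simp: schur_partition_def intro: generate.incl)
  ultimately have "indicator X x = (indicator X y :: int)"
    using schur_partition_const[OF fin T _ XY(2) XY(4) y] by metis
  with XY show "y \<in> X" by (auto simp: indicator_def split: if_splits)
qed

lemma (in group) schur_partition_subset:
  assumes fin: "finite (carrier G)" and S: "schur_partition G A S" and T: "schur_partition G A T"
  shows "S \<subseteq> T"
proof
  fix X assume X: "X \<in> S"
  with S obtain x where x: "x \<in> X" "x \<in> carrier G"
    by (auto simp: schur_partition_def partition_on_def)
      (metis UnionI all_not_in_conv)
  with T obtain Y where Y: "Y \<in> T" "x \<in> Y"
    by (auto simp: schur_partition_def partition_on_def)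
  have "X = Y"
    using schur_partition_refines[OF fin S T X Y(1) x(1) Y(2)]
      schur_partition_refines[OF fin T S Y(1) X Y(2) x(1)] by blast
  with Y show "X \<in> T" by simp
qed

lemma (in group) schur_partition_basic_sets:
  assumes "finite (carrier G)" "S_ring G A"
  shows "schur_partition G A S \<longleftrightarrow> S = basic_sets G A"
proof -
  have "\<exists>!S. schur_partition G A S"
    using assms schur_partition_subset[OF assms(1)] unfolding S_ring_def by blast
  then show ?thesis unfolding basic_sets_def by (metis theI')
qed


section \<open>Schurian S-rings and Schur groups\<close>

definition right_translation :: "('a, 'b) monoid_scheme \<Rightarrow> 'a \<Rightarrow> 'a \<Rightarrow> 'a" where
  "right_translation D d = (\<lambda>x\<in>carrier D. x \<otimes>\<^bsub>D\<^esub> d)"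

definition stabilizer_orbits ::
    "('a, 'b) monoid_scheme \<Rightarrow> ('a \<Rightarrow> 'a) set \<Rightarrow> 'a set set" where
  "stabilizer_orbits D K =
    (let Sym = BijGroup (carrier D);
         K1 = stabilizer (Sym\<lparr>carrier := K\<rparr>) (\<lambda>g. g) \<one>\<^bsub>D\<^esub>
     in orbits (Sym\<lparr>carrier := K1\<rparr>) (carrier D) (\<lambda>g. g))"

definition schurian :: "('a, 'b) monoid_scheme \<Rightarrow> ('a \<Rightarrow> int) set \<Rightarrow> bool" where
  "schurian D A \<longleftrightarrow>
    (\<exists>K. subgroup K (BijGroup (carrier D)) \<and>
         right_translation D ` carrier D \<subseteq> K \<and>
         basic_sets D A = stabilizer_orbits D K)"

definition Schur_group :: "('a, 'b) monoid_scheme \<Rightarrow> bool" where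
  "Schur_group D \<longleftrightarrow>
    group D \<and> finite (carrier D) \<and> (\<forall>A. S_ring D A \<longrightarrow> schurian D A)"


section \<open>Dihedral groups\<close>

text \<open>
  The finite dihedral groups, given by the presentation
  \<open>\<langle>r, s | r\<^sup>n = s\<^sup>2 = 1, s r s = r\<^sup>-\<^sup>1\<rangle>\<close>. The relations bound the order by \<open>2 n\<close>, so that
  requiring equality says that no further relations hold. The degenerate cases \<open>n = 1, 2\<close>,
  which are abelian, are included.
\<close>

definition dihedral :: "('a, 'b) monoid_scheme \<Rightarrow> bool" where
  "dihedral D \<longleftrightarrow>
    group D \<and>
    (\<exists>(n::nat) r s. n \<ge> 1 \<and> r \<in> carrier D \<and> s \<in> carrier D \<and>
       generate D {r, s} = carrier D \<and>
       r [^]\<^bsub>D\<^esub> n = \<one>\<^bsub>D\<^esub> \<and> s [^]\<^bsub>D\<^esub> (2::nat) = \<one>\<^bsub>D\<^esub> \<and>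
       s \<otimes>\<^bsub>D\<^esub> r \<otimes>\<^bsub>D\<^esub> s = inv\<^bsub>D\<^esub> r \<and>
       order D = 2 * n)"

end

theory Submission
  imports Defs "HOL-Algebra.Multiplicative_Group" "HOL-Computational_Algebra.Primes" "HOL-Library.Multiset"
begin

text \<open>
  A Schur group has the following property: if \<open>c\<close> colours \<open>D\<close> by the basic sets of an S-ring and
  \<open>c x = c y\<close>, then some map \<open>k\<close> with \<open>k 1 = 1\<close> and \<open>k x = y\<close> preserves all colours \<open>c (p q\<^sup>-\<^sup>1)\<close>.
  This property passes to subgroups and quotients, and it fails as soon as some configuration
  \<open>(u, v)\<close> seen from \<open>(1, x)\<close> is not seen from \<open>(1, y)\<close>. Configurations of this kind exclude nine groups
  of order 16, and also every group with a normal four-group \<open>V\<close> that is centralized by neither the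
  group nor some \<open>a\<close> with \<open>a\<^sup>4 \<notin> V\<close>; the latter covers the modular groups of order at least 32. A
  2-group of order at least 32 without such sections is, if it has exponent at most 4, elementary
  abelian; otherwise one climbs from a cyclic subgroup of order at least 8 through subgroups of
  index 2 and finds a cyclic subgroup of index at most 2 at each stage.
\<close>

section \<open>Colourings of a group by the basic sets of an S-ring\<close>

text \<open>What is inherited and refuted is a single map preserving the colours of all quotients p
  q^-1: it restricts to subgroups, projects to quotients, and can be refuted on the four points 1,
  x, u, v. A colouring lifts because each lift adds only one class: the complement of a subgroup, or
  the nontrivial elements of a kernel. The bound 32 enters only for exponent at most 4, where
  centralizers of index at most 2 must contain more than 8 elements. The excluded groups of order 16
  arise by adjoining one element to C4 x C2 or to C8; over C8 only abelian and dihedral extensions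
  survive. The larger quaternion and semidihedral groups contain a generalized quaternion group of
  order 16. The modular groups contain no modular group of smaller order with the same shape, hence
  the separate construction with a four-group V; it breaks down at order 16, where a^4 falls into V,
  so that this order needs a table. In the climb the delicate case is a dihedral subgroup of index
  2: its elements outside the cyclic part are involutions that invert, and this forces some new
  element to centralize the cyclic part.\<close>

definition class_function :: "('a, 'b) monoid_scheme \<Rightarrow> ('a \<Rightarrow> 'c) \<Rightarrow> ('a \<Rightarrow> int) \<Rightarrow> bool" where
  "class_function G c f \<longleftrightarrow> (\<forall>x\<in>carrier G. \<forall>y\<in>carrier G. c x = c y \<longrightarrow> f x = f y)"

text \<open>On the carrier this is the product of the group ring. Values outside the carrier are
  left free, and \<open>class_function\<close> accordingly looks only inside.\<close>

definition conv :: "('a, 'b) monoid_scheme \<Rightarrow> ('a \<Rightarrow> int) \<Rightarrow> ('a \<Rightarrow> int) \<Rightarrow> 'a \<Rightarrow> int" where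
  "conv G f g y = (\<Sum>x\<in>carrier G. f x * g (inv\<^bsub>G\<^esub> x \<otimes>\<^bsub>G\<^esub> y))"

text \<open>The S-ring axioms, read off from the partition into colour classes; the last clause says
  that the span of the class sums is closed under multiplication. Only equality of colours
  matters.\<close>

definition s_coloring :: "('a, 'b) monoid_scheme \<Rightarrow> ('a \<Rightarrow> 'c) \<Rightarrow> bool" where
  "s_coloring G c \<longleftrightarrow>
     (\<forall>x\<in>carrier G. c x = c \<one>\<^bsub>G\<^esub> \<longrightarrow> x = \<one>\<^bsub>G\<^esub>) \<and>
     (\<forall>x\<in>carrier G. \<forall>y\<in>carrier G. c x = c y \<longrightarrow> c (inv\<^bsub>G\<^esub> x) = c (inv\<^bsub>G\<^esub> y)) \<and>
     (\<forall>f g. class_function G c f \<longrightarrow> class_function G c g \<longrightarrow> class_function G c (conv G f g))"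

lemma class_functionD:
  "class_function G c f \<Longrightarrow> x \<in> carrier G \<Longrightarrow> y \<in> carrier G \<Longrightarrow> c x = c y \<Longrightarrow> f x = f y"
  unfolding class_function_def by blast

lemma s_coloringD:
  assumes "s_coloring G c"
  shows "x \<in> carrier G \<Longrightarrow> c x = c \<one>\<^bsub>G\<^esub> \<Longrightarrow> x = \<one>\<^bsub>G\<^esub>"
    and "x \<in> carrier G \<Longrightarrow> y \<in> carrier G \<Longrightarrow> c x = c y \<Longrightarrow> c (inv\<^bsub>G\<^esub> x) = c (inv\<^bsub>G\<^esub> y)"
    and "class_function G c f \<Longrightarrow> class_function G c g \<Longrightarrow> class_function G c (conv G f g)"
  using assms unfolding s_coloring_def by blast+

text \<open>The map \<open>k\<close> stands for an element of the stabilizer of the identity in a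
  group containing the right translations. Such a group preserves the colour of p q^-1 because a
  right translation moves the pair (p, q) to (p q^-1, 1).\<close>

definition color_transitive :: "('a, 'b) monoid_scheme \<Rightarrow> ('a \<Rightarrow> 'c) \<Rightarrow> bool" where
  "color_transitive G c \<longleftrightarrow>
     (\<forall>x\<in>carrier G. \<forall>y\<in>carrier G. c x = c y \<longrightarrow>
        (\<exists>k\<in>carrier G \<rightarrow> carrier G. k \<one>\<^bsub>G\<^esub> = \<one>\<^bsub>G\<^esub> \<and> k x = y \<and>
           (\<forall>p\<in>carrier G. \<forall>q\<in>carrier G.
              c (k p \<otimes>\<^bsub>G\<^esub> inv\<^bsub>G\<^esub> k q) = c (p \<otimes>\<^bsub>G\<^esub> inv\<^bsub>G\<^esub> q))))"

definition weakly_Schur :: "('a, 'b) monoid_scheme \<Rightarrow> bool" where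
  "weakly_Schur G \<longleftrightarrow> (\<forall>c :: 'a \<Rightarrow> nat. s_coloring G c \<longrightarrow> color_transitive G c)"

text \<open>A function constant on the classes is the sum of the class indicators weighted by its
  values, so the ring of class functions coincides with the additive group generated by the class
  sums.\<close>

lemma (in group) s_coloring_S_ring:
  fixes c :: "'a \<Rightarrow> 'c"
  assumes fin: "finite (carrier G)" and c: "s_coloring G c"
  defines "S \<equiv> (\<lambda>x. {y\<in>carrier G. c y = c x}) ` carrier G"
    and "A \<equiv> {f :: 'a \<Rightarrow> int. (\<forall>x. x \<notin> carrier G \<longrightarrow> f x = 0) \<and>
                (\<forall>x\<in>carrier G. \<forall>y\<in>carrier G. c x = c y \<longrightarrow> f x = f y)}"
  shows "subring A (group_ring G)" "schur_partition G A S"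
proof -
  interpret R: ring "group_ring G" by (rule group_ring_ring[OF fin])
  have c1: "\<And>x. x \<in> carrier G \<Longrightarrow> c x = c \<one> \<Longrightarrow> x = \<one>"
    and c2: "\<And>x y. x \<in> carrier G \<Longrightarrow> y \<in> carrier G \<Longrightarrow> c x = c y \<Longrightarrow> c (inv x) = c (inv y)"
    and c3: "\<And>f g. class_function G c f \<Longrightarrow> class_function G c g \<Longrightarrow> class_function G c (conv G f g)"
    using c unfolding s_coloring_def by blast+
  have minus: "\<ominus>\<^bsub>group_ring G\<^esub> f = (\<lambda>x. - f x)" if "\<And>x. x \<notin> carrier G \<Longrightarrow> f x = 0" for f
    by (rule R.minus_equality) (use that in auto)
  have mult: "f \<otimes>\<^bsub>group_ring G\<^esub> g \<in> A" if f: "f \<in> A" and g: "g \<in> A" for f g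
  proof -
    have "class_function G c (conv G f g)"
      using f g unfolding A_def class_function_def mem_Collect_eq by (intro c3[unfolded class_function_def]) blast+
    moreover have "(f \<otimes>\<^bsub>group_ring G\<^esub> g) z = (if z \<in> carrier G then conv G f g z else 0)" for z
      by (simp add: group_ring_mult[OF fin] conv_def)
    ultimately show ?thesis
      unfolding A_def class_function_def mem_Collect_eq by metis
  qed
  show "subring A (group_ring G)"
  proof (rule R.subringI)
    show "A \<subseteq> carrier (group_ring G)" by (auto simp: A_def)
    show "\<one>\<^bsub>group_ring G\<^esub> \<in> A" using c1 by (auto simp: A_def basis_elt_def)
    show "\<ominus>\<^bsub>group_ring G\<^esub> f \<in> A" if "f \<in> A" for f
    proof -
      have "\<ominus>\<^bsub>group_ring G\<^esub> f = (\<lambda>x. - f x)" using that by (intro minus) (simp add: A_def)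
      moreover have "(\<lambda>x. - f x) \<in> A"
        using that unfolding A_def mem_Collect_eq by (metis neg_0_equal_iff_equal)
      ultimately show ?thesis by simp
    qed
    show "f \<oplus>\<^bsub>group_ring G\<^esub> g \<in> A" if "f \<in> A" "g \<in> A" for f g
      using that unfolding A_def mem_Collect_eq group_ring_simps by (metis add_0)
  qed (rule mult)
  define gen where "gen = generate (add_monoid (group_ring G)) (set_sum G ` S)"
  have SS: "X \<subseteq> carrier G" "finite X" if "X \<in> S" for X
    using that fin by (auto simp: S_def)
  have ind: "set_sum G X = indicator X" if "X \<in> S" for X
    using SS[OF that] by (rule set_sum_eq_indicator[rotated])
  have g0: "(\<lambda>x. 0) \<in> gen" unfolding gen_def using generate.one[of "add_monoid (group_ring G)"] by simp
  have gadd: "(\<lambda>x. f x + g x) \<in> gen" if "f \<in> gen" "g \<in> gen" for f g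
    using generate.eng[of f "add_monoid (group_ring G)" "set_sum G ` S" g] that by (simp add: gen_def)
  have gind: "indicator X \<in> gen" if "X \<in> S" for X
    unfolding gen_def using that ind[OF that] by (metis generate.incl image_eqI)
  have gmin: "(\<lambda>x. - indicator X x) \<in> gen" if X: "X \<in> S" for X
  proof -
    have "\<ominus>\<^bsub>group_ring G\<^esub> (indicator X) \<in> gen"
      unfolding gen_def a_inv_def using X ind[OF X] by (metis generate.inv image_eqI)
    moreover have "\<ominus>\<^bsub>group_ring G\<^esub> (indicator X) = (\<lambda>x. - indicator X x)"
      by (rule minus) (use SS[OF X] in \<open>auto simp: indicator_def\<close>)
    ultimately show ?thesis by simp
  qed
  \<comment> \<open>The generated group is known only through its generators and their negatives, so
    integer multiples are built up by induction in both directions.\<close>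
  have gnat: "(\<lambda>x. int n * indicator X x) \<in> gen" "(\<lambda>x. - (int n * indicator X x)) \<in> gen" if X: "X \<in> S" for n X
  proof (induction n)
    case (Suc n)
    { case 1 show ?case using gadd[OF Suc(1) gind[OF X]] by (simp add: algebra_simps) }
    { case 2 show ?case using gadd[OF Suc(2) gmin[OF X]] by (simp add: algebra_simps) }
  qed (use g0 in auto)
  have gint: "(\<lambda>x. n * indicator X x) \<in> gen" if X: "X \<in> S" for n X
    using gnat[OF X, of "nat \<bar>n\<bar>"] by (cases "n \<ge> 0") auto
  have gsum: "(\<lambda>x. \<Sum>X\<in>T. v X * indicator X x) \<in> gen" if "T \<subseteq> S" "finite T" for T and v :: "'a set \<Rightarrow> int"
    using that(2,1) by (induction T rule: finite_induct) (auto intro!: g0 gadd gint)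
  have finS: "finite S" using fin by (simp add: S_def)
  have part: "partition_on (carrier G) S"
    unfolding partition_on_def S_def disjoint_def by auto
  have cls: "{y\<in>carrier G. c y = c x} \<in> S" if "x \<in> carrier G" for x using that by (auto simp: S_def)
  have "f \<in> gen" if f: "f \<in> A" for f
  proof -
    \<comment> \<open>The coefficient of a class is the value of f at an arbitrarily chosen
      member.\<close>
    have "f = (\<lambda>x. \<Sum>X\<in>S. f (SOME y. y \<in> X) * indicator X x)"
    proof
      fix x
      show "f x = (\<Sum>X\<in>S. f (SOME y. y \<in> X) * indicator X x)"
      proof (cases "x \<in> carrier G")
        case False
        then have "(\<Sum>X\<in>S. f (SOME y. y \<in> X) * indicator X x) = 0"
          using SS by (intro sum.neutral) (auto simp: indicator_def)
        then show ?thesis using False f by (simp add: A_def)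
      next
        case True
        let ?X = "{y\<in>carrier G. c y = c x}"
        have "(\<Sum>X\<in>S. f (SOME y. y \<in> X) * indicator X x) = (\<Sum>X\<in>S. if X = ?X then f (SOME y. y \<in> ?X) else 0)"
          using True by (intro sum.cong) (auto simp: S_def indicator_def)
        also have "\<dots> = f (SOME y. y \<in> ?X)" using finS cls[OF True] by simp
        also have "\<dots> = f x"
        proof -
          have "(SOME y. y \<in> ?X) \<in> ?X" by (rule someI[of _ x]) (use True in auto)
          then show ?thesis using f True unfolding A_def mem_Collect_eq by blast
        qed
        finally show ?thesis by simp
      qed
    qed
    also have "\<dots> \<in> gen" by (rule gsum) (use finS in auto)
    finally show ?thesis .
  qed
  moreover have "f \<in> A" if "f \<in> gen" for f
    using that unfolding gen_def
  proof (induction rule: generate.induct)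
    case one show ?case by (simp add: A_def)
  next
    case (incl h)
    then obtain X where X: "X \<in> S" "h = indicator X" using ind by auto
    then show ?case by (auto simp: A_def S_def indicator_def)
  next
    case (inv h)
    then obtain X where X: "X \<in> S" "h = indicator X" using ind by auto
    then have "m_inv (add_monoid (group_ring G)) h = (\<lambda>x. - h x)"
      using minus[of h] SS[of X] by (auto simp: a_inv_def indicator_def)
    then show ?case using X by (auto simp: A_def S_def indicator_def)
  next
    case (eng f g)
    have "(\<lambda>x. f x + g x) \<in> A"
      using eng.IH unfolding A_def mem_Collect_eq by (metis add_0)
    then show ?case by simp
  qed
  ultimately have "A = gen" by blast
  moreover have "{\<one>} \<in> S"
  proof -
    have "{y\<in>carrier G. c y = c \<one>} = {\<one>}" using c1 by auto
    then show ?thesis using cls[of \<one>] by simp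
  qed
  moreover have "set_inv X \<in> S" if X: "X \<in> S" for X
  proof -
    obtain x where x: "x \<in> carrier G" "X = {y\<in>carrier G. c y = c x}" using X by (auto simp: S_def)
    have "set_inv X = {y\<in>carrier G. c y = c (inv x)}"
    proof (intro equalityI subsetI)
      fix y assume "y \<in> set_inv X"
      then obtain h where h: "h \<in> carrier G" "c h = c x" "y = inv h" using x by (auto simp: SET_INV_def)
      then show "y \<in> {y\<in>carrier G. c y = c (inv x)}" using c2[OF h(1) x(1) h(2)] by simp
    next
      fix y assume y: "y \<in> {y\<in>carrier G. c y = c (inv x)}"
      then have "inv y \<in> X" using x c2[of y "inv x"] by simp
      then show "y \<in> set_inv X" using y unfolding SET_INV_def by (auto intro!: bexI[of _ "inv y"])
    qed
    then show ?thesis using cls[of "inv x"] x by simp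
  qed
  ultimately show "schur_partition G A S"
    unfolding schur_partition_def using part by (auto simp: gen_def)
qed

text \<open>The classes are the orbits of the stabilizer of the identity in a group
  \<open>K\<close>, so equal colours are joined by some \<open>k\<close> in it. That
  \<open>k\<close> also preserves the colours of quotients is seen by combining it with right
  translations from \<open>K\<close>.\<close>

lemma (in group) Schur_group_color_transitive:
  assumes Schur: "Schur_group G" and c: "s_coloring G c"
  shows "color_transitive G c"
  unfolding color_transitive_def
proof (intro ballI impI)
  fix x y assume x: "x \<in> carrier G" and y: "y \<in> carrier G" and xy: "c x = c y"
  have fin: "finite (carrier G)" using Schur by (simp add: Schur_group_def)
  define S where "S = (\<lambda>x. {y\<in>carrier G. c y = c x}) ` carrier G"
  define A where "A = {f :: 'a \<Rightarrow> int. (\<forall>x. x \<notin> carrier G \<longrightarrow> f x = 0) \<and>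
                (\<forall>x\<in>carrier G. \<forall>y\<in>carrier G. c x = c y \<longrightarrow> f x = f y)}"
  have A: "subring A (group_ring G)" and S: "schur_partition G A S"
    unfolding A_def S_def by (rule s_coloring_S_ring[OF fin c])+
  then have SR: "S_ring G A" by (auto simp: S_ring_def)
  then have bs: "basic_sets G A = S" using schur_partition_basic_sets[OF fin SR] S by simp
  obtain K where K: "subgroup K (BijGroup (carrier G))" "right_translation G ` carrier G \<subseteq> K"
    and orb: "S = stabilizer_orbits G K"
    using Schur SR bs unfolding Schur_group_def schurian_def by metis
  have KB: "k \<in> Bij (carrier G)" if "k \<in> K" for k
    using subgroup.subset[OF K(1)] that by (auto simp: BijGroup_def)
  have Kc: "k p \<in> carrier G" if "k \<in> K" "p \<in> carrier G" for k p
    using KB[OF that(1)] that(2) by (auto simp: Bij_def bij_betw_def)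
  have Kcomp: "compose (carrier G) k l \<in> K" if "k \<in> K" "l \<in> K" for k l
    using subgroup.m_closed[OF K(1) that] KB that by (simp add: BijGroup_def)
  have orbS: "S = {{k p |k. k \<in> K \<and> k \<one> = \<one>} |p. p \<in> carrier G}"
    unfolding orb stabilizer_orbits_def Let_def orbits_def orbit_def stabilizer_def by (simp cong: conj_cong)
  have idK: "(\<lambda>x\<in>carrier G. x) \<in> K" using subgroup.one_closed[OF K(1)] by (simp add: BijGroup_def)
  have same: "{k p |k. k \<in> K \<and> k \<one> = \<one>} = {q\<in>carrier G. c q = c p}" if p: "p \<in> carrier G" for p
  proof -
    have pin: "p \<in> {k p |k. k \<in> K \<and> k \<one> = \<one>}"
      using idK p by (auto intro!: exI[of _ "\<lambda>x\<in>carrier G. x"])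
    have "{k p |k. k \<in> K \<and> k \<one> = \<one>} \<in> S" using orbS p by auto
    then obtain x where x: "{k p |k. k \<in> K \<and> k \<one> = \<one>} = {y\<in>carrier G. c y = c x}"
      unfolding S_def by (rule imageE)
    then have "c p = c x" using pin by simp
    then show ?thesis using x by simp
  qed
  have "y \<in> {k x |k. k \<in> K \<and> k \<one> = \<one>}" unfolding same[OF x] using y xy by auto
  then obtain k where k: "k \<in> K" "k \<one> = \<one>" "k x = y" by auto
  have "c (k p \<otimes> inv (k q)) = c (p \<otimes> inv q)" if p: "p \<in> carrier G" and q: "q \<in> carrier G" for p q
  proof -
    \<comment> \<open>\<open>l\<close> sends t to k(t q) k(q)^-1. It therefore fixes the identity
      and takes p q^-1 to k(p) k(q)^-1, which puts both into one orbit.\<close>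
    define l where "l = compose (carrier G) (right_translation G (inv (k q)))
        (compose (carrier G) k (right_translation G q))"
    have "l \<in> K" unfolding l_def using K(2) q Kc[OF k(1)] by (auto intro!: Kcomp k)
    moreover have "l \<one> = \<one>" using q Kc[OF k(1)] by (simp add: l_def compose_def right_translation_def)
    moreover have "l (p \<otimes> inv q) = k p \<otimes> inv (k q)"
      using p q Kc[OF k(1)] by (simp add: l_def compose_def right_translation_def m_assoc)
    ultimately have "k p \<otimes> inv (k q) \<in> {k (p \<otimes> inv q) |k. k \<in> K \<and> k \<one> = \<one>}" by (metis (mono_tags, lifting) mem_Collect_eq)
    then show ?thesis using same[of "p \<otimes> inv q"] p q by auto
  qed
  then show "\<exists>k\<in>carrier G \<rightarrow> carrier G. k \<one> = \<one> \<and> k x = y \<and>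
           (\<forall>p\<in>carrier G. \<forall>q\<in>carrier G. c (k p \<otimes> inv k q) = c (p \<otimes> inv q))"
    using k Kc by (intro bexI[of _ k]) auto
qed

lemma (in group) Schur_group_imp_weakly_Schur: "Schur_group G \<Longrightarrow> weakly_Schur G"
  by (simp add: weakly_Schur_def Schur_group_color_transitive)


section \<open>Subgroups and homomorphic images\<close>

lemma weakly_SchurD:
  fixes G (structure) and c :: "'a \<Rightarrow> nat"
  assumes "weakly_Schur G" "s_coloring G c" "x \<in> carrier G" "y \<in> carrier G" "c x = c y"
  shows "\<exists>k. k \<in> carrier G \<rightarrow> carrier G \<and> k \<one> = \<one> \<and> k x = y \<and>
    (\<forall>p\<in>carrier G. \<forall>q\<in>carrier G.
       c (k p \<otimes> inv k q) = c (p \<otimes> inv q))"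
  using assms unfolding weakly_Schur_def color_transitive_def by blast

lemma s_coloring_comp:
  fixes G (structure)
  assumes "inj_on h (c ` carrier G)" and c: "s_coloring G c" and G: "group G"
  shows "s_coloring G (h \<circ> c)"
proof -
  interpret group G by fact
  have eq: "h (c x) = h (c y) \<longleftrightarrow> c x = c y" if "x \<in> carrier G" "y \<in> carrier G" for x y
    using assms(1) that by (auto simp: inj_on_def)
  have cf: "class_function G (h \<circ> c) = class_function G c"
    unfolding class_function_def by (intro ext) (simp add: eq cong: ball_cong)
  show ?thesis
    unfolding s_coloring_def cf o_apply
  proof (intro conjI ballI impI)
    fix x assume "x \<in> carrier G" "h (c x) = h (c \<one>)"
    then show "x = \<one>" using c eq[of x "\<one>"] unfolding s_coloring_def by blast
  next
    fix x y assume "x \<in> carrier G" "y \<in> carrier G" "h (c x) = h (c y)"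
    then have "c (inv x) = c (inv y)" using c eq[of x y] unfolding s_coloring_def by blast
    then show "h (c (inv x)) = h (c (inv y))" by simp
  qed (use c in \<open>unfold s_coloring_def, blast\<close>)
qed

text \<open>The restriction to colours in \<open>nat\<close> in the definition is inessential for finite groups.\<close>

lemma weakly_Schur_color_transitive:
  fixes G (structure)
  assumes G: "group G" and fin: "finite (carrier G)" and W: "weakly_Schur G" and c: "s_coloring G c"
  shows "color_transitive G c"
proof -
  interpret group G by fact
  obtain h :: "_ \<Rightarrow> nat" where h: "inj_on h (c ` carrier G)"
    using finite_imp_inj_to_nat_seg[of "c ` carrier G"] fin by auto
  have "color_transitive G (h \<circ> c)"
    using W s_coloring_comp[OF h c G] by (simp add: weakly_Schur_def)
  moreover have eq: "h (c x) = h (c y) \<longleftrightarrow> c x = c y" if "x \<in> carrier G" "y \<in> carrier G" for x y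
    using h that by (auto simp: inj_on_def)
  ultimately have *: "\<exists>k\<in>carrier G \<rightarrow> carrier G. k \<one> = \<one> \<and> k x = y \<and>
      (\<forall>p\<in>carrier G. \<forall>q\<in>carrier G. h (c (k p \<otimes> inv k q)) = h (c (p \<otimes> inv q)))"
    if "x \<in> carrier G" "y \<in> carrier G" "c x = c y" for x y
    using that unfolding color_transitive_def o_apply by metis
  show ?thesis
    unfolding color_transitive_def
  proof (intro ballI impI)
    fix x y assume xy: "x \<in> carrier G" "y \<in> carrier G" "c x = c y"
    obtain k where k: "k \<in> carrier G \<rightarrow> carrier G" "k \<one> = \<one>" "k x = y"
      "\<And>p q. p \<in> carrier G \<Longrightarrow> q \<in> carrier G \<Longrightarrow> h (c (k p \<otimes> inv k q)) = h (c (p \<otimes> inv q))"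
      using *[OF xy] by blast
    have "c (k p \<otimes> inv k q) = c (p \<otimes> inv q)" if "p \<in> carrier G" "q \<in> carrier G" for p q
      using k(1) k(4)[OF that] that by (subst (asm) eq) auto
    then show "\<exists>k\<in>carrier G \<rightarrow> carrier G. k \<one> = \<one> \<and> k x = y \<and>
      (\<forall>p\<in>carrier G. \<forall>q\<in>carrier G. c (k p \<otimes> inv k q) = c (p \<otimes> inv q))"
      using k by blast
  qed
qed

lemma (in group) sum_translate:
  assumes "y \<in> carrier G"
  shows "(\<Sum>x\<in>carrier G. f (inv x \<otimes> y)) = (\<Sum>x\<in>carrier G. f x)"
  by (rule sum.reindex_bij_witness[where i = "\<lambda>x. y \<otimes> inv x" and j = "\<lambda>x. inv x \<otimes> y"])
     (use assms in \<open>auto simp: inv_mult_group m_assoc[symmetric]\<close>, auto simp: m_assoc)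

text \<open>The colouring \<open>d\<close> gives all elements outside H the new colour 0. Its class
  functions are class functions on H plus constants, and convolving with a constant gives a
  constant; thus convolution in G reduces to convolution in H. A map that preserves \<open>d\<close>
  preserves H and restricts to it.\<close>

lemma (in group) weakly_Schur_subgroup:
  assumes fin: "finite (carrier G)" and W: "weakly_Schur G" and H: "subgroup H G"
  shows "weakly_Schur (G\<lparr>carrier := H\<rparr>)"
  unfolding weakly_Schur_def
proof (intro allI impI)
  fix c :: "'a \<Rightarrow> nat"
  let ?K = "G\<lparr>carrier := H\<rparr>"
  assume c: "s_coloring ?K c"
  interpret H: subgroup H G by fact
  interpret K: group ?K by (rule subgroup_imp_group[OF H])
  have invK: "inv\<^bsub>?K\<^esub> x = inv x" if "x \<in> H" for x using m_inv_consistent[OF H that] .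
  have HG: "x \<in> carrier G" if "x \<in> H" for x using that H.subset by auto
  define d where "d x = (if x \<in> H then Suc (c x) else 0)" for x
  have dH: "d x = d y \<Longrightarrow> x \<in> H \<longleftrightarrow> y \<in> H" for x y by (auto simp: d_def split: if_splits)
  have dc: "d x = d y \<longleftrightarrow> c x = c y" if "x \<in> H" "y \<in> H" for x y using that by (auto simp: d_def)
  have c1: "x = \<one>" if "x \<in> H" "c x = c \<one>" for x
    using s_coloringD(1)[OF c, of x] that by simp
  have c2: "c (inv x) = c (inv y)" if "x \<in> H" "y \<in> H" "c x = c y" for x y
    using s_coloringD(2)[OF c, of x y] that by (simp add: invK)
  note c3 = s_coloringD(3)[OF c]
  have "s_coloring G d"
    unfolding s_coloring_def
  proof (intro conjI ballI impI allI)
    fix x assume "d x = d \<one>"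
    then show "x = \<one>" using c1[of x] by (auto simp: d_def split: if_splits)
  next
    fix x y assume xy: "x \<in> carrier G" "y \<in> carrier G" "d x = d y"
    show "d (inv x) = d (inv y)"
    proof (cases "x \<in> H")
      case True
      then show ?thesis using dH[OF xy(3)] xy c2[of x y] by (simp add: d_def)
    next
      case False
      then have "inv x \<notin> H" "inv y \<notin> H" using xy dH[OF xy(3)] H.m_inv_closed by fastforce+
      then show ?thesis by (simp add: d_def)
    qed
  next
    fix f g assume f: "class_function G d f" and g: "class_function G d g"
    have out: "\<exists>\<alpha>. \<forall>x\<in>carrier G - H. f x = \<alpha>" if "class_function G d f" for f
    proof (cases "\<exists>x. x \<in> carrier G - H")
      case True
      then obtain x where x: "x \<in> carrier G - H" by blast
      have "f y = f x" if "y \<in> carrier G - H" for y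
        using class_functionD[OF \<open>class_function G d f\<close>, of y x] x that by (simp add: d_def)
      then show ?thesis by blast
    qed auto
    obtain \<alpha> \<beta> where \<alpha>: "\<And>x. x \<in> carrier G - H \<Longrightarrow> f x = \<alpha>" and \<beta>: "\<And>x. x \<in> carrier G - H \<Longrightarrow> g x = \<beta>"
      using out[OF f] out[OF g] by blast
    \<comment> \<open>Subtracting the common value outside H leaves a function supported on H. If H
      is the whole group, the constant may be anything.\<close>
    define f1 where "f1 x = (if x \<in> H then f x - \<alpha> else 0)" for x
    define g1 where "g1 x = (if x \<in> H then g x - \<beta> else 0)" for x
    have f1: "f x = f1 x + \<alpha>" if "x \<in> carrier G" for x using \<alpha> that by (auto simp: f1_def)
    have g1: "g x = g1 x + \<beta>" if "x \<in> carrier G" for x using \<beta> that by (auto simp: g1_def)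
    have cf: "class_function ?K c (\<lambda>x. if x \<in> H then f x - \<alpha> else 0)" if f: "class_function G d f" for f \<alpha>
      unfolding class_function_def
    proof (intro ballI impI)
      fix x y assume xy: "x \<in> carrier ?K" "y \<in> carrier ?K" "c x = c y"
      then have "f x = f y" by (intro class_functionD[OF f]) (simp_all add: HG dc)
      then show "(if x \<in> H then f x - \<alpha> else 0) = (if y \<in> H then f y - \<alpha> else 0)" using xy by simp
    qed
    have cf: "class_function ?K c f1" "class_function ?K c g1"
      using cf[OF f, of \<alpha>] cf[OF g, of \<beta>] by (simp_all add: f1_def[abs_def] g1_def[abs_def])
    have eq: "conv G f g y = conv G f1 g1 y + \<beta> * (\<Sum>x\<in>carrier G. f1 x) + \<alpha> * (\<Sum>x\<in>carrier G. g1 x) +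
        \<alpha> * \<beta> * int (card (carrier G))" if y: "y \<in> carrier G" for y
    proof -
      have "conv G f g y = (\<Sum>x\<in>carrier G. (f1 x + \<alpha>) * (g1 (inv x \<otimes> y) + \<beta>))"
        unfolding conv_def using y by (intro sum.cong) (simp_all add: f1 g1)
      also have "\<dots> = conv G f1 g1 y + \<beta> * (\<Sum>x\<in>carrier G. f1 x) + \<alpha> * (\<Sum>x\<in>carrier G. g1 (inv x \<otimes> y)) +
        \<alpha> * \<beta> * int (card (carrier G))"
        by (simp add: conv_def algebra_simps sum.distrib sum_distrib_left)
      finally show ?thesis using y by (simp add: sum_translate)
    qed
    have in0: "conv G f1 g1 y = conv ?K f1 g1 y" if "y \<in> H" for y
      unfolding conv_def using that H.subset fin invK
      by (simp, intro sum.mono_neutral_cong_right) (auto simp: f1_def)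
    have out0: "conv G f1 g1 y = 0" if y: "y \<in> carrier G" "y \<notin> H" for y
      unfolding conv_def
    proof (rule sum.neutral, intro ballI)
      fix x assume x: "x \<in> carrier G"
      have "\<not> (x \<in> H \<and> inv x \<otimes> y \<in> H)"
      proof
        assume a: "x \<in> H \<and> inv x \<otimes> y \<in> H"
        then have "x \<otimes> (inv x \<otimes> y) \<in> H" by blast
        then show False using x y by (simp add: m_assoc[symmetric])
      qed
      then show "f1 x * g1 (inv x \<otimes> y) = 0" by (auto simp: f1_def g1_def)
    qed
    show "class_function G d (conv G f g)"
      unfolding class_function_def
    proof (intro ballI impI)
      fix x y assume xy: "x \<in> carrier G" "y \<in> carrier G" "d x = d y"
      show "conv G f g x = conv G f g y"
      proof (cases "x \<in> H")
        case True
        then have "y \<in> H" using dH[OF xy(3)] by simp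
        then have "conv ?K f1 g1 x = conv ?K f1 g1 y"
          using class_functionD[OF c3[OF cf], of x y] True dc[of x y] xy(3) by simp
        then show ?thesis using True \<open>y \<in> H\<close> xy by (simp add: eq in0)
      next
        case False
        then show ?thesis using xy dH[OF xy(3)] by (simp add: eq out0)
      qed
    qed
  qed
  note d = this
  show "color_transitive ?K c"
    unfolding color_transitive_def
  proof (intro ballI impI)
    fix x y assume xy: "x \<in> carrier ?K" "y \<in> carrier ?K" "c x = c y"
    then have "x \<in> H" "y \<in> H" "d x = d y" by (auto simp: dc)
    from weakly_SchurD[OF W d HG[OF this(1)] HG[OF this(2)] this(3)]
    obtain k where k: "k \<in> carrier G \<rightarrow> carrier G" "k \<one> = \<one>" "k x = y"
      "\<And>p q. p \<in> carrier G \<Longrightarrow> q \<in> carrier G \<Longrightarrow> d (k p \<otimes> inv k q) = d (p \<otimes> inv q)"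
      by blast
    have kH: "k p \<in> H" if "p \<in> H" for p
      using k(4)[of p \<one>] k(2) that HG[OF that] dH[of "k p" p] funcset_mem[OF k(1), of p] by simp
    have "c (k p \<otimes> inv k q) = c (p \<otimes> inv q)" if "p \<in> H" "q \<in> H" for p q
      using k(4)[OF HG HG, OF that] dc[of "k p \<otimes> inv k q" "p \<otimes> inv q"] kH that by simp
    then show "\<exists>k\<in>carrier ?K \<rightarrow> carrier ?K. k \<one>\<^bsub>?K\<^esub> = \<one>\<^bsub>?K\<^esub> \<and> k x = y \<and>
        (\<forall>p\<in>carrier ?K. \<forall>q\<in>carrier ?K. c (k p \<otimes>\<^bsub>?K\<^esub> inv\<^bsub>?K\<^esub> k q) = c (p \<otimes>\<^bsub>?K\<^esub> inv\<^bsub>?K\<^esub> q))"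
      using k kH by (intro bexI[of _ k]) (auto simp: invK)
  qed
qed

text \<open>Colour 0 is kept for the identity and colour 1 for the rest of the kernel; all other
  elements inherit the colour of their image. The class functions of \<open>d\<close> are pullbacks
  from Q with a correction at the identity, so a convolution in G is the kernel order times a
  convolution in Q, plus multiples of the two factors, plus a correction at the identity. A map on Q
  is obtained by lifting with the section \<open>sel\<close>, applying \<open>k\<close> and
  projecting.\<close>

lemma weakly_Schur_hom_image:
  fixes G (structure)
  assumes G: "group G" and Q: "group Q" and fin: "finite (carrier G)" and W: "weakly_Schur G"
    and hom: "\<phi> \<in> hom G Q" and surj: "\<phi> ` carrier G = carrier Q"
  shows "weakly_Schur Q"
  unfolding weakly_Schur_def
proof (intro allI impI)
  fix c :: "_ \<Rightarrow> nat"
  assume c: "s_coloring Q c"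
  interpret G: group G by fact
  interpret Q: group Q by fact
  interpret h: group_hom G Q \<phi> by unfold_locales (rule hom)
  have finQ: "finite (carrier Q)" using fin surj by (metis finite_imageI)
  note c1 = s_coloringD(1)[OF c] and c2 = s_coloringD(2)[OF c] and c3 = s_coloringD(3)[OF c]
  define d where "d x = (if x = \<one> then 0 else if \<phi> x = \<one>\<^bsub>Q\<^esub> then 1 else Suc (Suc (c (\<phi> x))))" for x
  have d1: "d x = d \<one> \<Longrightarrow> x = \<one>" for x by (auto simp: d_def split: if_splits)
  have dc: "c (\<phi> x) = c (\<phi> y)" if "d x = d y" for x y
    using that by (auto simp: d_def split: if_splits)
  have d_eq: "d x = d y" if "x \<noteq> \<one>" "y \<noteq> \<one>" "x \<in> carrier G" "y \<in> carrier G" "c (\<phi> x) = c (\<phi> y)" for x y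
    using that c1[of "\<phi> x"] c1[of "\<phi> y"] by (auto simp: d_def)
  \<comment> \<open>The section avoids the identity of G whenever the kernel is nontrivial. Its
    value over the identity of Q then represents the nontrivial kernel elements; for a trivial
    kernel the correction at the identity vanishes.\<close>
  have "\<exists>x. x \<in> carrier G \<and> \<phi> x = q \<and> (q = \<one>\<^bsub>Q\<^esub> \<longrightarrow> x = \<one> \<longrightarrow> (\<forall>y\<in>carrier G. \<phi> y = \<one>\<^bsub>Q\<^esub> \<longrightarrow> y = \<one>))"
    if q: "q \<in> carrier Q" for q
  proof (cases "q = \<one>\<^bsub>Q\<^esub> \<and> (\<exists>y\<in>carrier G. \<phi> y = \<one>\<^bsub>Q\<^esub> \<and> y \<noteq> \<one>)")
    case True
    then show ?thesis by blast
  next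
    case False
    obtain x where "x \<in> carrier G" "\<phi> x = q" using q surj by (metis imageE)
    then show ?thesis using False by blast
  qed
  then obtain sel where sel: "\<And>q. q \<in> carrier Q \<Longrightarrow> sel q \<in> carrier G"
    "\<And>q. q \<in> carrier Q \<Longrightarrow> \<phi> (sel q) = q"
    "\<And>y. sel \<one>\<^bsub>Q\<^esub> = \<one> \<Longrightarrow> y \<in> carrier G \<Longrightarrow> \<phi> y = \<one>\<^bsub>Q\<^esub> \<Longrightarrow> y = \<one>"
    by (metis Q.one_closed)
  have "s_coloring G d"
    unfolding s_coloring_def
  proof (intro conjI ballI impI allI)
    fix x assume "d x = d \<one>" then show "x = \<one>" by (rule d1)
  next
    fix x y assume xy: "x \<in> carrier G" "y \<in> carrier G" "d x = d y"
    show "d (inv x) = d (inv y)"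
    proof (cases "x = \<one>")
      case True
      then show ?thesis using d1[of y] xy by simp
    next
      case False
      then have "y \<noteq> \<one>" using d1[of x] xy by metis
      then show ?thesis
        using False xy c2[of "\<phi> x" "\<phi> y"] dc[OF xy(3)] by (intro d_eq) auto
    qed
  next
    fix f g assume f: "class_function G d f" and g: "class_function G d g"
    define F where "F f q = f (sel q)" for f :: "_ \<Rightarrow> int" and q
    have F: "f x = F f (\<phi> x) + (if x = \<one> then f \<one> - F f \<one>\<^bsub>Q\<^esub> else 0)"
      if "class_function G d f" "x \<in> carrier G" for x f
    proof (cases "x = \<one>")
      case False
      then have "sel (\<phi> x) \<noteq> \<one>" using sel(2)[OF h.hom_closed[OF that(2)]] sel(3)[of x] that(2) by (metis h.hom_one)
      then have "d x = d (sel (\<phi> x))" using False that(2) sel(1,2)[OF h.hom_closed[OF that(2)]] by (intro d_eq) simp_all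
      then have "f x = F f (\<phi> x)" using sel(1)[of "\<phi> x"] that(2) class_functionD[OF that(1), of x "sel (\<phi> x)"] by (simp add: F_def)
      then show ?thesis using False by simp
    qed simp
    have cf: "class_function Q c (F f)" if "class_function G d f" for f
      unfolding class_function_def
    proof (intro ballI impI)
      fix q r assume qr: "q \<in> carrier Q" "r \<in> carrier Q" "c q = c r"
      show "F f q = F f r"
      proof (cases "q = \<one>\<^bsub>Q\<^esub> \<or> r = \<one>\<^bsub>Q\<^esub>")
        case True
        then show ?thesis using qr c1 by metis
      next
        case False
        then have "d (sel q) = d (sel r)" using qr sel by (intro d_eq) (metis h.hom_one)+
        then show ?thesis using class_functionD[OF that, of "sel q" "sel r"] sel(1) qr by (simp add: F_def)
      qed
    qed
    define n where "n = card {x\<in>carrier G. \<phi> x = \<one>\<^bsub>Q\<^esub>}"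
    have n: "card {x\<in>carrier G. \<phi> x = q} = n" if q: "q \<in> carrier Q" for q
      unfolding n_def
      by (rule bij_betw_same_card[of "\<lambda>x. inv (sel q) \<otimes> x"],
          rule bij_betwI[where g = "\<lambda>x. sel q \<otimes> x"])
         (use sel q in \<open>auto simp: G.m_assoc[symmetric]\<close>)
    \<comment> \<open>Summing over fibres: each fibre has n elements, the order of the
      kernel.\<close>
    have lift: "(\<Sum>x\<in>carrier G. F f (\<phi> x) * F g (inv\<^bsub>Q\<^esub> \<phi> x \<otimes>\<^bsub>Q\<^esub> \<phi> y)) = int n * conv Q (F f) (F g) (\<phi> y)" for y
    proof -
      have "(\<Sum>x\<in>carrier G. F f (\<phi> x) * F g (inv\<^bsub>Q\<^esub> \<phi> x \<otimes>\<^bsub>Q\<^esub> \<phi> y)) =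
         (\<Sum>q\<in>carrier Q. \<Sum>x\<in>{x\<in>carrier G. \<phi> x = q}. F f (\<phi> x) * F g (inv\<^bsub>Q\<^esub> \<phi> x \<otimes>\<^bsub>Q\<^esub> \<phi> y))"
        by (rule sum.group[symmetric]) (use fin finQ surj in auto)
      also have "\<dots> = (\<Sum>q\<in>carrier Q. \<Sum>x\<in>{x\<in>carrier G. \<phi> x = q}. F f q * F g (inv\<^bsub>Q\<^esub> q \<otimes>\<^bsub>Q\<^esub> \<phi> y))"
        by (intro sum.cong) auto
      finally show ?thesis by (simp add: n conv_def sum_distrib_left)
    qed
    define \<alpha> where "\<alpha> = f \<one> - F f \<one>\<^bsub>Q\<^esub>"
    define \<beta> where "\<beta> = g \<one> - F g \<one>\<^bsub>Q\<^esub>"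
    have eq: "conv G f g y = int n * conv Q (F f) (F g) (\<phi> y) + \<alpha> * F g (\<phi> y) + \<beta> * F f (\<phi> y) +
        (if y = \<one> then \<alpha> * \<beta> else 0)" if y: "y \<in> carrier G" for y
    proof -
      have e: "inv x \<otimes> y = \<one> \<longleftrightarrow> x = y" if "x \<in> carrier G" for x
        using that y by (metis G.inv_closed G.inv_equality G.inv_inv G.l_inv)
      have "conv G f g y = (\<Sum>x\<in>carrier G. (F f (\<phi> x) + (if x = \<one> then \<alpha> else 0)) *
          (F g (inv\<^bsub>Q\<^esub> \<phi> x \<otimes>\<^bsub>Q\<^esub> \<phi> y) + (if x = y then \<beta> else 0)))"
        unfolding conv_def
      proof (rule sum.cong[OF refl])
        fix x assume x: "x \<in> carrier G"
        have "f x = F f (\<phi> x) + (if x = \<one> then \<alpha> else 0)" using F[OF f x] by (simp add: \<alpha>_def)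
        moreover have "g (inv x \<otimes> y) = F g (inv\<^bsub>Q\<^esub> \<phi> x \<otimes>\<^bsub>Q\<^esub> \<phi> y) + (if x = y then \<beta> else 0)"
          using F[OF g, of "inv x \<otimes> y"] x y by (simp add: \<beta>_def e)
        ultimately show "f x * g (inv x \<otimes> y) = (F f (\<phi> x) + (if x = \<one> then \<alpha> else 0)) *
          (F g (inv\<^bsub>Q\<^esub> \<phi> x \<otimes>\<^bsub>Q\<^esub> \<phi> y) + (if x = y then \<beta> else 0))" by simp
      qed
      also have "\<dots> = (\<Sum>x\<in>carrier G. F f (\<phi> x) * F g (inv\<^bsub>Q\<^esub> \<phi> x \<otimes>\<^bsub>Q\<^esub> \<phi> y) +
          (if x = \<one> then \<alpha> * F g (\<phi> y) + (if y = \<one> then \<alpha> * \<beta> else 0) else 0) +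
          (if x = y then \<beta> * F f (\<phi> y) else 0))"
        using y by (intro sum.cong) (auto simp: algebra_simps)
      also have "\<dots> = int n * conv Q (F f) (F g) (\<phi> y) + \<alpha> * F g (\<phi> y) + \<beta> * F f (\<phi> y) +
        (if y = \<one> then \<alpha> * \<beta> else 0)"
        using y fin by (simp add: sum.distrib lift)
      finally show ?thesis .
    qed
    show "class_function G d (conv G f g)"
      unfolding class_function_def
    proof (intro ballI impI)
      fix x y assume xy: "x \<in> carrier G" "y \<in> carrier G" "d x = d y"
      show "conv G f g x = conv G f g y"
      proof (cases "x = \<one>")
        case True
        then show ?thesis using d1[of y] xy by simp
      next
        case False
        then have ny: "y \<noteq> \<one>" using d1[of x] xy by metis
        have cxy: "c (\<phi> x) = c (\<phi> y)" by (rule dc[OF xy(3)])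
        have "conv Q (F f) (F g) (\<phi> x) = conv Q (F f) (F g) (\<phi> y)" "F f (\<phi> x) = F f (\<phi> y)" "F g (\<phi> x) = F g (\<phi> y)"
          using xy(1,2) cxy by (intro class_functionD[OF c3[OF cf[OF f] cf[OF g]]]
              class_functionD[OF cf[OF f]] class_functionD[OF cf[OF g]]; simp)+
        then show ?thesis using False ny xy by (simp add: eq)
      qed
    qed
  qed
  note d = this
  show "color_transitive Q c"
    unfolding color_transitive_def
  proof (intro ballI impI)
    fix x y assume xy: "x \<in> carrier Q" "y \<in> carrier Q" "c x = c y"
    have dxy: "d (sel x) = d (sel y)"
    proof (cases "x = \<one>\<^bsub>Q\<^esub> \<or> y = \<one>\<^bsub>Q\<^esub>")
      case True
      then show ?thesis using xy c1 by metis
    next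
      case False
      then show ?thesis using xy sel by (intro d_eq) (metis h.hom_one)+
    qed
    from weakly_SchurD[OF W d sel(1)[OF xy(1)] sel(1)[OF xy(2)] dxy]
    obtain k where k: "k \<in> carrier G \<rightarrow> carrier G" "k \<one> = \<one>" "k (sel x) = sel y"
      "\<And>p q. p \<in> carrier G \<Longrightarrow> q \<in> carrier G \<Longrightarrow> d (k p \<otimes> inv k q) = d (p \<otimes> inv q)"
      by blast
    define l where "l q = \<phi> (k (sel q))" for q
    have kc: "k p \<in> carrier G" if "p \<in> carrier G" for p using k(1) that by auto
    have lc: "l q \<in> carrier Q" if "q \<in> carrier Q" for q using kc that sel by (auto simp: l_def)
    have "c (l p \<otimes>\<^bsub>Q\<^esub> inv\<^bsub>Q\<^esub> l q) = c (p \<otimes>\<^bsub>Q\<^esub> inv\<^bsub>Q\<^esub> q)" if pq: "p \<in> carrier Q" "q \<in> carrier Q" for p q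
      using dc[OF k(4)[of "sel p" "sel q"]] pq kc sel by (simp add: l_def)
    moreover have "l \<one>\<^bsub>Q\<^esub> = \<one>\<^bsub>Q\<^esub>"
    proof -
      have "d (k (sel \<one>\<^bsub>Q\<^esub>)) = d (sel \<one>\<^bsub>Q\<^esub>)" using k(4)[of "sel \<one>\<^bsub>Q\<^esub>" "\<one>"] k(2) sel kc by simp
      then have "c (\<phi> (k (sel \<one>\<^bsub>Q\<^esub>))) = c \<one>\<^bsub>Q\<^esub>" using dc[of "k (sel \<one>\<^bsub>Q\<^esub>)"] sel(2)[OF Q.one_closed] by simp
      then show ?thesis using c1[of "l \<one>\<^bsub>Q\<^esub>"] lc[OF Q.one_closed] by (simp add: l_def)
    qed
    moreover have "l x = y" using k(3) sel xy by (simp add: l_def)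
    ultimately show "\<exists>k\<in>carrier Q \<rightarrow> carrier Q. k \<one>\<^bsub>Q\<^esub> = \<one>\<^bsub>Q\<^esub> \<and> k x = y \<and>
           (\<forall>p\<in>carrier Q. \<forall>q\<in>carrier Q. c (k p \<otimes>\<^bsub>Q\<^esub> inv\<^bsub>Q\<^esub> k q) = c (p \<otimes>\<^bsub>Q\<^esub> inv\<^bsub>Q\<^esub> q))"
      using lc by (intro bexI[of _ l]) auto
  qed
qed


section \<open>Identities in groups\<close>

lemma (in group) cancel_assoc:
  assumes "x \<in> carrier G" "y \<in> carrier G"
  shows "inv x \<otimes> (x \<otimes> y) = y" "x \<otimes> (inv x \<otimes> y) = y"
  using assms by (simp_all flip: m_assoc)

lemma (in group) finite_subgroupI:
  assumes fin: "finite (carrier G)" and H: "H \<subseteq> carrier G" "H \<noteq> {}"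
    and mult: "\<And>x y. x \<in> H \<Longrightarrow> y \<in> H \<Longrightarrow> x \<otimes> y \<in> H"
  shows "subgroup H G"
proof (rule subgroupI[OF H _ mult])
  fix a assume a: "a \<in> H"
  have pow: "a [^] Suc n \<in> H" for n :: nat
    by (induction n) (use a H(1) mult in auto)
  have aG: "a \<in> carrier G" using a H(1) by blast
  have "order G > 0" using fin by (simp add: order_gt_0_iff_finite)
  then have 1: "a [^] (order G - 1) \<otimes> a = \<one>"
    using pow_order_eq_1[OF aG] by (metis Suc_diff_1 nat_pow_Suc)
  then have inv: "inv a = a [^] (order G - 1)" using aG by (metis inv_equality nat_pow_closed)
  show "inv a \<in> H"
  proof (cases "order G - 1")
    case 0
    then have "a = \<one>" using 1 aG by simp
    then show ?thesis using a by simp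
  next
    case (Suc n)
    then show ?thesis using inv pow by simp
  qed
qed

lemma (in group) semiconj_int_pow:
  assumes "s \<otimes> x = y \<otimes> s" "s \<in> carrier G" "x \<in> carrier G" "y \<in> carrier G"
  shows "s \<otimes> x [^] (i::int) = y [^] i \<otimes> s"
proof -
  have nat: "s \<otimes> x [^] n = y [^] n \<otimes> s" for n :: nat
  proof (induction n)
    case (Suc n)
    have "s \<otimes> x [^] Suc n = (y [^] n \<otimes> s) \<otimes> x" using Suc assms by (simp add: m_assoc[symmetric])
    also have "\<dots> = y [^] Suc n \<otimes> s" using assms by (simp add: m_assoc)
    finally show ?case .
  qed (use assms in simp)
  show ?thesis
  proof (cases i rule: int_cases2)
    case (nonneg n)
    then show ?thesis using nat by (simp add: int_pow_int)
  next
    case (nonpos n)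
    have "inv (y [^] n) \<otimes> (s \<otimes> x [^] n) \<otimes> inv (x [^] n) = inv (y [^] n) \<otimes> (y [^] n \<otimes> s) \<otimes> inv (x [^] n)"
      by (simp add: nat)
    moreover have "inv (y [^] n) \<otimes> (s \<otimes> x [^] n) \<otimes> inv (x [^] n) = inv (y [^] n) \<otimes> s"
      using assms by (simp add: m_assoc)
    moreover have "inv (y [^] n) \<otimes> (y [^] n \<otimes> s) \<otimes> inv (x [^] n) = s \<otimes> inv (x [^] n)"
      using assms by (simp add: m_assoc[symmetric])
    ultimately have "inv (y [^] n) \<otimes> s = s \<otimes> inv (x [^] n)" by simp
    then show ?thesis using nonpos assms by (simp add: int_pow_neg_int)
  qed
qed

lemma (in group) commute_int_pow:
  assumes "x \<otimes> y = y \<otimes> x" "x \<in> carrier G" "y \<in> carrier G"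
  shows "x [^] (i::int) \<otimes> y [^] (j::int) = y [^] j \<otimes> x [^] i"
  using semiconj_int_pow[of y x x i] semiconj_int_pow[of "x [^] i" y y j] assms by simp

lemma (in group) commuting_pow_mult:
  assumes rz: "r \<otimes> z = z \<otimes> r" "r \<in> carrier G" "z \<in> carrier G"
  shows "r [^] (i::int) \<otimes> z [^] (a::int) \<otimes> (r [^] (j::int) \<otimes> z [^] (b::int)) = r [^] (i + j) \<otimes> z [^] (a + b)"
proof -
  have "z [^] a \<otimes> (r [^] j \<otimes> z [^] b) = r [^] j \<otimes> (z [^] a \<otimes> z [^] b)"
    using commute_int_pow[OF rz, of j a] rz(2,3) by (simp flip: m_assoc)
  then show ?thesis using rz(2,3) by (simp add: m_assoc int_pow_mult)
qed

lemma (in group) int_pow_mod: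
  assumes "x \<in> carrier G" "x [^] (m::int) = \<one>"
  shows "x [^] (i mod m) = x [^] (i::int)"
proof -
  have "x [^] i = x [^] (m * (i div m)) \<otimes> x [^] (i mod m)"
    using int_pow_mult[OF assms(1), of "m * (i div m)" "i mod m"] by simp
  moreover have "x [^] (m * (i div m)) = \<one>"
    using int_pow_pow[OF assms(1), of m "i div m"] assms(2) by simp
  ultimately show ?thesis using assms by simp
qed

lemma (in group) int_pow_numerals:
  assumes "x \<in> carrier G"
  shows "x [^] (2::int) = x \<otimes> x" "x [^] (3::int) = x \<otimes> (x \<otimes> x)" "x [^] (4::int) = x \<otimes> (x \<otimes> (x \<otimes> x))"
  using assms int_pow_mult[OF assms, of 1 1] int_pow_mult[OF assms, of 1 2] int_pow_mult[OF assms, of 1 3] by simp_all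


section \<open>Groups of order 16\<close>

primrec lookup :: "'b list \<Rightarrow> int \<Rightarrow> 'b" where
  "lookup [] n = undefined"
| "lookup (x # xs) n = (if n = 0 then x else lookup xs (n - 1))"

text \<open>
  Let \<open>r\<close> and \<open>z\<close> be commuting elements of orders \<open>m\<close> and \<open>k\<close> with \<open>m k = 8\<close>, and let \<open>s\<close> satisfy
  \<open>s r = r\<^sup>p z\<^sup>t s\<close>, \<open>s z = z s\<close> and \<open>s\<^sup>2 = r\<^sup>v z\<^sup>w\<close>. The element \<open>r\<^sup>i z\<^sup>a s\<^sup>e\<close> is encoded as \<open>i + m a + 8 e\<close>.
\<close>

definition ext_mult :: "int \<Rightarrow> int \<Rightarrow> int \<Rightarrow> int \<Rightarrow> int \<Rightarrow> int \<Rightarrow> int \<Rightarrow> int \<Rightarrow> int" where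
  "ext_mult m k p t v w x y =
     (let i = x mod m; a = x div m mod k; e = x div 8; j = y mod m; b = y div m mod k; g = y div 8
      in (i + (if e = 0 then 1 else p) * j + v * e * g) mod m +
         m * ((a + b + t * e * j + w * e * g) mod k) + 8 * ((e + g) mod 2))"

definition ext_table :: "int \<Rightarrow> int \<Rightarrow> int \<Rightarrow> int \<Rightarrow> int \<Rightarrow> int \<Rightarrow> int list list" where
  "ext_table m k p t v w = map (\<lambda>x. map (ext_mult m k p t v w x) [0..15]) [0..15]"

primrec position :: "int \<Rightarrow> int list \<Rightarrow> int" where
  "position y [] = 0"
| "position y (x # xs) = (if x = y then 0 else 1 + position y xs)"

text \<open>
  The list \<open>I\<close> contains the inverses. The pairs \<open>(c x, c (x\<^sup>-\<^sup>1 y))\<close> are encoded in base 16, so that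
  sorting them allows one to compare the structure constants at different \<open>y\<close>.
\<close>

definition color_counts :: "int list list \<Rightarrow> int list \<Rightarrow> int list \<Rightarrow> int \<Rightarrow> int list" where
  "color_counts T I c y = sort (map (\<lambda>x. 16 * lookup c x + lookup c (lookup (lookup T (lookup I x)) y)) [0..15])"

text \<open>\<open>N\<close> holds the counts of all elements, so that closure under convolution
  becomes a comparison of its entries. Colours lie below 16, as the pair encoding requires.\<close>

definition table_coloring :: "int list list \<Rightarrow> int list \<Rightarrow> int list \<Rightarrow> int list list \<Rightarrow> bool" where
  "table_coloring T I c N \<longleftrightarrow>
    (\<forall>x\<in>set [0..15]. lookup (lookup T x) (lookup I x) = 0 \<and>
       lookup I x \<in> set [0..15] \<and> lookup c x \<in> set [0..15] \<and> (lookup c x = lookup c 0 \<longrightarrow> x = 0)) \<and>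
    (\<forall>x\<in>set [0..15]. \<forall>y\<in>set [0..15]. lookup c x = lookup c y \<longrightarrow>
       lookup c (lookup I x) = lookup c (lookup I y) \<and> lookup N x = lookup N y)"

text \<open>The code 0 is the identity and \<open>d\<close> is the colour of a quotient. No pair
  (u', v') stands to (1, y) as (u, v) stands to (1, x); v' is tried only for those u' that already
  fit.\<close>

definition table_obstruction :: "int list list \<Rightarrow> int list \<Rightarrow> int list \<Rightarrow> int \<Rightarrow> int \<Rightarrow> int \<Rightarrow> int \<Rightarrow> bool" where
  "table_obstruction T I c x y u v \<longleftrightarrow>
    (let d = (\<lambda>p q. lookup c (lookup (lookup T p) (lookup I q))) in
     lookup c x = lookup c y \<and>
     (\<forall>u'\<in>set [0..15]. lookup c u' = lookup c u \<longrightarrow> d u' y = d u x \<longrightarrow>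
        (\<forall>v'\<in>set [0..15]. \<not> (lookup c v' = lookup c v \<and> d v' y = d v x \<and> d v' u' = d v u))))"

definition not_Schur_table :: "int list list \<Rightarrow> int list \<Rightarrow> int list \<Rightarrow> int \<Rightarrow> int \<Rightarrow> int \<Rightarrow> int \<Rightarrow> bool" where
  "not_Schur_table T I c x y u v \<longleftrightarrow>
     table_coloring T I c (map (color_counts T I c) [0..15]) \<and> table_obstruction T I c x y u v"

definition ext_not_Schur :: "int \<Rightarrow> int \<Rightarrow> int \<Rightarrow> int \<Rightarrow> int \<Rightarrow> int \<Rightarrow> int list \<Rightarrow> int \<Rightarrow> int \<Rightarrow> int \<Rightarrow> int \<Rightarrow> bool" where
  "ext_not_Schur m k p t v w c x y g h \<longleftrightarrow>
    (\<lambda>T. not_Schur_table T (map (position 0) T) c x y g h) (ext_table m k p t v w)"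


section \<open>From multiplication tables to groups\<close>

lemma lookup_nth: "0 \<le> n \<Longrightarrow> n < int (length xs) \<Longrightarrow> lookup xs n = xs ! nat n"
  by (induction xs arbitrary: n) (auto simp: nth_Cons' nat_diff_distrib)

lemma lookup_map: "0 \<le> n \<Longrightarrow> n \<le> 15 \<Longrightarrow> lookup (map f [0..15]) n = f n"
  by (subst lookup_nth) (auto simp: nth_map)

text \<open>A convolution of class functions at y depends only on the multiset of colour pairs of x
  and x^-1 y, and \<open>color_counts\<close> lists this multiset in sorted order. A
  colour-preserving \<open>k\<close> with k(x) = y would yield the pair (k(u), k(v)) that
  \<open>table_obstruction\<close> rules out.\<close>

lemma (in group) table_not_weakly_Schur:
  assumes W: "weakly_Schur G" and bij: "bij_betw f {0..15} (carrier G)"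
    and f0: "f 0 = \<one>"
    and mult: "\<And>x y. x \<in> {0..15} \<Longrightarrow> y \<in> {0..15} \<Longrightarrow> lookup (lookup T x) y \<in> {0..15}"
      "\<And>x y. x \<in> {0..15} \<Longrightarrow> y \<in> {0..15} \<Longrightarrow> f x \<otimes> f y = f (lookup (lookup T x) y)"
    and check: "not_Schur_table T I c x y u v"
    and xyuv: "x \<in> {0..15}" "y \<in> {0..15}" "u \<in> {0..15}" "v \<in> {0..15}"
  shows False
proof -
  have fin: "finite (carrier G)" using bij bij_betw_finite by blast
  have fc: "f i \<in> carrier G" if "i \<in> {0..15}" for i using bij that by (auto simp: bij_betw_def)
  define g where "g = inv_into {0..15} f"
  have gf: "g (f i) = i" if "i \<in> {0..15}" for i
    using bij that by (simp add: g_def bij_betw_inv_into_left)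
  have fg: "f (g a) = a" "g a \<in> {0..15}" if "a \<in> carrier G" for a
    using bij_betw_inv_into_right[OF bij that] bij_betwE[OF bij_betw_inv_into[OF bij]] that
    by (simp_all only: g_def)
  have set: "set [0..15] = {0..15::int}" by simp
  have c1: "lookup (lookup T i) (lookup I i) = 0" "lookup I i \<in> {0..15}" "lookup c i \<in> {0..15}"
    "lookup c i = lookup c 0 \<Longrightarrow> i = 0" if "i \<in> {0..15}" for i
    using check that unfolding not_Schur_table_def table_coloring_def set by blast+
  have c2: "lookup c (lookup I i) = lookup c (lookup I j)" "color_counts T I c i = color_counts T I c j"
    if "i \<in> {0..15}" "j \<in> {0..15}" "lookup c i = lookup c j" for i j
  proof -
    have "lookup c (lookup I i) = lookup c (lookup I j) \<and>
        lookup (map (color_counts T I c) [0..15]) i = lookup (map (color_counts T I c) [0..15]) j"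
      using check that unfolding not_Schur_table_def table_coloring_def set by blast
    then show "lookup c (lookup I i) = lookup c (lookup I j)" "color_counts T I c i = color_counts T I c j"
      using that by (simp_all add: lookup_map)
  qed
  have inv: "inv (f i) = f (lookup I i)" if i: "i \<in> {0..15}" for i
    using mult(2)[OF i c1(2)[OF i]] c1(1)[OF i] f0 fc i c1(2)[OF i] by (metis inv_equality inv_inv l_inv_ex inv_unique')
  define d where "d a = lookup c (g a)" for a
  have d: "d (f i) = lookup c i" if "i \<in> {0..15}" for i using gf that by (simp add: d_def)
  have "s_coloring G d"
    unfolding s_coloring_def
  proof (intro conjI ballI impI allI)
    fix a assume a: "a \<in> carrier G" "d a = d \<one>"
    then have "g a = 0" using c1(4)[OF fg(2)[OF a(1)]] d[of 0] f0 by (simp add: d_def)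
    then show "a = \<one>" using fg(1)[OF a(1)] f0 by simp
  next
    fix a b assume ab: "a \<in> carrier G" "b \<in> carrier G" "d a = d b"
    have "d (inv f (g a)) = d (inv f (g b))"
      using ab c2(1)[of "g a" "g b"] fg(2) c1(2) by (simp add: inv d) (simp add: d_def)
    then show "d (inv a) = d (inv b)" using fg(1) ab by simp
  next
    fix \<phi> \<psi> assume cf: "class_function G d \<phi>" "class_function G d \<psi>"
    \<comment> \<open>\<open>F\<close> rewrites a class function as a function of the colour, and
      \<open>h\<close> decodes a pair in base 16. A convolution then becomes the sum of
      \<open>h\<close> over the counts.\<close>
    define F where "F \<phi> a = \<phi> (inv_into (carrier G) d a)" for \<phi> :: "'a \<Rightarrow> int" and a
    have F: "\<phi> a = F \<phi> (d a)" if "class_function G d \<phi>" "a \<in> carrier G" for \<phi> a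
      unfolding F_def using that
      by (intro class_functionD[OF that(1)]) (auto intro!: inv_into_into f_inv_into_f[symmetric])
    define h where "h n = F \<phi> (n div 16) * F \<psi> (n mod 16)" for n
    have sort_sum: "sum_list (map h (sort xs)) = sum_list (map h xs)" for xs
      by (metis mset_map mset_sort sum_mset_sum_list)
    have "conv G \<phi> \<psi> (f j) = sum_list (map h (color_counts T I c j))" if j: "j \<in> {0..15}" for j
    proof -
      let ?k = "\<lambda>i. lookup (lookup T (lookup I i)) j"
      have "conv G \<phi> \<psi> (f j) = (\<Sum>i\<in>{0..15}. \<phi> (f i) * \<psi> (inv (f i) \<otimes> f j))"
        unfolding conv_def by (rule sum.reindex_bij_betw[OF bij, symmetric])
      also have "\<dots> = (\<Sum>i\<in>{0..15}. h (16 * lookup c i + lookup c (?k i)))"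
      proof (rule sum.cong[OF refl])
        fix i :: int assume i: "i \<in> {0..15}"
        have k: "?k i \<in> {0..15}" using mult(1) c1(2) i j by blast
        have "\<phi> (f i) = F \<phi> (lookup c i)" using F[OF cf(1) fc[OF i]] i by (simp add: d)
        moreover have "\<psi> (inv (f i) \<otimes> f j) = F \<psi> (lookup c (?k i))"
          using F[OF cf(2) fc[OF k]] mult(2)[OF c1(2)[OF i] j] i k by (simp add: inv d)
        moreover have "(16 * lookup c i + lookup c (?k i)) div 16 = lookup c i"
            "(16 * lookup c i + lookup c (?k i)) mod 16 = lookup c (?k i)"
          using c1(3)[OF k] by auto
        ultimately show "\<phi> (f i) * \<psi> (inv (f i) \<otimes> f j) = h (16 * lookup c i + lookup c (?k i))"
          by (simp add: h_def)
      qed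
      also have "\<dots> = sum_list (map h (map (\<lambda>i. 16 * lookup c i + lookup c (?k i)) [0..15]))"
        by (simp add: interv_sum_list_conv_sum_set_int o_def del: upto.simps)
      also have "\<dots> = sum_list (map h (color_counts T I c j))"
        unfolding color_counts_def by (rule sort_sum[symmetric])
      finally show ?thesis .
    qed
    then show "class_function G d (conv G \<phi> \<psi>)"
      unfolding class_function_def using c2(2) fg by (metis d_def)
  qed
  then have "color_transitive G d"
    by (rule weakly_Schur_color_transitive[OF group_axioms fin W])
  moreover have "d (f x) = d (f y)"
    using check xyuv by (simp add: d not_Schur_table_def table_obstruction_def Let_def)
  ultimately have "\<exists>k\<in>carrier G \<rightarrow> carrier G. k \<one> = \<one> \<and> k (f x) = f y \<and>
      (\<forall>p\<in>carrier G. \<forall>q\<in>carrier G. d (k p \<otimes> inv k q) = d (p \<otimes> inv q))"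
    unfolding color_transitive_def using fc[OF xyuv(1)] fc[OF xyuv(2)] by blast
  then obtain k where k: "k \<in> carrier G \<rightarrow> carrier G" "k \<one> = \<one>" "k (f x) = f y"
      "\<And>p q. p \<in> carrier G \<Longrightarrow> q \<in> carrier G \<Longrightarrow> d (k p \<otimes> inv k q) = d (p \<otimes> inv q)"
    by blast
  define l where "l i = g (k (f i))" for i
  have l: "l i \<in> {0..15}" "f (l i) = k (f i)" if "i \<in> {0..15}" for i
    using fg[OF funcset_mem[OF k(1) fc[OF that]]] by (auto simp: l_def)
  have lx: "l x = y" using k(3) gf xyuv by (simp add: l_def)
  have diff: "d (f p \<otimes> inv f q) = lookup c (lookup (lookup T p) (lookup I q))"
    if "p \<in> {0..15}" "q \<in> {0..15}" for p q
    using that mult c1(2) by (simp add: inv d)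
  have ld: "lookup c (lookup (lookup T (l p)) (lookup I (l q))) = lookup c (lookup (lookup T p) (lookup I q))"
    if "p \<in> {0..15}" "q \<in> {0..15}" for p q
    using k(4)[OF fc fc, OF that] diff[OF that] diff[OF l(1) l(1), OF that] l(2) that by simp
  have lc: "lookup c (l p) = lookup c p" if "p \<in> {0..15}" for p
  proof -
    have "d (k (f p)) = d (f p)"
      using k(4)[OF fc[OF that] one_closed] k(2) funcset_mem[OF k(1) fc[OF that]] fc[OF that] by simp
    then show ?thesis using d[OF l(1)[OF that]] d[OF that] l(2)[OF that] by simp
  qed
  show False
    using check lc[of u] lc[of v] ld[of u x] ld[of v x] ld[of v u] lx xyuv l(1)[of u] l(1)[of v]
    unfolding not_Schur_table_def table_obstruction_def Let_def set by metis
qed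

text \<open>The relations bring products of normal forms r^i z^a s^e into normal form again, while
  \<open>indep\<close> and \<open>s_notin\<close> keep the 16 normal forms distinct. They constitute
  a subgroup of order 16 with the given table, and G passes its property to this subgroup.\<close>

lemma (in group) ext_not_weakly_Schur:
  fixes m k p t v w :: int
  assumes fin: "finite (carrier G)" and W: "weakly_Schur G"
    and mk: "m * k = 8" "m > 0" "k > 0"
    and [simp]: "r \<in> carrier G" "z \<in> carrier G" "s \<in> carrier G"
    and rz: "r \<otimes> z = z \<otimes> r" and sz: "s \<otimes> z = z \<otimes> s"
    and sr: "s \<otimes> r = r [^] p \<otimes> z [^] t \<otimes> s"
    and ss: "s \<otimes> s = r [^] v \<otimes> z [^] w"
    and rm: "r [^] m = \<one>" and zk: "z [^] k = \<one>"
    and indep: "\<And>i a. r [^] i \<otimes> z [^] a = \<one> \<Longrightarrow> m dvd i \<and> k dvd a"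
    and s_notin: "\<And>(i::int) (a::int). s \<noteq> r [^] i \<otimes> z [^] a"
    and check: "ext_not_Schur m k p t v w c x y g h"
    and xygh: "x \<in> {0..15}" "y \<in> {0..15}" "g \<in> {0..15}" "h \<in> {0..15}"
  shows False
proof -
  define E where "E i a e = r [^] (i::int) \<otimes> z [^] (a::int) \<otimes> s [^] (e::int)" for i a e
  have Ec [simp]: "E i a e \<in> carrier G" for i a e by (simp add: E_def)
  have rzp: "z [^] a \<otimes> r [^] i = r [^] i \<otimes> z [^] a" for i a :: int
    using commute_int_pow[OF rz] by simp
  have srp: "s \<otimes> r [^] j = r [^] (p * j) \<otimes> z [^] (t * j) \<otimes> s" for j
    using semiconj_int_pow[OF sr, of j] rzp by (simp add: int_pow_mult_distrib int_pow_pow)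
  have szp: "s \<otimes> z [^] b = z [^] b \<otimes> s" for b :: int
    using semiconj_int_pow[OF sz] by simp
  note AA = commuting_pow_mult[OF rz \<open>r \<in> carrier G\<close> \<open>z \<in> carrier G\<close>]
  have sA: "s \<otimes> (r [^] j \<otimes> z [^] b) = r [^] (p * j) \<otimes> z [^] (t * j + b) \<otimes> s" for j b
  proof -
    have "s \<otimes> (r [^] j \<otimes> z [^] b) = s \<otimes> r [^] j \<otimes> z [^] b" by (simp add: m_assoc)
    also have "\<dots> = r [^] (p * j) \<otimes> z [^] (t * j) \<otimes> (s \<otimes> z [^] b)" by (simp add: srp m_assoc)
    also have "\<dots> = r [^] (p * j) \<otimes> z [^] (t * j + b) \<otimes> s" by (simp add: szp int_pow_mult m_assoc)
    finally show ?thesis .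
  qed
  \<comment> \<open>Moving s across r^j z^b turns it into r^(p j) z^(t j + b); a resulting s^2 is
    absorbed as r^v z^w.\<close>
  have EE: "E i a e \<otimes> E j b d = E (i + (if e = 0 then 1 else p) * j + v * e * d) (a + b + t * e * j + w * e * d) ((e + d) mod 2)"
    if "e \<in> {0,1}" "d \<in> {0,1}" for i a j b e d
  proof (cases "e = 0")
    case True
    then show ?thesis using that AA[of i a j b] by (auto simp: E_def m_assoc[symmetric])
  next
    case False
    then have e: "e = 1" using that by auto
    have "E i a 1 \<otimes> E j b d = r [^] i \<otimes> z [^] a \<otimes> (s \<otimes> (r [^] j \<otimes> z [^] b)) \<otimes> s [^] d"
      by (simp add: E_def m_assoc)
    also have "\<dots> = r [^] i \<otimes> z [^] a \<otimes> (r [^] (p * j) \<otimes> z [^] (t * j + b)) \<otimes> (s \<otimes> s [^] d)"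
      by (simp add: sA m_assoc)
    also have "\<dots> = r [^] (i + p * j) \<otimes> z [^] (a + (t * j + b)) \<otimes> (s \<otimes> s [^] d)" by (simp only: AA)
    also have "s \<otimes> s [^] d = r [^] (v * d) \<otimes> z [^] (w * d) \<otimes> s [^] ((1 + d) mod 2)"
      using that ss by auto
    also have "r [^] (i + p * j) \<otimes> z [^] (a + (t * j + b)) \<otimes> (r [^] (v * d) \<otimes> z [^] (w * d) \<otimes> s [^] ((1 + d) mod 2))
       = E (i + p * j + v * d) (a + (t * j + b) + w * d) ((1 + d) mod 2)"
      unfolding E_def AA[symmetric] by (simp add: m_assoc)
    finally show ?thesis by (simp add: e algebra_simps)
  qed
  define f where "f n = E (n mod m) (n div m mod k) (n div 8)" for n
  have Emod: "E (i mod m) (a mod k) e = E i a e" for i a e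
    by (simp add: E_def int_pow_mod rm zk)
  have dec: "(i + m * a + 8 * e) mod m = i" "(i + m * a + 8 * e) div m mod k = a" "(i + m * a + 8 * e) div 8 = e"
      "i + m * a + 8 * e \<in> {0..15}"
    if "0 \<le> i" "i < m" "0 \<le> a" "a < k" "e \<in> {0,1}" for i a e
  proof -
    have 8: "i + m * a + 8 * e = i + m * (a + k * e)" by (simp add: mk(1)[symmetric] algebra_simps)
    show "(i + m * a + 8 * e) mod m = i" "(i + m * a + 8 * e) div m mod k = a"
      using that unfolding 8 by auto
    have "m * a \<le> m * (k - 1)" using that mk by (intro mult_left_mono) auto
    then have "i + m * a < 8" using that mk(1) by (simp add: algebra_simps)
    then show "(i + m * a + 8 * e) div 8 = e" "i + m * a + 8 * e \<in> {0..15}"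
      using that mk by auto
  qed
  have digits: "0 \<le> n mod m" "n mod m < m" "0 \<le> n div m mod k" "n div m mod k < k" "n div 8 \<in> {0,1}"
    "n = n mod m + m * (n div m mod k) + 8 * (n div 8)"
    if n: "n \<in> {0..15}" for n
  proof -
    show "0 \<le> n mod m" "n mod m < m" "0 \<le> n div m mod k" "n div m mod k < k" using mk by auto
    show "n div 8 \<in> {0,1}" using n by auto
    \<comment> \<open>Since m k = 8, the digit of s is what remains after removing the digits of r
      and z.\<close>
    have "n div m div k = n div 8" using mk by (metis zdiv_zmult2_eq less_imp_le)
    then have "n div m = k * (n div 8) + n div m mod k" by (metis mult_div_mod_eq)
    then have "m * (n div m) = 8 * (n div 8) + m * (n div m mod k)"
      by (metis mk(1) distrib_left mult.assoc)
    then show "n = n mod m + m * (n div m mod k) + 8 * (n div 8)"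
      using mult_div_mod_eq[of m n] by linarith
  qed
  let ?T = "ext_table m k p t v w"
  have T: "lookup (lookup ?T a) b = ext_mult m k p t v w a b" if "a \<in> {0..15}" "b \<in> {0..15}" for a b
    using that by (simp add: ext_table_def lookup_map del: upto.simps)
  have T_in: "ext_mult m k p t v w a b \<in> {0..15}" for a b
    unfolding ext_mult_def Let_def using mk by (intro dec(4)) auto
  have T_mult: "f a \<otimes> f b = f (ext_mult m k p t v w a b)" if ab: "a \<in> {0..15}" "b \<in> {0..15}" for a b
  proof -
    have "f (ext_mult m k p t v w a b) = E (a mod m + (if a div 8 = 0 then 1 else p) * (b mod m) + v * (a div 8) * (b div 8))
       (a div m mod k + b div m mod k + t * (a div 8) * (b mod m) + w * (a div 8) * (b div 8)) ((a div 8 + b div 8) mod 2)"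
      (is "_ = E ?i ?a ?e")
    proof -
      have e: "?e \<in> {0,1}" by auto
      have "ext_mult m k p t v w a b = ?i mod m + m * (?a mod k) + 8 * ?e"
        by (simp add: ext_mult_def Let_def)
      moreover have "0 \<le> ?i mod m" "?i mod m < m" "0 \<le> ?a mod k" "?a mod k < k" using mk by simp_all
      ultimately show ?thesis
        using dec(1-3)[of "?i mod m" "?a mod k" ?e] e by (simp only: f_def Emod)
    qed
    then show ?thesis
      unfolding f_def using digits(5) ab by (subst EE) auto
  qed
  have inj: "inj_on f {0..15}"
  proof (rule inj_onI)
    fix a b assume ab: "a \<in> {0..15}" "b \<in> {0..15}" "f a = f b"
    have A: "i = j \<and> n = l" if "r [^] i \<otimes> z [^] n = r [^] j \<otimes> z [^] l" "0 \<le> i" "i < m" "0 \<le> j" "j < m"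
      "0 \<le> n" "n < k" "0 \<le> l" "l < k" for i j n l :: int
    proof -
      have "r [^] (i - j) \<otimes> z [^] (n - l) = r [^] i \<otimes> z [^] n \<otimes> (r [^] (-j) \<otimes> z [^] (-l))"
        by (simp add: AA)
      also have "\<dots> = r [^] j \<otimes> z [^] l \<otimes> (r [^] (-j) \<otimes> z [^] (-l))" using that by simp
      also have "\<dots> = \<one>" by (simp add: AA)
      finally have "m dvd i - j" "k dvd n - l" using indep by blast+
      then have "i mod m = j mod m" "n mod k = l mod k" by (simp_all add: mod_eq_dvd_iff)
      then show ?thesis using that by simp
    qed
    have B: False if "E i n 0 = E j l 1" for i n j l
    proof -
      have "r [^] i \<otimes> z [^] n = r [^] j \<otimes> z [^] l \<otimes> s" using that by (simp add: E_def)
      then have "s = inv (r [^] j \<otimes> z [^] l) \<otimes> (r [^] i \<otimes> z [^] n)" by (simp add: inv_solve_left)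
      also have "\<dots> = z [^] (-l) \<otimes> r [^] (-j) \<otimes> (r [^] i \<otimes> z [^] n)" by (simp add: inv_mult_group int_pow_neg)
      also have "\<dots> = r [^] (-j + i) \<otimes> z [^] (-l + n)" by (simp only: rzp AA)
      finally show False using s_notin by blast
    qed
    have e: "a div 8 = b div 8"
    proof (rule ccontr)
      assume "a div 8 \<noteq> b div 8"
      then consider "a div 8 = 0" "b div 8 = 1" | "a div 8 = 1" "b div 8 = 0"
        using digits(5)[OF ab(1)] digits(5)[OF ab(2)] by auto
      then show False by cases (use ab(3) B in \<open>auto simp: f_def\<close>, metis B)
    qed
    have "r [^] (a mod m) \<otimes> z [^] (a div m mod k) = r [^] (b mod m) \<otimes> z [^] (b div m mod k)"
      using ab(3) e by (simp add: f_def E_def)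
    then have "a mod m = b mod m \<and> a div m mod k = b div m mod k"
      by (rule A) (use digits ab in blast)+
    then show "a = b" using digits(6)[OF ab(1)] digits(6)[OF ab(2)] e by simp
  qed
  define H where "H = f ` {0..15}"
  have HG: "H \<subseteq> carrier G" by (auto simp: H_def f_def)
  have f0: "f 0 = \<one>" by (simp add: f_def E_def)
  have Hmult: "a \<otimes> b \<in> H" if ab: "a \<in> H" "b \<in> H" for a b
  proof -
    obtain i j where ij: "i \<in> {0..15}" "j \<in> {0..15}" "a = f i" "b = f j" using ab unfolding H_def by blast
    then have "a \<otimes> b = f (ext_mult m k p t v w i j)" using T_mult by simp
    then show ?thesis using T_in by (auto simp: H_def)
  qed
  have H: "subgroup H G"
    by (rule finite_subgroupI[OF fin HG _ Hmult]) (auto simp: H_def)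
  interpret K: group "G\<lparr>carrier := H\<rparr>" by (rule subgroup_imp_group[OF H])
  show False
  proof (rule K.table_not_weakly_Schur)
    show "weakly_Schur (G\<lparr>carrier := H\<rparr>)" by (rule weakly_Schur_subgroup[OF fin W H])
    show "bij_betw f {0..15} (carrier (G\<lparr>carrier := H\<rparr>))" using inj by (simp add: bij_betw_def H_def)
    show "not_Schur_table ?T (map (position 0) ?T) c x y g h" using check by (simp add: ext_not_Schur_def)
  qed (use f0 T T_in T_mult xygh in simp_all)
qed

section \<open>Colourings of nine groups of order 16\<close>

lemma abelian_4_2_2_not_Schur: "ext_not_Schur 4 2 1 0 0 0 [0, 1, 2, 1, 3, 4, 1, 5, 1, 4, 3, 5, 6, 3, 2, 3] 1 6 4 5"
  by code_simp

text \<open>Here z = s^2, and colour 1 consists of r, s, r^-1 s and their inverses. This is the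
  connection set of the Shrikhande graph, which is strongly regular with parameters (16,6,2,2) but
  not of rank 3. The common neighbours r and r^3 of 1 and r^2 are not adjacent, whereas those of 1
  and r z are.\<close>

lemma abelian_4_4_not_Schur: "ext_not_Schur 4 2 1 0 0 1 [0, 1, 2, 1, 2, 2, 2, 2, 1, 2, 2, 1, 1, 1, 2, 2] 2 5 1 3"
  by code_simp

text \<open>The Shrikhande graph again, with connection set r, r^-1 and the involutions r s, r^2 s,
  z s, r z s.\<close>

lemma dihedral8_2_not_Schur: "ext_not_Schur 4 2 3 0 0 0 [0, 1, 2, 1, 2, 2, 2, 2, 2, 1, 1, 2, 1, 1, 2, 2] 2 5 1 3"
  by code_simp

lemma quaternion8_2_not_Schur: "ext_not_Schur 4 2 3 0 2 0 [0, 1, 2, 3, 4, 3, 4, 1, 3, 5, 1, 5, 3, 4, 1, 4] 4 13 1 5"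
  by code_simp

lemma semidirect_4_4_not_Schur: "ext_not_Schur 4 2 3 0 0 1 [0, 1, 2, 3, 4, 1, 4, 3, 3, 5, 1, 5, 1, 6, 3, 6] 1 10 8 9"
  by code_simp

lemma semidirect_42_2_not_Schur: "ext_not_Schur 4 2 1 1 0 0 [0, 1, 2, 3, 2, 1, 4, 3, 2, 1, 5, 1, 5, 3, 2, 3] 2 8 1 3"
  by code_simp

text \<open>Colour 2 is the connection set r^2, r^3, r^5, r^6, r s, r^3 s of a Shrikhande graph. The
  common neighbours r^3 and r^6 of 1 and r are adjacent, whereas those of 1 and r^4 are not.\<close>

lemma modular16_not_Schur: "ext_not_Schur 8 1 5 0 0 0 [0, 1, 2, 2, 1, 2, 2, 1, 1, 2, 1, 2, 1, 1, 1, 1] 1 4 3 6"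
  by code_simp

text \<open>A Shrikhande graph with connection set r^2, r^3, r^5, r^6, s, r^2 s; the obstruction
  uses the same four points as for the modular group.\<close>

lemma semidihedral16_not_Schur: "ext_not_Schur 8 1 3 0 0 0 [0, 1, 2, 2, 1, 2, 2, 1, 2, 1, 2, 1, 1, 1, 1, 1] 1 4 3 6"
  by code_simp

lemma quaternion16_not_Schur: "ext_not_Schur 8 1 7 0 4 0 [0, 1, 2, 1, 3, 2, 1, 2, 1, 1, 1, 4, 2, 2, 2, 4] 1 6 2 3"
  by code_simp


section \<open>Normal four-groups\<close>

text \<open>The classes are the cosets x R(x). Because (x r)^-1 = x^-1 (x r^-1 x^-1),
  \<open>R_inv\<close> sends inverses of a class into a class. Because x d w f = x w (w^-1 d w) f,
  \<open>R_mult\<close> says that the class of x w lies in the product of the classes of x and w. So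
  whenever y is a product x w, every y e in its class is a product of elements in the same two
  classes.\<close>

lemma (in group) coset_s_coloring:
  assumes fin: "finite (carrier G)" and V: "subgroup V G"
    and V_comm: "\<And>v w. v \<in> V \<Longrightarrow> w \<in> V \<Longrightarrow> v \<otimes> w = w \<otimes> v"
    and V_conj: "\<And>x v. x \<in> carrier G \<Longrightarrow> v \<in> V \<Longrightarrow> inv x \<otimes> v \<otimes> x \<in> V"
    and R: "\<And>x. x \<in> carrier G \<Longrightarrow> subgroup (R x) G" "\<And>x. x \<in> carrier G \<Longrightarrow> R x \<subseteq> V"
    and R_coset: "\<And>x v. x \<in> carrier G \<Longrightarrow> v \<in> V \<Longrightarrow> R (x \<otimes> v) = R x"
    and R_one: "R \<one> = {\<one>}"
    and R_inv: "\<And>x r. x \<in> carrier G \<Longrightarrow> r \<in> R x \<Longrightarrow> x \<otimes> r \<otimes> inv x \<in> R (inv x)"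
    and R_mult: "\<And>x w e. x \<in> carrier G \<Longrightarrow> w \<in> carrier G \<Longrightarrow> e \<in> R (x \<otimes> w) \<Longrightarrow>
      \<exists>d\<in>R x. \<exists>f\<in>R w. e = inv w \<otimes> d \<otimes> w \<otimes> f"
  shows "s_coloring G (\<lambda>x. x <# R x)"
    and "\<And>x y. x \<in> carrier G \<Longrightarrow> y \<in> carrier G \<Longrightarrow> x <# R x = y <# R y \<longleftrightarrow> inv x \<otimes> y \<in> R x"
proof -
  have VG: "v \<in> carrier G" if "v \<in> V" for v using subgroup.mem_carrier[OF V that] .
  have RV: "r \<in> V" if "x \<in> carrier G" "r \<in> R x" for x r using R(2) that by blast
  have RG: "r \<in> carrier G" if "x \<in> carrier G" "r \<in> R x" for x r using RV[OF that] VG by blast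
  have R1: "\<one> \<in> R x" if "x \<in> carrier G" for x using subgroup.one_closed[OF R(1)[OF that]] .
  have shift: "(x \<otimes> r) <# R (x \<otimes> r) = x <# R x" if x: "x \<in> carrier G" and r: "r \<in> R x" for x r
  proof -
    have "(x \<otimes> r) <# R (x \<otimes> r) = (x \<otimes> r) <# R x" using R_coset[OF x RV[OF x r]] by simp
    also have "\<dots> = x <# (r <# R x)"
      using x RG[OF x r] subgroup.subset[OF R(1)[OF x]] by (simp add: lcos_m_assoc)
    also have "r <# R x = R x"
      using coset_join3[OF RG[OF x r] R(1)[OF x] r] by simp
    finally show ?thesis .
  qed
  show eq: "x <# R x = y <# R y \<longleftrightarrow> inv x \<otimes> y \<in> R x" if x: "x \<in> carrier G" and y: "y \<in> carrier G" for x y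
  proof
    assume "x <# R x = y <# R y"
    moreover have "y \<in> y <# R y" using R1[OF y] y by (force simp: l_coset_def)
    ultimately obtain r where "r \<in> R x" "y = x \<otimes> r" by (auto simp: l_coset_def)
    then show "inv x \<otimes> y \<in> R x" using x RG[OF x] by (simp add: m_assoc[symmetric])
  next
    assume "inv x \<otimes> y \<in> R x"
    from shift[OF x this] show "x <# R x = y <# R y" using x y by (simp add: m_assoc[symmetric])
  qed
  show "s_coloring G (\<lambda>x. x <# R x)"
    unfolding s_coloring_def
  proof (intro conjI ballI impI allI)
    fix x assume x: "x \<in> carrier G" "x <# R x = \<one> <# R \<one>"
    then have "inv \<one> \<otimes> x \<in> R \<one>" using eq[of \<one> x] by simp
    then show "x = \<one>" using x(1) R_one by simp
  next
    fix x y assume x: "x \<in> carrier G" and y: "y \<in> carrier G" and "x <# R x = y <# R y"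
    then have r: "inv x \<otimes> y \<in> R x" using eq by simp
    let ?r = "inv x \<otimes> y"
    have "x \<otimes> inv ?r \<otimes> inv x \<in> R (inv x)"
      by (rule R_inv[OF x]) (rule subgroup.m_inv_closed[OF R(1)[OF x] r])
    moreover have "x \<otimes> inv ?r \<otimes> inv x = inv (inv x) \<otimes> inv y"
      using x y by (simp add: inv_mult_group m_assoc)
    ultimately show "inv x <# R (inv x) = inv y <# R (inv y)" using eq[of "inv x" "inv y"] x y by simp
  next
    fix f g :: "'a \<Rightarrow> int"
    assume cf: "class_function G (\<lambda>x. x <# R x) f" "class_function G (\<lambda>x. x <# R x) g"
    have f_shift: "h (x \<otimes> r) = h x" if "class_function G (\<lambda>x. x <# R x) h" "x \<in> carrier G" "r \<in> R x" for h x r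
      using class_functionD[OF that(1), of "x \<otimes> r" x] shift[OF that(2,3)] RG[OF that(2,3)] that(2) by simp
    \<comment> \<open>Passing from \<open>y\<close> to \<open>y e\<close> permutes the summands of the convolution by \<open>x \<mapsto> x d\<close>, where \<open>d\<close> depends
      only on the coset \<open>x V\<close>.\<close>
    have conv_shift: "conv G f g (y \<otimes> e) = conv G f g y" if y: "y \<in> carrier G" and e: "e \<in> R y" for y e
    proof -
      define P where "P x d \<longleftrightarrow> d \<in> R x \<and> (\<exists>h\<in>R (inv x \<otimes> y). e = inv (inv x \<otimes> y) \<otimes> d \<otimes> (inv x \<otimes> y) \<otimes> h)" for x d
      define D where "D x = (SOME d. P x d)" for x
      have D: "P x (D x)" if x: "x \<in> carrier G" for x
      proof -
        have "x \<otimes> (inv x \<otimes> y) = y" using x y by (simp add: m_assoc[symmetric])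
        then have "\<exists>d. P x d" unfolding P_def using R_mult[of x "inv x \<otimes> y" e] x y e by auto
        then show ?thesis unfolding D_def by (rule someI_ex)
      qed
      \<comment> \<open>Replacing x by x v multiplies x^-1 y by v^-1 on the left. This stays in the
        same coset of V and amounts to conjugating d by v, which changes nothing because V is
        abelian.\<close>
      have P_coset: "P (x \<otimes> v) = P x" if x: "x \<in> carrier G" and v: "v \<in> V" for x v
      proof
        fix d
        show "P (x \<otimes> v) d = P x d"
        proof (cases "d \<in> R x")
          case True
          let ?w = "inv x \<otimes> y"
          have vG: "v \<in> carrier G" and dG: "d \<in> carrier G" using VG v RG[OF x True] by auto
          have w': "inv (x \<otimes> v) \<otimes> y = inv v \<otimes> ?w" using x y vG by (simp add: inv_mult_group m_assoc)
          have "inv v \<otimes> ?w = ?w \<otimes> (inv ?w \<otimes> inv v \<otimes> ?w)"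
            using x y vG by (simp add: m_assoc) (simp add: m_assoc[symmetric])
          moreover have "inv ?w \<otimes> inv v \<otimes> ?w \<in> V"
            using x y v by (intro V_conj) (simp_all add: subgroup.m_inv_closed[OF V])
          ultimately have Rw: "R (inv v \<otimes> ?w) = R ?w" using R_coset[of ?w] x y by simp
          have vd: "v \<otimes> d \<otimes> inv v = d"
            using V_comm[OF v RV[OF x True]] vG dG by (simp add: m_assoc)
          have "inv (inv v \<otimes> ?w) \<otimes> d \<otimes> (inv v \<otimes> ?w) = inv ?w \<otimes> (v \<otimes> d \<otimes> inv v) \<otimes> ?w"
            using x y vG dG by (simp add: inv_mult_group m_assoc)
          then show ?thesis unfolding P_def w' Rw vd using R_coset[OF x v] by simp
        next
          case False
          then show ?thesis unfolding P_def using R_coset[OF x v] by simp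
        qed
      qed
      have DR: "D x \<in> R x" if "x \<in> carrier G" for x using D[OF that] by (simp add: P_def)
      define \<pi> where "\<pi> x = x \<otimes> D x" for x
      have \<pi>G: "\<pi> x \<in> carrier G" if "x \<in> carrier G" for x using that DR RG by (simp add: \<pi>_def)
      \<comment> \<open>Elements with the same image lie in one coset of V, and there
        \<open>D\<close> is constant.\<close>
      have "inj_on \<pi> (carrier G)"
      proof (rule inj_onI)
        fix x x' assume x: "x \<in> carrier G" and x': "x' \<in> carrier G" and e: "\<pi> x = \<pi> x'"
        have d: "D x \<in> carrier G" "D x' \<in> carrier G" using DR RG x x' by auto
        have "x' = x \<otimes> (D x \<otimes> inv (D x'))"
          using e x x' d by (simp add: \<pi>_def m_assoc[symmetric]) (simp add: m_assoc)
        moreover have "D x \<otimes> inv (D x') \<in> V"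
          using DR RV x x' by (auto intro!: subgroup.m_closed[OF V] subgroup.m_inv_closed[OF V])
        ultimately have "P x' = P x" using P_coset[OF x] by metis
        then have "D x' = D x" by (simp add: D_def)
        then have "x \<otimes> D x = x' \<otimes> D x" using e by (simp only: \<pi>_def)
        then show "x = x'" using x x' d(1) by simp
      qed
      moreover have "\<pi> ` carrier G \<subseteq> carrier G" using \<pi>G by auto
      ultimately have bij: "bij_betw \<pi> (carrier G) (carrier G)"
        using fin by (simp add: bij_betw_def endo_inj_surj)
      have eG: "e \<in> carrier G" using RG[OF y e] .
      have "conv G f g (y \<otimes> e) = (\<Sum>x\<in>carrier G. f (\<pi> x) * g (inv (\<pi> x) \<otimes> (y \<otimes> e)))"
        unfolding conv_def by (rule sum.reindex_bij_betw[OF bij, symmetric])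
      also have "\<dots> = conv G f g y"
        unfolding conv_def
      proof (rule sum.cong[OF refl])
        fix x assume x: "x \<in> carrier G"
        let ?w = "inv x \<otimes> y"
        obtain h where h: "h \<in> R ?w" "e = inv ?w \<otimes> D x \<otimes> ?w \<otimes> h" using D[OF x] by (auto simp: P_def)
        have hG: "h \<in> carrier G" using RG[OF _ h(1)] x y by simp
        have dG: "D x \<in> carrier G" using DR RG x by blast
        have "inv (\<pi> x) \<otimes> (y \<otimes> e) = inv (D x) \<otimes> (?w \<otimes> e)"
          using x y dG eG by (simp add: \<pi>_def inv_mult_group m_assoc)
        also have "?w \<otimes> e = D x \<otimes> (?w \<otimes> h)"
          unfolding h(2) using x y dG hG by (simp add: m_assoc[symmetric])
        also have "inv (D x) \<otimes> (D x \<otimes> (?w \<otimes> h)) = ?w \<otimes> h"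
          using x y dG hG by (simp add: m_assoc[symmetric])
        finally have "g (inv (\<pi> x) \<otimes> (y \<otimes> e)) = g ?w" using f_shift[OF cf(2) _ h(1)] x y by simp
        then show "f (\<pi> x) * g (inv (\<pi> x) \<otimes> (y \<otimes> e)) = f x * g ?w"
          using f_shift[OF cf(1) x DR[OF x]] by (simp add: \<pi>_def)
      qed
      finally show ?thesis .
    qed
    show "class_function G (\<lambda>x. x <# R x) (conv G f g)"
      unfolding class_function_def
    proof (intro ballI impI)
      fix x y assume x: "x \<in> carrier G" and y: "y \<in> carrier G" and "x <# R x = y <# R y"
      then have "inv x \<otimes> y \<in> R x" using eq by simp
      from conv_shift[OF x this] show "conv G f g x = conv G f g y" using x y by (simp add: m_assoc[symmetric])
    qed
  qed
qed

text \<open>\<open>H\<close> is the centralizer of b, and \<open>R\<close> depends on the coset of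
  V. Choosing {1, b} on a V forces {1, z b} on a^-1 V, because conjugation by a exchanges b and z b.
  As a^2 is not in V, these two cosets differ; as a^4 is not in V, the coset of a^3 is neither of
  them. Hence R(a^3) = V, which makes a^3 and z a^3 equal in colour.\<close>

lemma (in group) normal_four_group_not_weakly_Schur:
  assumes fin: "finite (carrier G)" and W: "weakly_Schur G"
    and [simp]: "a \<in> carrier G" "b \<in> carrier G" "z \<in> carrier G"
    and zz: "z \<otimes> z = \<one>" and bb: "b \<otimes> b = \<one>" and ne: "z \<noteq> \<one>" "b \<noteq> \<one>" "b \<noteq> z"
    and z: "\<And>x. x \<in> carrier G \<Longrightarrow> x \<otimes> z = z \<otimes> x"
    and b: "\<And>x. x \<in> carrier G \<Longrightarrow> x \<otimes> b = b \<otimes> x \<or> x \<otimes> b = z \<otimes> b \<otimes> x"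
    and ab: "a \<otimes> b \<noteq> b \<otimes> a"
    and a4: "a \<otimes> a \<otimes> (a \<otimes> a) \<notin> {\<one>, z, b, z \<otimes> b}"
  shows False
proof -
  define V where "V = {\<one>, z, b, z \<otimes> b}"
  define H where "H = {x \<in> carrier G. x \<otimes> b = b \<otimes> x}"
  have [simp]: "inv z = z" "inv b = b" using zz bb by (simp_all add: inv_equality)
  have bz: "b \<otimes> z = z \<otimes> b" by (rule z) simp
  have zzx [simp]: "z \<otimes> (z \<otimes> x) = x" "b \<otimes> (b \<otimes> x) = x" if "x \<in> carrier G" for x
    using that zz bb by (simp_all add: m_assoc[symmetric])
  have bzx: "b \<otimes> (z \<otimes> x) = z \<otimes> (b \<otimes> x)" if "x \<in> carrier G" for x
    using that bz by (simp add: m_assoc[symmetric])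
  have xzx: "x \<otimes> (z \<otimes> y) = z \<otimes> (x \<otimes> y)" if "x \<in> carrier G" "y \<in> carrier G" for x y
    using that z[of x] by (simp add: m_assoc[symmetric])
  have "z \<otimes> b \<noteq> \<one>"
  proof
    assume "z \<otimes> b = \<one>"
    then have "z \<otimes> (z \<otimes> b) = z" by simp
    then show False using ne by simp
  qed
  moreover have "z \<otimes> b \<noteq> z"
  proof
    assume "z \<otimes> b = z"
    then have "z \<otimes> (z \<otimes> b) = \<one>" using zz by simp
    then show False using ne by simp
  qed
  moreover have "z \<otimes> b \<noteq> b"
  proof
    assume "z \<otimes> b = b"
    then have "z \<otimes> b \<otimes> b = \<one>" using bb by simp
    then show False using ne bb by (simp add: m_assoc)
  qed
  ultimately have neq: "z \<otimes> b \<noteq> \<one>" "z \<otimes> b \<noteq> z" "z \<otimes> b \<noteq> b" by auto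
  have VG: "v \<in> carrier G" if "v \<in> V" for v using that by (auto simp: V_def)
  have sub2: "subgroup {\<one>, t} G" if "t \<in> carrier G" "t \<otimes> t = \<one>" for t
    using that by (intro subgroupI) (auto simp: inv_equality)
  have V: "subgroup V G"
    by (intro subgroupI) (auto simp: V_def zz bb bz bzx m_assoc inv_mult_group)
  have V_comm: "v \<otimes> w = w \<otimes> v" if "v \<in> V" "w \<in> V" for v w
    using that by (auto simp: V_def bz bzx m_assoc)
  have Vm: "v \<otimes> w \<in> V" "inv v \<in> V" if "v \<in> V" "w \<in> V" for v w
    using subgroup.m_closed[OF V] subgroup.m_inv_closed[OF V] that by auto
  have xz: "inv x \<otimes> z \<otimes> x = z" if "x \<in> carrier G" for x
  proof -
    have "inv x \<otimes> z \<otimes> x = inv x \<otimes> (x \<otimes> z)" using that z[OF that] by (simp add: m_assoc)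
    then show ?thesis using that by (simp add: cancel_assoc)
  qed
  have xb: "inv x \<otimes> b \<otimes> x = (if x \<in> H then b else z \<otimes> b)" if x: "x \<in> carrier G" for x
  proof (cases "x \<in> H")
    case True
    then have "b \<otimes> x = x \<otimes> b" by (simp add: H_def)
    then have "inv x \<otimes> (b \<otimes> x) = b" using x by (simp add: m_assoc[symmetric])
    then show ?thesis using True x by (simp add: m_assoc)
  next
    case False
    then have "x \<otimes> b = z \<otimes> b \<otimes> x" using b[OF x] x by (simp add: H_def)
    then have "z \<otimes> (x \<otimes> b) = b \<otimes> x" using x by (simp add: m_assoc)
    then have "b \<otimes> x = x \<otimes> (z \<otimes> b)" using x xzx by simp
    then have "inv x \<otimes> (b \<otimes> x) = z \<otimes> b" using x by (simp add: m_assoc[symmetric])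
    then show ?thesis using False x by (simp add: m_assoc)
  qed
  have xzb: "inv x \<otimes> (z \<otimes> b) \<otimes> x = (if x \<in> H then z \<otimes> b else b)" if x: "x \<in> carrier G" for x
  proof -
    have "inv x \<otimes> (z \<otimes> b) \<otimes> x = z \<otimes> (inv x \<otimes> b \<otimes> x)" using x by (simp add: m_assoc xzx)
    then show ?thesis using xb[OF x] by simp
  qed
  have V_conj: "inv x \<otimes> v \<otimes> x \<in> V" if "x \<in> carrier G" "v \<in> V" for x v
    using that xz xb xzb by (auto simp: V_def)
  have V_conj': "x \<otimes> v \<otimes> inv x \<in> V" if "x \<in> carrier G" "v \<in> V" for x v
    using V_conj[of "inv x" v] that by simp
  have H: "subgroup H G"
  proof (rule subgroupI)
    fix x assume x: "x \<in> H"
    then have e: "x \<otimes> b = b \<otimes> x" "x \<in> carrier G" by (simp_all add: H_def)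
    have "b \<otimes> inv x = inv x \<otimes> (x \<otimes> b) \<otimes> inv x" using e(2) by (simp add: m_assoc cancel_assoc)
    also have "\<dots> = inv x \<otimes> (b \<otimes> x) \<otimes> inv x" by (simp only: e(1))
    also have "\<dots> = inv x \<otimes> b" using e(2) by (simp add: m_assoc)
    finally have "b \<otimes> inv x = inv x \<otimes> b" .
    then show "inv x \<in> H" using x by (simp add: H_def)
  next
    fix x y assume "x \<in> H" "y \<in> H"
    then have xy: "x \<in> carrier G" "y \<in> carrier G" "x \<otimes> b = b \<otimes> x" "y \<otimes> b = b \<otimes> y" by (auto simp: H_def)
    have "x \<otimes> y \<otimes> b = x \<otimes> b \<otimes> y" using xy(1,2,4) by (simp add: m_assoc)
    then have "x \<otimes> y \<otimes> b = b \<otimes> x \<otimes> y" by (simp only: xy(3))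
    then show "x \<otimes> y \<in> H" using xy(1,2) by (simp add: H_def m_assoc)
  qed (auto simp: H_def)
  have VH: "v \<in> H" if "v \<in> V" for v using that by (auto simp: V_def H_def bb bz bzx m_assoc)
  have Hm: "x \<otimes> y \<in> H" "inv x \<in> H" if "x \<in> H" "y \<in> H" for x y
    using subgroup.m_closed[OF H] subgroup.m_inv_closed[OF H] that by auto
  have H_iff: "x \<otimes> y \<in> H \<longleftrightarrow> x \<in> H" "y \<otimes> x \<in> H \<longleftrightarrow> x \<in> H" if "x \<in> carrier G" "y \<in> H" for x y
  proof -
    have y: "y \<in> carrier G" using that by (simp add: H_def)
    have "x \<otimes> y \<otimes> inv y = x" "inv y \<otimes> (y \<otimes> x) = x" using that y by (simp add: m_assoc, simp add: m_assoc[symmetric])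
    then show "x \<otimes> y \<in> H \<longleftrightarrow> x \<in> H" "y \<otimes> x \<in> H \<longleftrightarrow> x \<in> H" using Hm that by metis+
  qed
  have V_iff: "x \<otimes> y \<in> V \<longleftrightarrow> x \<in> V" "y \<otimes> x \<in> V \<longleftrightarrow> x \<in> V" if "x \<in> carrier G" "y \<in> V" for x y
  proof -
    have y: "y \<in> carrier G" using that VG by simp
    have "x \<otimes> y \<otimes> inv y = x" "inv y \<otimes> (y \<otimes> x) = x" using that y by (simp add: m_assoc, simp add: m_assoc[symmetric])
    then show "x \<otimes> y \<in> V \<longleftrightarrow> x \<in> V" "y \<otimes> x \<in> V \<longleftrightarrow> x \<in> V" using Vm that by metis+
  qed
  have H_inv: "inv x \<in> H \<longleftrightarrow> x \<in> H" "inv x \<in> V \<longleftrightarrow> x \<in> V" if "x \<in> carrier G" for x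
    using that Hm(2)[of x x] Hm(2)[of "inv x" "inv x"] Vm(2)[of x x] Vm(2)[of "inv x" "inv x"] by auto
  have V_swap: "y \<otimes> x \<in> V" if "x \<otimes> y \<in> V" "x \<in> carrier G" "y \<in> carrier G" for x y
    using V_conj[of x "x \<otimes> y"] that by (simp add: m_assoc[symmetric])
  have V_prod: "x \<otimes> w \<in> V"
    if "y \<otimes> x \<in> V" "inv y \<otimes> w \<in> V" "x \<in> carrier G" "w \<in> carrier G" "y \<in> carrier G" for x w y
  proof -
    have "(y \<otimes> x) \<otimes> (w \<otimes> inv y) \<in> V" using that V_swap[of "inv y" w] Vm by simp
    then have "x \<otimes> w \<otimes> inv y \<otimes> y \<in> V" using V_swap[of y "x \<otimes> w \<otimes> inv y"] that by (simp add: m_assoc)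
    then show ?thesis using that by (simp add: m_assoc)
  qed
  have aH: "a \<notin> H" using ab by (simp add: H_def)
  have a2H: "a \<otimes> a \<in> H"
  proof -
    have "a \<otimes> b = z \<otimes> b \<otimes> a" using b[of a] ab by simp
    then have 1: "a \<otimes> b = z \<otimes> (b \<otimes> a)" by (simp add: m_assoc)
    have "a \<otimes> a \<otimes> b = a \<otimes> (z \<otimes> (b \<otimes> a))" by (simp add: m_assoc 1)
    also have "\<dots> = z \<otimes> (a \<otimes> b \<otimes> a)" by (simp add: xzx m_assoc)
    also have "\<dots> = b \<otimes> (a \<otimes> a)" by (simp add: 1 m_assoc)
    finally show ?thesis by (simp add: H_def m_assoc)
  qed
  have a2V: "a \<otimes> a \<notin> V" using a4 Vm(1)[of "a \<otimes> a" "a \<otimes> a"] by (auto simp: V_def)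
  have a4V: "a \<otimes> a \<otimes> (a \<otimes> a) \<notin> V" using a4 by (simp add: V_def)
  define R where "R x = (if x \<in> V then {\<one>} else if x \<in> H then {\<one>, z}
      else if inv a \<otimes> x \<in> V then {\<one>, b} else if a \<otimes> x \<in> V then {\<one>, z \<otimes> b} else V)" for x
  have excl: False if "inv a \<otimes> x \<in> V" "a \<otimes> x \<in> V" "x \<in> carrier G" for x
  proof -
    have "inv (inv a \<otimes> x) \<in> V" using Vm that by blast
    then have "a \<otimes> x \<otimes> (inv x \<otimes> a) \<in> V" using Vm(1)[OF that(2)] that(3) by (simp add: inv_mult_group)
    moreover have "a \<otimes> x \<otimes> (inv x \<otimes> a) = a \<otimes> a" using that(3) by (simp add: m_assoc) (simp add: m_assoc[symmetric])
    ultimately show False using a2V by simp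
  qed
  have R_even: "R x = {\<one>}" if "x \<in> V" for x using that by (simp add: R_def)
  have R_H: "R x = {\<one>, z}" if "x \<in> H" "x \<notin> V" for x using that by (simp add: R_def)
  have aV_H: "x \<notin> H" if "inv a \<otimes> x \<in> V \<or> a \<otimes> x \<in> V" "x \<in> carrier G" for x
  proof
    assume "x \<in> H"
    then have "inv a \<in> H \<or> a \<in> H" using that H_iff(1)[of "inv a" x] H_iff(1)[of a x] VH by auto
    then show False using aH H_inv by simp
  qed
  have R_a: "R x = {\<one>, b}" if "inv a \<otimes> x \<in> V" "x \<in> carrier G" for x
    using that aV_H[of x] VH[of x] by (auto simp: R_def)
  have R_a': "R x = {\<one>, z \<otimes> b}" if "a \<otimes> x \<in> V" "x \<in> carrier G" for x
    using that aV_H[of x] VH[of x] excl[of x] by (auto simp: R_def)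
  have R_else: "R x = V" if "x \<notin> H" "inv a \<otimes> x \<notin> V" "a \<otimes> x \<notin> V" for x
    using that VH[of x] by (auto simp: R_def)
  have cases_R: "x \<in> V \<or> (x \<in> H \<and> x \<notin> V) \<or> inv a \<otimes> x \<in> V \<or> a \<otimes> x \<in> V \<or>
      (x \<notin> H \<and> inv a \<otimes> x \<notin> V \<and> a \<otimes> x \<notin> V)" for x using VH by blast
  have R_sub: "subgroup (R x) G" for x
    unfolding R_def by (auto simp: triv_subgroup V intro!: sub2) (simp_all add: zz bb bzx bz m_assoc)
  have R_V: "R x \<subseteq> V" for x by (auto simp: R_def V_def)
  have R_coset: "R (x \<otimes> v) = R x" if x: "x \<in> carrier G" and v: "v \<in> V" for x v
    unfolding R_def using x v VG[OF v] V_iff(1)[OF _ v] H_iff(1)[OF _ VH[OF v]] by (simp add: m_assoc[symmetric])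
  have R_one: "R \<one> = {\<one>}" by (simp add: R_def V_def)
  have R_inv: "x \<otimes> r \<otimes> inv x \<in> R (inv x)" if x: "x \<in> carrier G" and r: "r \<in> R x" for x r
  proof -
    have rV: "r \<in> V" using r R_V by blast
    have conj: "x \<otimes> z \<otimes> inv x = z" "x \<otimes> b \<otimes> inv x = (if x \<in> H then b else z \<otimes> b)"
      "x \<otimes> (z \<otimes> b) \<otimes> inv x = (if x \<in> H then z \<otimes> b else b)"
      using xz[of "inv x"] xb[of "inv x"] xzb[of "inv x"] x H_inv by auto
    consider "x \<in> V" | "x \<in> H" "x \<notin> V" | "inv a \<otimes> x \<in> V" | "a \<otimes> x \<in> V"
      | "x \<notin> H" "inv a \<otimes> x \<notin> V" "a \<otimes> x \<notin> V" using cases_R[of x] by blast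
    then show ?thesis
    proof cases
      case 1
      then show ?thesis using r x R_even[OF 1] R_even[of "inv x"] H_inv[OF x] by simp
    next
      case 2
      have "R (inv x) = {\<one>, z}" using 2 H_inv[OF x] by (intro R_H) auto
      moreover have "r = \<one> \<or> r = z" using r R_H[OF 2] by simp
      ultimately show ?thesis using x conj(1) by (elim disjE) simp_all
    next
      case 3
      have "inv (inv a \<otimes> x) \<in> V" using Vm 3 by blast
      then have "a \<otimes> inv x \<in> V" using V_swap[of "inv x" a] x by (simp add: inv_mult_group)
      then show ?thesis using r x R_a[OF 3 x] R_a'[of "inv x"] conj aV_H[of x] 3 by auto
    next
      case 4
      have "inv (a \<otimes> x) \<in> V" using Vm 4 by blast
      then have "inv a \<otimes> inv x \<in> V" using V_swap[of "inv x" "inv a"] x by (simp add: inv_mult_group)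
      then show ?thesis using r x R_a'[OF 4 x] R_a[of "inv x"] conj aV_H[of x] 4 by auto
    next
      case 5
      have "inv a \<otimes> inv x \<notin> V"
      proof
        assume "inv a \<otimes> inv x \<in> V"
        then have "inv (inv a \<otimes> inv x) \<in> V" using Vm by blast
        then show False using V_swap[of x a] x 5 by (simp add: inv_mult_group)
      qed
      moreover have "a \<otimes> inv x \<notin> V"
      proof
        assume "a \<otimes> inv x \<in> V"
        then have "inv (a \<otimes> inv x) \<in> V" using Vm by blast
        then show False using V_swap[of x "inv a"] x 5 by (simp add: inv_mult_group)
      qed
      ultimately have "R (inv x) = V" using 5 H_inv[OF x] by (intro R_else) auto
      then show ?thesis using V_conj'[OF x rV] by simp
    qed
  qed
  have R_mult: "\<exists>d\<in>R x. \<exists>f\<in>R w. e = inv w \<otimes> d \<otimes> w \<otimes> f"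
    if x: "x \<in> carrier G" and w: "w \<in> carrier G" and e: "e \<in> R (x \<otimes> w)" for x w e
  proof -
    have eV: "e \<in> V" using e R_V by blast
    have eG: "e \<in> carrier G" using VG[OF eV] .
    have one: "\<one> \<in> R y" for y using subgroup.one_closed[OF R_sub] .
    have left: ?thesis if "w \<otimes> e \<otimes> inv w \<in> R x"
      using that one[of w] eG w by (intro bexI[of _ "w \<otimes> e \<otimes> inv w"] bexI[of _ \<one>]) (simp_all add: m_assoc[symmetric], simp add: m_assoc)
    have right: ?thesis if "e \<in> R w"
      using that one[of x] eG w by (intro bexI[of _ "\<one>"] bexI[of _ e]) simp_all
    have prod: ?thesis if "R x = {\<one>, t}" "R w = {\<one>, s}" "inv w \<otimes> t \<otimes> w = t'" "e \<in> {\<one>, t', s, t' \<otimes> s}"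
        "s \<in> carrier G" "t' \<in> carrier G" for t s t'
    proof -
      have "e = inv w \<otimes> \<one> \<otimes> w \<otimes> \<one> \<or> e = inv w \<otimes> t \<otimes> w \<otimes> \<one> \<or> e = inv w \<otimes> \<one> \<otimes> w \<otimes> s \<or> e = inv w \<otimes> t \<otimes> w \<otimes> s"
        using that w by auto
      then show ?thesis unfolding that(1,2) by blast
    qed
    have eV': "e = \<one> \<or> e = z \<or> e = b \<or> e = z \<otimes> b" using eV by (simp add: V_def)
    \<comment> \<open>A factor in V, or one with R equal to V, settles the inclusion at once. For
      both factors in H all subgroups lie in {1, z}. A product of a V and a^-1 V falls into V, where
      R is trivial. In the other cases the two subgroups of order 2 differ after conjugation by w,
      so that their product is V.\<close>
    consider "x \<in> V" | "w \<in> V" | "x \<notin> H" "inv a \<otimes> x \<notin> V" "a \<otimes> x \<notin> V"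
      | "w \<notin> H" "inv a \<otimes> w \<notin> V" "a \<otimes> w \<notin> V"
      | "x \<in> H" "x \<notin> V" "w \<in> H" "w \<notin> V"
      | "x \<in> H" "x \<notin> V" "inv a \<otimes> w \<in> V" | "x \<in> H" "x \<notin> V" "a \<otimes> w \<in> V"
      | "w \<in> H" "w \<notin> V" "inv a \<otimes> x \<in> V" | "w \<in> H" "w \<notin> V" "a \<otimes> x \<in> V"
      | "inv a \<otimes> x \<in> V" "inv a \<otimes> w \<in> V" | "a \<otimes> x \<in> V" "a \<otimes> w \<in> V"
      | "inv a \<otimes> x \<in> V" "a \<otimes> w \<in> V" | "a \<otimes> x \<in> V" "inv a \<otimes> w \<in> V"
      using cases_R[of x] cases_R[of w] by blast
    then show ?thesis
    proof cases
      case 1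
      have "x \<otimes> w = w \<otimes> (inv w \<otimes> x \<otimes> w)" using x w by (simp add: m_assoc[symmetric])
      then have "R (x \<otimes> w) = R w" using R_coset[OF w V_conj[OF w 1]] by simp
      then show ?thesis using right e by simp
    next
      case 2
      have "w \<otimes> e \<otimes> inv w = e" using V_comm[OF 2 eV] w eG by (simp add: m_assoc)
      then show ?thesis using left e R_coset[OF x 2] by simp
    next
      case 3
      then show ?thesis using left V_conj'[OF w eV] R_else[of x] by simp
    next
      case 4
      then show ?thesis using right eV R_else[of w] by simp
    next
      case 5
      then have "R (x \<otimes> w) \<subseteq> {\<one>, z}" using Hm by (auto simp: R_def)
      then show ?thesis using right e R_H[of w] 5 by auto
    next
      case 6
      show ?thesis
        by (rule prod[OF R_H[OF 6(1,2)] R_a[OF 6(3) w] xz[OF w]]) (use eV' in auto)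
    next
      case 7
      show ?thesis
        by (rule prod[OF R_H[OF 7(1,2)] R_a'[OF 7(3) w] xz[OF w]]) (use eV' in auto)
    next
      case 8
      show ?thesis
        by (rule prod[OF R_a[OF 8(3) x] R_H[OF 8(1,2)] xb[OF w]]) (use eV' 8 bz in auto)
    next
      case 9
      show ?thesis
        by (rule prod[OF R_a'[OF 9(3) x] R_H[OF 9(1,2)] xzb[OF w]]) (use eV' 9 bz in \<open>auto simp: m_assoc\<close>)
    next
      case 10
      have "w \<notin> H" using aV_H 10 w by blast
      then show ?thesis
        by (intro prod[OF R_a[OF 10(1) x] R_a[OF 10(2) w] xb[OF w]]) (use eV' bb in \<open>auto simp: m_assoc\<close>)
    next
      case 11
      have "w \<notin> H" using aV_H 11 w by blast
      then show ?thesis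
        by (intro prod[OF R_a'[OF 11(1) x] R_a'[OF 11(2) w] xzb[OF w]]) (use eV' bb bz bzx in \<open>auto simp: m_assoc\<close>)
    next
      case 12
      then have "x \<otimes> w \<in> V" using V_prod[of "inv a" x w] x w by simp
      then show ?thesis using right one e R_even by auto
    next
      case 13
      then have "x \<otimes> w \<in> V" using V_prod[of a x w] x w by simp
      then show ?thesis using right one e R_even by auto
    qed
  qed
  \<comment> \<open>A colour-preserving map cannot send \<open>a\<^sup>3\<close> to \<open>z a\<^sup>3\<close>, because the configuration \<open>(a, a\<^sup>2)\<close> seen from
    \<open>(1, a\<^sup>3)\<close> is not seen from \<open>(1, z a\<^sup>3)\<close>.\<close>
  note col = coset_s_coloring[where R = R, OF fin V V_comm V_conj R_sub R_V R_coset R_one R_inv R_mult]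
  have "color_transitive G (\<lambda>x. x <# R x)"
    by (rule weakly_Schur_color_transitive[OF group_axioms fin W col(1)])
  let ?a2 = "a \<otimes> a" and ?a3 = "a \<otimes> (a \<otimes> a)"
  have a3H: "?a3 \<notin> H" using H_iff(1)[of a ?a2] a2H aH by simp
  have Ra3: "R ?a3 = V"
  proof (rule R_else[OF a3H])
    show "inv a \<otimes> ?a3 \<notin> V" using a2V by (simp add: m_assoc[symmetric])
    show "a \<otimes> ?a3 \<notin> V" using a4V by (simp add: m_assoc)
  qed
  have Ra: "R a = {\<one>, b}" by (rule R_a) (simp_all add: V_def)
  have Ra2: "R ?a2 = {\<one>, z}" by (rule R_H[OF a2H a2V])
  have Rai: "R (inv a) = {\<one>, z \<otimes> b}" by (rule R_a') (simp_all add: V_def)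
  have Rai2: "R (inv ?a2) = {\<one>, z}" by (rule R_H) (simp_all only: H_inv assms m_closed a2H a2V not_False_eq_True)
  have "?a3 <# R ?a3 = (z \<otimes> ?a3) <# R (z \<otimes> ?a3)"
    using col(2)[of ?a3 "z \<otimes> ?a3"] xz[of ?a3] Ra3 by (simp add: m_assoc V_def)
  then have "\<exists>k\<in>carrier G \<rightarrow> carrier G. k \<one> = \<one> \<and> k ?a3 = z \<otimes> ?a3 \<and>
      (\<forall>p\<in>carrier G. \<forall>q\<in>carrier G. (k p \<otimes> inv k q) <# R (k p \<otimes> inv k q) = (p \<otimes> inv q) <# R (p \<otimes> inv q))"
    using \<open>color_transitive G (\<lambda>x. x <# R x)\<close> unfolding color_transitive_def by simp
  then obtain k where k: "k \<in> carrier G \<rightarrow> carrier G" "k \<one> = \<one>" "k ?a3 = z \<otimes> ?a3"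
    "\<And>p q. p \<in> carrier G \<Longrightarrow> q \<in> carrier G \<Longrightarrow>
       (k p \<otimes> inv k q) <# R (k p \<otimes> inv k q) = (p \<otimes> inv q) <# R (p \<otimes> inv q)" by blast
  have kG: "k x \<in> carrier G" if "x \<in> carrier G" for x using k(1) that by auto
  have kR: "inv (p \<otimes> inv q) \<otimes> (k p \<otimes> inv k q) \<in> R (p \<otimes> inv q)" if "p \<in> carrier G" "q \<in> carrier G" for p q
    using col(2)[of "p \<otimes> inv q" "k p \<otimes> inv k q"] k(4)[OF that] kG that by simp
  have solve: "y = x \<otimes> r" if "inv x \<otimes> y = r" "x \<in> carrier G" "y \<in> carrier G" for x y r
    using that by (auto simp: m_assoc[symmetric])
  have u: "k a = a \<or> k a = a \<otimes> b"
    using kR[of a \<one>] kG[of a] k(2) Ra solve[of a "k a"] by auto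
  have v: "k ?a2 = ?a2 \<or> k ?a2 = ?a2 \<otimes> z"
    using kR[of ?a2 \<one>] kG[of ?a2] k(2) Ra2 solve[of ?a2 "k ?a2"] by auto
  have cancel: "?a2 \<otimes> inv a = a" "a \<otimes> inv ?a3 = inv ?a2" "?a2 \<otimes> inv ?a3 = inv a"
    by (simp_all add: inv_mult_group m_assoc) (simp_all add: m_assoc[symmetric])
  have vu: "k ?a2 \<otimes> inv k a = a \<or> k ?a2 \<otimes> inv k a = a \<otimes> b"
    using kR[of ?a2 a] kG[of a] kG[of ?a2] Ra solve[of a "k ?a2 \<otimes> inv k a"] unfolding cancel by auto
  have ux: "k a \<otimes> (inv ?a3 \<otimes> z) = inv ?a2 \<or> k a \<otimes> (inv ?a3 \<otimes> z) = inv ?a2 \<otimes> z"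
    using kR[of a ?a3] kG[of a] Rai2 solve[of "inv ?a2" "k a \<otimes> (inv ?a3 \<otimes> z)"] unfolding cancel k(3)
    by (auto simp: inv_mult_group m_assoc)
  have vx: "k ?a2 \<otimes> (inv ?a3 \<otimes> z) = inv a \<or> k ?a2 \<otimes> (inv ?a3 \<otimes> z) = inv a \<otimes> (z \<otimes> b)"
  proof -
    have iz: "inv (z \<otimes> ?a3) = inv ?a3 \<otimes> z" by (subst inv_mult_group) simp_all
    have "inv (inv a) \<otimes> (k ?a2 \<otimes> (inv ?a3 \<otimes> z)) \<in> {\<one>, z \<otimes> b}"
      using kR[of ?a2 ?a3] unfolding cancel k(3) Rai iz by simp
    then consider "inv (inv a) \<otimes> (k ?a2 \<otimes> (inv ?a3 \<otimes> z)) = \<one>" |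
      "inv (inv a) \<otimes> (k ?a2 \<otimes> (inv ?a3 \<otimes> z)) = z \<otimes> b" by blast
    then show ?thesis using kG[of ?a2] by cases (drule solve; simp)+
  qed
  \<comment> \<open>The colour relative to a^3 excludes k(a^2) = a^2, leaving a^2 z. The colour of
    k(a^2) k(a)^-1 then excludes k(a) = a, leaving a b. Finally k(a) k(a^3)^-1 = a^-2 b is not in
    the class of a^-2.\<close>
  have "k ?a2 \<noteq> ?a2"
  proof
    assume e: "k ?a2 = ?a2"
    have "?a2 \<otimes> (inv ?a3 \<otimes> z) = inv a \<otimes> z" using cancel(3) by (simp add: m_assoc[symmetric])
    then show False using vx e ne neq by auto
  qed
  then have v': "k ?a2 = ?a2 \<otimes> z" using v by simp
  have "k a \<noteq> a"
  proof
    assume e: "k a = a"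
    have "?a2 \<otimes> z \<otimes> inv a = ?a2 \<otimes> (z \<otimes> inv a)" by (simp add: m_assoc)
    also have "z \<otimes> inv a = inv a \<otimes> z" using z[of "inv a"] by simp
    also have "?a2 \<otimes> (inv a \<otimes> z) = ?a2 \<otimes> inv a \<otimes> z" by (rule m_assoc[symmetric]) simp_all
    finally have "?a2 \<otimes> z \<otimes> inv a = a \<otimes> z" by (simp only: cancel(1))
    then show False using vu e v' ne by auto
  qed
  then have u': "k a = a \<otimes> b" using u by simp
  have "a \<otimes> b \<otimes> inv a = z \<otimes> b" using xb[of "inv a"] aH H_inv by simp
  moreover have "a \<otimes> b \<otimes> (inv ?a3 \<otimes> z) = a \<otimes> b \<otimes> inv a \<otimes> (a \<otimes> inv ?a3) \<otimes> z"
    by (simp add: m_assoc cancel_assoc)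
  ultimately have "a \<otimes> b \<otimes> (inv ?a3 \<otimes> z) = z \<otimes> b \<otimes> (a \<otimes> inv ?a3) \<otimes> z" by simp
  also have "\<dots> = b \<otimes> inv ?a2" unfolding cancel using z[of "z \<otimes> b \<otimes> inv ?a2"] by (simp add: m_assoc del: inv_mult_group)
  also have "\<dots> = inv ?a2 \<otimes> b"
  proof -
    have "inv ?a2 \<in> H" using a2H H_inv by simp
    then show ?thesis by (simp add: H_def)
  qed
  finally show False using ux u' ne by auto
qed


section \<open>Extensions of the direct product of cyclic groups of orders 4 and 2\<close>

text \<open>The elements r and z generate a direct product C4 x C2. Powers are written as nested
  products so that \<open>Z4_Z2_simps\<close> can sort and shorten words by rewriting.\<close>

definition (in group) Z4_Z2 :: "'a \<Rightarrow> 'a \<Rightarrow> bool" where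
  "Z4_Z2 r z \<longleftrightarrow> r \<in> carrier G \<and> z \<in> carrier G \<and> r \<otimes> z = z \<otimes> r \<and>
     r \<otimes> (r \<otimes> (r \<otimes> r)) = \<one> \<and> r \<otimes> r \<noteq> \<one> \<and> z \<otimes> z = \<one> \<and> z \<noteq> \<one> \<and> z \<noteq> r \<otimes> r"

definition (in group) span42 :: "'a \<Rightarrow> 'a \<Rightarrow> 'a set" where
  "span42 r z = {\<one>, r, r \<otimes> r, r \<otimes> (r \<otimes> r), z, r \<otimes> z, r \<otimes> (r \<otimes> z), r \<otimes> (r \<otimes> (r \<otimes> z))}"

context group
begin

lemma Z4_Z2_simps:
  assumes "Z4_Z2 r z"
  shows "r \<in> carrier G" "z \<in> carrier G" "z \<otimes> r = r \<otimes> z" "x \<in> carrier G \<Longrightarrow> z \<otimes> (r \<otimes> x) = r \<otimes> (z \<otimes> x)"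
    "r \<otimes> (r \<otimes> (r \<otimes> r)) = \<one>" "x \<in> carrier G \<Longrightarrow> r \<otimes> (r \<otimes> (r \<otimes> (r \<otimes> x))) = x"
    "z \<otimes> z = \<one>" "x \<in> carrier G \<Longrightarrow> z \<otimes> (z \<otimes> x) = x"
proof -
  have rz: "r \<in> carrier G" "z \<in> carrier G" "r \<otimes> z = z \<otimes> r" "r \<otimes> (r \<otimes> (r \<otimes> r)) = \<one>" "z \<otimes> z = \<one>"
    using assms by (auto simp: Z4_Z2_def)
  then show "r \<in> carrier G" "z \<in> carrier G" "z \<otimes> r = r \<otimes> z" "r \<otimes> (r \<otimes> (r \<otimes> r)) = \<one>" "z \<otimes> z = \<one>" by auto
  show "x \<in> carrier G \<Longrightarrow> z \<otimes> (r \<otimes> x) = r \<otimes> (z \<otimes> x)" using rz(1-3) by (simp flip: m_assoc)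
  show "x \<in> carrier G \<Longrightarrow> z \<otimes> (z \<otimes> x) = x" using rz(2,5) by (simp flip: m_assoc)
  assume x: "x \<in> carrier G"
  have "r \<otimes> (r \<otimes> (r \<otimes> (r \<otimes> x))) = r \<otimes> (r \<otimes> (r \<otimes> r)) \<otimes> x" using rz(1) x by (simp add: m_assoc)
  then show "r \<otimes> (r \<otimes> (r \<otimes> (r \<otimes> x))) = x" using rz(4) x by simp
qed

lemma Z4_Z2_int_pow:
  assumes "Z4_Z2 r z"
  shows "r [^] (i::int) \<otimes> z [^] (j::int) \<in> span42 r z"
    and "r [^] i \<otimes> z [^] j = \<one> \<Longrightarrow> 4 dvd i \<and> 2 dvd j"
proof -
  note s = Z4_Z2_simps[OF assms]
  have 4: "r [^] (4::int) = \<one>" and 2: "z [^] (2::int) = \<one>"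
    using s by (simp_all add: int_pow_numerals)
  have eq: "r [^] i \<otimes> z [^] j = r [^] (i mod 4) \<otimes> z [^] (j mod 2)"
    using int_pow_mod[OF s(1) 4] int_pow_mod[OF s(2) 2] by simp
  have i: "i mod 4 = 0 \<or> i mod 4 = 1 \<or> i mod 4 = 2 \<or> i mod 4 = 3" by presburger
  have j: "j mod 2 = 0 \<or> j mod 2 = 1" by presburger
  show "r [^] i \<otimes> z [^] j \<in> span42 r z"
    unfolding eq span42_def using i j s(1,2) by (auto simp: int_pow_numerals m_assoc)
  assume "r [^] i \<otimes> z [^] j = \<one>"
  then have 1: "r [^] (i mod 4) \<otimes> z [^] (j mod 2) = \<one>" using eq by simp
  have ne: "r \<otimes> r \<noteq> \<one>" "z \<noteq> \<one>" "z \<noteq> r \<otimes> r" using assms by (auto simp: Z4_Z2_def)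
  have n1: "r \<noteq> \<one>" using ne(1) by auto
  have n2: "r \<otimes> (r \<otimes> r) \<noteq> \<one>" using s(5) n1 s(1) by (metis r_one)
  have n3: "r \<otimes> z \<noteq> \<one>"
  proof
    assume "r \<otimes> z = \<one>"
    then have "r \<otimes> z \<otimes> (r \<otimes> z) = \<one>" by simp
    then show False using s ne(1) by (simp add: m_assoc)
  qed
  have n4: "r \<otimes> (r \<otimes> z) \<noteq> \<one>"
  proof
    assume "r \<otimes> (r \<otimes> z) = \<one>"
    then have "r \<otimes> (r \<otimes> (r \<otimes> (r \<otimes> z))) = r \<otimes> r" using s(1) by simp
    then show False using s(2,6) ne(3) by simp
  qed
  have n5: "r \<otimes> (r \<otimes> (r \<otimes> z)) \<noteq> \<one>"
  proof
    assume "r \<otimes> (r \<otimes> (r \<otimes> z)) = \<one>"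
    then have "r \<otimes> (r \<otimes> (r \<otimes> (r \<otimes> z))) = r" using s(1) by simp
    then have "z = r" using s(2,6) by simp
    then show False using s(7) ne(1) by simp
  qed
  have "i mod 4 = 0 \<and> j mod 2 = 0"
    using i j 1 s(1,2) ne n1 n2 n3 n4 n5 by (auto simp: int_pow_numerals m_assoc)
  then show "4 dvd i \<and> 2 dvd j" by presburger
qed

lemma ext42_not_weakly_Schur:
  assumes fin: "finite (carrier G)" and W: "weakly_Schur G"
    and rz: "Z4_Z2 r z" and s: "s \<in> carrier G" "s \<notin> span42 r z"
    and sz: "s \<otimes> z = z \<otimes> s" and sr: "s \<otimes> r = r [^] (p::int) \<otimes> z [^] (t::int) \<otimes> s"
    and ss: "s \<otimes> s = r [^] (v::int) \<otimes> z [^] (w::int)"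
    and check: "ext_not_Schur 4 2 p t v w c x y g h"
    and xygh: "x \<in> {0..15}" "y \<in> {0..15}" "g \<in> {0..15}" "h \<in> {0..15}"
  shows False
proof (rule ext_not_weakly_Schur[OF fin W _ _ _ _ _ s(1) _ sz sr ss _ _ _ _ check xygh])
  note simps = Z4_Z2_simps[OF rz]
  show "r [^] (4::int) = \<one>" "z [^] (2::int) = \<one>" "r \<in> carrier G" "z \<in> carrier G" "r \<otimes> z = z \<otimes> r"
    using simps by (simp_all add: int_pow_numerals)
  show "4 dvd i \<and> 2 dvd a" if "r [^] i \<otimes> z [^] a = \<one>" for i a :: int
    using Z4_Z2_int_pow(2)[OF rz that] .
  show "s \<noteq> r [^] i \<otimes> z [^] a" for i a :: int
    using Z4_Z2_int_pow(1)[OF rz, of i a] s(2) by auto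
qed simp_all

text \<open>This automorphism of C4 x C2 lets s^2 = r^2 z be treated as s^2 = z.\<close>

lemma span42_change:
  assumes "Z4_Z2 r z"
  shows "Z4_Z2 r (r \<otimes> (r \<otimes> z))" "span42 r (r \<otimes> (r \<otimes> z)) = span42 r z"
proof -
  note s = Z4_Z2_simps[OF assms]
  have ne: "r \<otimes> r \<noteq> \<one>" "z \<noteq> \<one>" "z \<noteq> r \<otimes> r" using assms by (auto simp: Z4_Z2_def)
  have "r \<otimes> (r \<otimes> z) \<noteq> \<one>"
    using Z4_Z2_int_pow(2)[OF assms, of 2 1] s(1,2) by (auto simp: int_pow_numerals m_assoc)
  moreover have "r \<otimes> (r \<otimes> z) \<noteq> r \<otimes> r" using s(1,2) ne by (simp flip: m_assoc)
  ultimately show "Z4_Z2 r (r \<otimes> (r \<otimes> z))"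
    using s ne by (simp add: Z4_Z2_def m_assoc)
  show "span42 r (r \<otimes> (r \<otimes> z)) = span42 r z"
    unfolding span42_def using s by (auto simp: m_assoc)
qed

lemma span42_mult:
  assumes "Z4_Z2 r z" "x \<in> span42 r z" "y \<in> span42 r z"
  shows "x \<otimes> y \<in> span42 r z"
proof -
  note s = Z4_Z2_simps[OF assms(1)]
  show ?thesis using assms(2,3) s(1,2) unfolding span42_def
    by (elim insertE emptyE) (simp_all add: m_assoc s)
qed

lemma span42_subgroup:
  assumes "Z4_Z2 r z"
  shows "subgroup (span42 r z) G"
proof (rule subgroupI)
  note s = Z4_Z2_simps[OF assms]
  show sub: "span42 r z \<subseteq> carrier G" using s(1,2) by (auto simp: span42_def)
  show "x \<otimes> y \<in> span42 r z" if "x \<in> span42 r z" "y \<in> span42 r z" for x y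
    using span42_mult[OF assms that] .
  show "inv x \<in> span42 r z" if x: "x \<in> span42 r z" for x
  proof -
    have "x \<otimes> x \<otimes> x \<otimes> x = \<one>"
      using x s(1,2) unfolding span42_def by (elim insertE emptyE) (simp_all add: m_assoc s)
    then have "inv x = x \<otimes> x \<otimes> x" using x sub by (intro inv_equality) auto
    then show ?thesis using span42_mult[OF assms] x by simp
  qed
qed (auto simp: span42_def)

text \<open>From s r = r z s one gets (s r)^2 = r^2 z s^2, so passing from s to s r reduces
  everything to s^2 = 1 and s^2 = z. In the latter case s has order 4 and r s = s^-1 r. Then s and
  r^2 generate the C4 x C2, r is the adjoined element, and the group is a semidirect product of C4
  by C4.\<close>

lemma twisted_ext42_not_weakly_Schur:
  assumes fin: "finite (carrier G)" and W: "weakly_Schur G"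
    and rz: "Z4_Z2 r z" and s: "s \<in> carrier G" "s \<notin> span42 r z"
    and sz: "s \<otimes> z = z \<otimes> s" and sr: "s \<otimes> r = r \<otimes> z \<otimes> s"
    and ss: "s \<otimes> s \<in> {\<one>, r \<otimes> r, z, r \<otimes> (r \<otimes> z)}"
  shows False
proof -
  note A = Z4_Z2_simps[OF rz]
  have ne: "r \<otimes> r \<noteq> \<one>" "z \<noteq> \<one>" "z \<noteq> r \<otimes> r" using rz by (auto simp: Z4_Z2_def)
  have one: False if "s \<in> carrier G" "s \<notin> span42 r z" "s \<otimes> z = z \<otimes> s" "s \<otimes> r = r \<otimes> z \<otimes> s" "s \<otimes> s = \<one>" for s
    by (rule ext42_not_weakly_Schur[OF fin W rz that(1,2,3) _ _ semidirect_42_2_not_Schur])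
       (use that A in simp_all)
  have zed: False if t: "s \<in> carrier G" "s \<notin> span42 r z" "s \<otimes> z = z \<otimes> s" "s \<otimes> r = r \<otimes> z \<otimes> s" "s \<otimes> s = z" for s
  proof -
    have s_r: "s \<otimes> (r \<otimes> x) = r \<otimes> (z \<otimes> (s \<otimes> x))" if "x \<in> carrier G" for x
      using t(1,4) A(1,2) that by (simp add: m_assoc[symmetric])
    have s_z: "s \<otimes> (z \<otimes> x) = z \<otimes> (s \<otimes> x)" if "x \<in> carrier G" for x
      using t(1,3) A(1,2) that by (simp add: m_assoc[symmetric])
    have s_s: "s \<otimes> (s \<otimes> x) = z \<otimes> x" if "x \<in> carrier G" for x
      using t(1,5) A(1,2) that by (simp add: m_assoc[symmetric])
    have sr': "s \<otimes> r = r \<otimes> (z \<otimes> s)" using t(1,4) A(1,2) by (simp add: m_assoc)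
    have comm: "s \<otimes> (r \<otimes> r) = r \<otimes> (r \<otimes> s)"
      using t(1) A sr' s_r s_z by (simp add: m_assoc)
    have rs: "Z4_Z2 s (r \<otimes> r)"
      unfolding Z4_Z2_def using t(1,5) A ne comm s_s by (auto simp: m_assoc)
    have "s \<otimes> x \<notin> span42 r z" if "x \<in> span42 r z" for x
    proof
      assume "s \<otimes> x \<in> span42 r z"
      then have "s \<otimes> x \<otimes> inv x \<in> span42 r z"
        using subgroup.m_inv_closed[OF span42_subgroup[OF rz] that] span42_mult[OF rz] by blast
      then show False using t(1,2) subgroup.mem_carrier[OF span42_subgroup[OF rz] that] by (simp add: m_assoc)
    qed
    then have "s \<otimes> z \<noteq> r" "s \<otimes> (r \<otimes> r) \<noteq> r" "s \<otimes> (r \<otimes> (r \<otimes> z)) \<noteq> r"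
      unfolding span42_def by blast+
    moreover have "r \<noteq> \<one>" "r \<noteq> z" "r \<noteq> r \<otimes> r" "r \<noteq> r \<otimes> (r \<otimes> z)" "s \<noteq> r"
      using A ne Z4_Z2_int_pow(2)[OF rz, of 1 1] t(2) by (auto simp: int_pow_numerals span42_def)
    moreover have "span42 s (r \<otimes> r) =
        {\<one>, s, z, s \<otimes> z, r \<otimes> r, s \<otimes> (r \<otimes> r), r \<otimes> (r \<otimes> z), s \<otimes> (r \<otimes> (r \<otimes> z))}"
      unfolding span42_def using t(1,5) A s_s by simp
    ultimately have r: "r \<notin> span42 s (r \<otimes> r)" by auto
    have rel: "r \<otimes> s = s [^] (3::int) \<otimes> (r \<otimes> r) [^] (0::int) \<otimes> r"
      using t(1,3,5) A sr' s_z s_r by (simp add: int_pow_numerals m_assoc)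
    have sq: "r \<otimes> r = s [^] (0::int) \<otimes> (r \<otimes> r) [^] (1::int)" using A by simp
    have rc: "r \<otimes> (r \<otimes> r) = r \<otimes> r \<otimes> r" using A by (simp add: m_assoc)
    show False
      by (rule ext42_not_weakly_Schur[OF fin W rs A(1) r rc rel sq semidirect_4_4_not_Schur]) simp_all
  qed
  let ?s = "s \<otimes> r"
  have s_r: "s \<otimes> (r \<otimes> x) = r \<otimes> (z \<otimes> (s \<otimes> x))" if "x \<in> carrier G" for x
    using s(1) sr A(1,2) that by (simp add: m_assoc[symmetric])
  have s_z: "s \<otimes> (z \<otimes> x) = z \<otimes> (s \<otimes> x)" if "x \<in> carrier G" for x
    using s(1) sz A(1,2) that by (simp add: m_assoc[symmetric])
  have sr': "s \<otimes> r = r \<otimes> (z \<otimes> s)" using s(1) sr A(1,2) by (simp add: m_assoc)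
  have s': "?s \<in> carrier G" "?s \<otimes> z = z \<otimes> ?s" "?s \<otimes> r = r \<otimes> z \<otimes> ?s"
    using s(1) A sr' s_z s_r sz by (simp_all add: m_assoc)
  have s'_notin: "?s \<notin> span42 r z"
  proof
    assume "?s \<in> span42 r z"
    moreover have "r \<otimes> (r \<otimes> r) \<in> span42 r z" by (simp add: span42_def)
    ultimately have "?s \<otimes> (r \<otimes> (r \<otimes> r)) \<in> span42 r z" by (rule span42_mult[OF rz])
    then show False using s A by (simp add: m_assoc)
  qed
  have s's': "?s \<otimes> ?s = r \<otimes> (r \<otimes> (z \<otimes> (s \<otimes> s)))"
    using s(1) A sr' s_z s_r sz by (simp add: m_assoc)
  from ss consider "s \<otimes> s = \<one>" | "s \<otimes> s = r \<otimes> r" | "s \<otimes> s = z" | "s \<otimes> s = r \<otimes> (r \<otimes> z)" by blast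
  then show False
  proof cases
    case 1
    then show False using one[OF s sz sr] by simp
  next
    case 2
    have "?s \<otimes> ?s = z" unfolding s's' 2 using A by simp
    then show False using zed[OF s'(1) s'_notin s'(2,3)] by simp
  next
    case 3
    then show False using zed[OF s sz sr] by simp
  next
    case 4
    have "?s \<otimes> ?s = \<one>" unfolding s's' 4 using A by simp
    then show False using one[OF s'(1) s'_notin s'(2,3)] by simp
  qed
qed

text \<open>
  Up to replacing \<open>z\<close> by \<open>r\<^sup>2 z\<close> or \<open>s\<close> by \<open>s r\<close>, or exchanging \<open>r\<close> and \<open>s\<close>, only six groups of order 16
  contradict the conclusion.
\<close>

theorem centralized_ext42:
  assumes fin: "finite (carrier G)" and W: "weakly_Schur G"
    and rz: "Z4_Z2 r z" and s: "s \<in> carrier G" "s \<notin> span42 r z"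
    and sz: "s \<otimes> z = z \<otimes> s" and conj: "s \<otimes> r \<otimes> inv s \<in> span42 r z"
    and ss: "s \<otimes> s \<in> span42 r z"
  shows "s \<otimes> s \<otimes> (s \<otimes> s) \<noteq> \<one>"
proof
  assume s4: "s \<otimes> s \<otimes> (s \<otimes> s) = \<one>"
  note A = Z4_Z2_simps[OF rz]
  have ne: "r \<otimes> r \<noteq> \<one>" "z \<noteq> \<one>" "z \<noteq> r \<otimes> r" using rz by (auto simp: Z4_Z2_def)
  let ?z = "r \<otimes> (r \<otimes> z)"
  note rz' = span42_change[OF rz]
  define q where "q = s \<otimes> r \<otimes> inv s"
  have qG: "q \<in> carrier G" using s A by (simp add: q_def)
  have sr: "s \<otimes> r = q \<otimes> s" using s A by (simp add: q_def m_assoc)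
  have "q \<otimes> q = s \<otimes> (r \<otimes> r) \<otimes> inv s" using s A by (simp add: q_def m_assoc cancel_assoc)
  then have qq: "q \<otimes> q \<noteq> \<one>" using ne(1) s A
    by (metis inv_closed inv_solve_right m_assoc m_closed l_one r_cancel_one' r_inv)
  have ss4: "s \<otimes> s = \<one> \<or> s \<otimes> s = r \<otimes> r \<or> s \<otimes> s = z \<or> s \<otimes> s = ?z"
  proof -
    have "x \<otimes> x = \<one> \<longrightarrow> x = \<one> \<or> x = r \<otimes> r \<or> x = z \<or> x = ?z" if "x \<in> span42 r z" for x
      using that A(1,2) ne unfolding span42_def by (elim insertE emptyE) (simp_all add: m_assoc A)
    then show ?thesis using ss s4 by blast
  qed
  \<comment> \<open>The square of q is conjugate to r^2, so q is one of the four elements of order 4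
    in C4 x C2.\<close>
  have q4: "q = r \<or> q = r \<otimes> (r \<otimes> r) \<or> q = r \<otimes> z \<or> q = r \<otimes> ?z"
  proof -
    have "x \<otimes> x \<noteq> \<one> \<longrightarrow> x = r \<or> x = r \<otimes> (r \<otimes> r) \<or> x = r \<otimes> z \<or> x = r \<otimes> ?z" if "x \<in> span42 r z" for x
      using that A(1,2) ne unfolding span42_def by (elim insertE emptyE) (simp_all add: m_assoc A)
    then show ?thesis using conj qq q_def by blast
  qed
  have srr: "s \<otimes> (r \<otimes> r) = q \<otimes> q \<otimes> s"
  proof -
    have "s \<otimes> (r \<otimes> r) = s \<otimes> r \<otimes> r" using s A by (simp add: m_assoc)
    also have "\<dots> = q \<otimes> (s \<otimes> r)" using s A qG by (simp add: sr m_assoc[of q s r])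
    also have "\<dots> = q \<otimes> q \<otimes> s" using s A qG by (simp add: sr m_assoc)
    finally show ?thesis .
  qed
  have sz': "s \<otimes> ?z = ?z \<otimes> s" if "q \<otimes> q = r \<otimes> r"
  proof -
    have "s \<otimes> ?z = s \<otimes> (r \<otimes> r) \<otimes> z" using s A by (simp add: m_assoc)
    also have "\<dots> = r \<otimes> r \<otimes> (s \<otimes> z)" unfolding srr that using s A by (simp add: m_assoc)
    also have "\<dots> = ?z \<otimes> s" unfolding sz using s A by (simp add: m_assoc)
    finally show ?thesis .
  qed
  from q4 consider (id) "q = r" | (inv) "q = r \<otimes> (r \<otimes> r)" | (tw) "q = r \<otimes> z" | (tw') "q = r \<otimes> ?z" by blast
  then show False
  proof cases
    case id
    from ss4 consider "s \<otimes> s = \<one>" | "s \<otimes> s = r \<otimes> r" | "s \<otimes> s = z" | "s \<otimes> s = ?z" by blast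
    then show False
    proof cases
      case 1
      then show False
        by (intro ext42_not_weakly_Schur[OF fin W rz s sz _ _ abelian_4_2_2_not_Schur]) (use id A sr s in simp_all)
    next
      case 2
      \<comment> \<open>Here s and r commute and have the same square r^2, so s r has trivial
        square.\<close>
      let ?s = "s \<otimes> r"
      have rs: "s \<otimes> r = r \<otimes> s" using sr id by simp
      have s_r: "s \<otimes> (r \<otimes> x) = r \<otimes> (s \<otimes> x)" if "x \<in> carrier G" for x
        using rs s A that by (simp add: m_assoc[symmetric])
      have s_z: "s \<otimes> (z \<otimes> x) = z \<otimes> (s \<otimes> x)" if "x \<in> carrier G" for x
        using s sz A(1,2) that by (simp add: m_assoc[symmetric])
      have notin: "?s \<notin> span42 r z"
      proof
        assume "?s \<in> span42 r z"
        moreover have "r \<otimes> (r \<otimes> r) \<in> span42 r z" by (simp add: span42_def)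
        ultimately have "?s \<otimes> (r \<otimes> (r \<otimes> r)) \<in> span42 r z" by (rule span42_mult[OF rz])
        then show False using s A by (simp add: m_assoc)
      qed
      have "?s \<otimes> ?s = r \<otimes> (r \<otimes> (s \<otimes> s))" using s A rs s_r by (simp add: m_assoc)
      then have sq: "?s \<otimes> ?s = \<one>" using 2 A by simp
      show False
        by (rule ext42_not_weakly_Schur[OF fin W rz _ notin _ _ _ abelian_4_2_2_not_Schur])
           (use sq s A rs s_r s_z sz in \<open>simp_all add: m_assoc\<close>)
    next
      case 3
      then show False
        by (intro ext42_not_weakly_Schur[OF fin W rz s sz _ _ abelian_4_4_not_Schur]) (use id A sr s in simp_all)
    next
      case 4
      then show False
        by (intro ext42_not_weakly_Schur[OF fin W rz'(1) s(1) s(2)[folded rz'(2)] sz' _ _ abelian_4_4_not_Schur])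
           (use id A sr s in simp_all)
    qed
  next
    case inv
    have sr3: "s \<otimes> r = r [^] (3::int) \<otimes> y [^] (0::int) \<otimes> s" for y
      using inv sr s A by (simp add: int_pow_numerals)
    from ss4 consider "s \<otimes> s = \<one>" | "s \<otimes> s = r \<otimes> r" | "s \<otimes> s = z" | "s \<otimes> s = ?z" by blast
    then show False
    proof cases
      case 1
      then show False
        by (intro ext42_not_weakly_Schur[OF fin W rz s sz sr3 _ dihedral8_2_not_Schur]) (use A in simp_all)
    next
      case 2
      then show False
        by (intro ext42_not_weakly_Schur[OF fin W rz s sz sr3 _ quaternion8_2_not_Schur])
           (use A in \<open>simp_all add: int_pow_numerals\<close>)
    next
      case 3
      then show False
        by (intro ext42_not_weakly_Schur[OF fin W rz s sz sr3 _ semidirect_4_4_not_Schur]) (use A in simp_all)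
    next
      case 4
      then show False
        by (intro ext42_not_weakly_Schur[OF fin W rz'(1) s(1) s(2)[folded rz'(2)] sz' sr3 _ semidirect_4_4_not_Schur])
           (use inv A in \<open>simp_all add: m_assoc\<close>)
    qed
  next
    case tw
    show False
      by (rule twisted_ext42_not_weakly_Schur[OF fin W rz s sz]) (use tw sr ss4 in auto)
  next
    case tw'
    have "s \<otimes> ?z = ?z \<otimes> s" by (rule sz') (use tw' A in \<open>simp add: m_assoc\<close>)
    moreover have "r \<otimes> (r \<otimes> ?z) = z" using A by simp
    ultimately show False
      using twisted_ext42_not_weakly_Schur[OF fin W rz'(1) s(1) s(2)[folded rz'(2)]] tw' sr ss4 by auto
  qed
qed

end


section \<open>Finite 2-groups\<close>

context group
begin

section \<open>Subgroups of index 2 and fixed points of 2-groups\<close>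

lemma index_two:
  assumes fin: "finite (carrier G)" and H: "subgroup H G" and L: "subgroup L G" and HL: "H \<subseteq> L"
    and card: "card L = 2 * card H" and s: "s \<in> L" "s \<notin> H"
  shows "L = H \<union> (\<lambda>h. s \<otimes> h) ` H" "s \<otimes> s \<in> H" "h \<in> H \<Longrightarrow> s \<otimes> h \<otimes> inv s \<in> H"
proof -
  have LG: "x \<in> carrier G" if "x \<in> L" for x using subgroup.mem_carrier[OF L that] .
  have finL: "finite L" using fin subgroup.subset[OF L] finite_subset by blast
  have sG: "s \<in> carrier G" using LG s by blast
  have HG: "x \<in> carrier G" if "x \<in> H" for x using LG HL that by blast
  have Hm: "x \<otimes> y \<in> H" "inv x \<in> H" if "x \<in> H" "y \<in> H" for x y
    using subgroup.m_closed[OF H] subgroup.m_inv_closed[OF H] that by auto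
  have inj: "inj_on (\<lambda>h. s \<otimes> h) H" using HG sG by (auto simp: inj_on_def)
  have disj: "H \<inter> (\<lambda>h. s \<otimes> h) ` H = {}"
  proof -
    have "s \<otimes> h \<notin> H" if h: "h \<in> H" for h
    proof
      assume "s \<otimes> h \<in> H"
      then have "s \<otimes> h \<otimes> inv h \<in> H" using Hm h by blast
      then show False using s sG HG[OF h] by (simp add: m_assoc)
    qed
    then show ?thesis by blast
  qed
  have "card (H \<union> (\<lambda>h. s \<otimes> h) ` H) = card L"
    using card disj finL HL by (subst card_Un_disjoint) (auto intro: finite_subset simp: card_image[OF inj])
  moreover have "H \<union> (\<lambda>h. s \<otimes> h) ` H \<subseteq> L" using HL s subgroup.m_closed[OF L] by auto
  ultimately show L_eq: "L = H \<union> (\<lambda>h. s \<otimes> h) ` H" using finL by (metis card_subset_eq)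
  show "s \<otimes> s \<in> H"
  proof (rule ccontr)
    assume "s \<otimes> s \<notin> H"
    moreover have "s \<otimes> s \<in> L" using s subgroup.m_closed[OF L] by blast
    ultimately obtain h where "h \<in> H" "s \<otimes> s = s \<otimes> h" using L_eq by blast
    then show False using s sG HG by simp
  qed
  show "s \<otimes> h \<otimes> inv s \<in> H" if h: "h \<in> H"
  proof (rule ccontr)
    assume "s \<otimes> h \<otimes> inv s \<notin> H"
    moreover have "s \<otimes> h \<otimes> inv s \<in> L"
      using s h HL subgroup.m_closed[OF L] subgroup.m_inv_closed[OF L] by blast
    ultimately obtain k where k: "k \<in> H" "s \<otimes> h \<otimes> inv s = s \<otimes> k" using L_eq by blast
    then have "h \<otimes> inv s = k" using sG HG h by (simp add: m_assoc)
    then have "s = inv k \<otimes> h"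
      using sG HG[OF h] HG[OF k(1)] by (metis inv_closed inv_inv inv_mult_group inv_solve_left m_closed)
    then show False using Hm h k s by auto
  qed
qed

lemma adjoin_subgroup:
  assumes fin: "finite (carrier G)" and H: "subgroup H G" and s: "s \<in> carrier G" "s \<notin> H"
    and ss: "s \<otimes> s \<in> H" and norm: "\<And>h. h \<in> H \<Longrightarrow> s \<otimes> h \<otimes> inv s \<in> H"
  shows "subgroup (H \<union> (\<lambda>h. s \<otimes> h) ` H) G" "card (H \<union> (\<lambda>h. s \<otimes> h) ` H) = 2 * card H"
proof -
  have HG: "x \<in> carrier G" if "x \<in> H" for x using subgroup.mem_carrier[OF H that] .
  have Hm: "x \<otimes> y \<in> H" "inv x \<in> H" if "x \<in> H" "y \<in> H" for x y
    using subgroup.m_closed[OF H] subgroup.m_inv_closed[OF H] that by auto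
  have finH: "finite H" using fin subgroup.subset[OF H] finite_subset by blast
  have norm': "inv s \<otimes> h \<otimes> s \<in> H" if h: "h \<in> H" for h
  proof -
    have "inv (s \<otimes> s) \<otimes> (s \<otimes> h \<otimes> inv s) \<otimes> (s \<otimes> s) \<in> H"
      by (intro Hm(1) Hm(2)[OF ss ss] ss norm[OF h])
    moreover have "inv (s \<otimes> s) \<otimes> (s \<otimes> h \<otimes> inv s) \<otimes> (s \<otimes> s) = inv s \<otimes> h \<otimes> s"
      using s HG[OF h] by (simp add: m_assoc inv_mult_group cancel_assoc)
    ultimately show ?thesis by simp
  qed
  show "subgroup (H \<union> (\<lambda>h. s \<otimes> h) ` H) G"
  proof (rule finite_subgroupI[OF fin])
    show "H \<union> (\<lambda>h. s \<otimes> h) ` H \<subseteq> carrier G" using HG s by auto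
    show "H \<union> (\<lambda>h. s \<otimes> h) ` H \<noteq> {}" using subgroup.one_closed[OF H] by blast
    fix x y assume x: "x \<in> H \<union> (\<lambda>h. s \<otimes> h) ` H" and y: "y \<in> H \<union> (\<lambda>h. s \<otimes> h) ` H"
    have 1: "h \<otimes> k \<in> H" if "h \<in> H" "k \<in> H" for h k using Hm that by blast
    have 2: "(s \<otimes> h) \<otimes> k = s \<otimes> (h \<otimes> k)" if "h \<in> H" "k \<in> H" for h k using that HG s by (simp add: m_assoc)
    have 3: "h \<otimes> (s \<otimes> k) = s \<otimes> (inv s \<otimes> h \<otimes> s \<otimes> k)" if "h \<in> H" "k \<in> H" for h k
      using that HG s by (simp add: m_assoc cancel_assoc)
    have 4: "(s \<otimes> h) \<otimes> (s \<otimes> k) = (s \<otimes> h \<otimes> inv s) \<otimes> (s \<otimes> s) \<otimes> k" if "h \<in> H" "k \<in> H" for h k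
      using that HG s by (simp add: m_assoc cancel_assoc)
    show "x \<otimes> y \<in> H \<union> (\<lambda>h. s \<otimes> h) ` H"
    proof (cases "x \<in> H"; cases "y \<in> H")
      assume "x \<in> H" "y \<in> H"
      then show ?thesis using 1 by blast
    next
      assume xH: "x \<in> H" and "y \<notin> H"
      then obtain k where k: "k \<in> H" "y = s \<otimes> k" using y by blast
      have "inv s \<otimes> x \<otimes> s \<otimes> k \<in> H" using 1 norm'[OF xH] k by blast
      then show ?thesis using 3[OF xH k(1)] k(2) by blast
    next
      assume "x \<notin> H" and yH: "y \<in> H"
      then obtain k where k: "k \<in> H" "x = s \<otimes> k" using x by blast
      then show ?thesis using 1[OF k(1) yH] 2[OF k(1) yH] by blast
    next
      assume "x \<notin> H" "y \<notin> H"
      then obtain h k where k: "h \<in> H" "x = s \<otimes> h" "k \<in> H" "y = s \<otimes> k" using x y by blast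
      have "(s \<otimes> h \<otimes> inv s) \<otimes> (s \<otimes> s) \<otimes> k \<in> H" using 1 norm[OF k(1)] ss k(3) by blast
      then show ?thesis using 4[OF k(1,3)] k(2,4) by simp
    qed
  qed
  have inj: "inj_on (\<lambda>h. s \<otimes> h) H" using HG s by (auto simp: inj_on_def)
  have "s \<otimes> h \<notin> H" if h: "h \<in> H" for h
  proof
    assume "s \<otimes> h \<in> H"
    then have "s \<otimes> h \<otimes> inv h \<in> H" using Hm h by blast
    then show False using s HG[OF h] by (simp add: m_assoc)
  qed
  then have "H \<inter> (\<lambda>h. s \<otimes> h) ` H = {}" by blast
  then show "card (H \<union> (\<lambda>h. s \<otimes> h) ` H) = 2 * card H"
    using finH by (subst card_Un_disjoint) (auto simp: card_image[OF inj])
qed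

text \<open>Orbit lengths are powers of 2, and an orbit of length 1 is a fixed point. The remaining
  points therefore split into orbits of even length.\<close>

lemma fixed_points_even:
  assumes ord: "order G = 2 ^ n" and fin: "finite (carrier G)" "finite E"
    and act: "\<And>g x. g \<in> carrier G \<Longrightarrow> x \<in> E \<Longrightarrow> act g x \<in> E" "\<And>x. x \<in> E \<Longrightarrow> act \<one> x = x"
      "\<And>g h x. g \<in> carrier G \<Longrightarrow> h \<in> carrier G \<Longrightarrow> x \<in> E \<Longrightarrow> act (g \<otimes> h) x = act g (act h x)"
    and even: "even (card E)"
  shows "even (card {x\<in>E. \<forall>g\<in>carrier G. act g x = x})"
proof -
  define \<phi> where "\<phi> g = restrict (act g) E" for g
  have inv_act: "act (inv g) (act g x) = x" "act g (act (inv g) x) = x" if "g \<in> carrier G" "x \<in> E" for g x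
    using that act(3)[of "inv g" g x] act(3)[of g "inv g" x] act(2) by simp_all
  have bij: "\<phi> g \<in> Bij E" if g: "g \<in> carrier G" for g
  proof -
    have "bij_betw (act g) E E"
      by (rule bij_betw_byWitness[where f' = "act (inv g)"]) (use g inv_act act(1) in auto)
    then show ?thesis unfolding Bij_def \<phi>_def by (simp cong: bij_betw_cong)
  qed
  have "\<phi> \<in> hom G (BijGroup E)"
  proof (rule homI)
    fix g assume "g \<in> carrier G"
    then show "\<phi> g \<in> carrier (BijGroup E)" using bij by (simp add: BijGroup_def)
  next
    fix g h assume gh: "g \<in> carrier G" "h \<in> carrier G"
    show "\<phi> (g \<otimes> h) = \<phi> g \<otimes>\<^bsub>BijGroup E\<^esub> \<phi> h"
      using gh bij act(1,3) by (auto simp: BijGroup_def \<phi>_def compose_def fun_eq_iff)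
  qed
  then interpret A: group_action G E \<phi>
    by (intro group_action.intro group_hom.intro group_hom_axioms.intro group_axioms group_BijGroup)
  let ?F = "{x\<in>E. \<forall>g\<in>carrier G. act g x = x}"
  let ?C = "{X \<in> orbits G E \<phi>. X \<inter> ?F = {}}"
  have orb: "orbit G \<phi> x = {act g x |g. g \<in> carrier G}" if "x \<in> E" for x
    using that by (auto simp: orbit_def \<phi>_def)
  have cover: "\<Union> (orbits G E \<phi>) = E" by (rule A.orbits_coverture)
  have fixed_orbit: "X = {x}" if "X \<in> orbits G E \<phi>" "x \<in> X" "x \<in> ?F" for X x
  proof -
    have "X = orbit G \<phi> x"
      using that A.orbit_partition A.disjoint_union[of X "orbit G \<phi> x"] A.orbit_refl
      by (auto simp: orbits_def)
    moreover have "{act g x |g. g \<in> carrier G} = {x}" using that(3) by (auto intro!: exI[of _ \<one>])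
    ultimately show ?thesis using orb[of x] that(3) by simp
  qed
  have "E - ?F = \<Union> ?C"
  proof (intro equalityI subsetI)
    fix x assume x: "x \<in> E - ?F"
    then obtain X where X: "X \<in> orbits G E \<phi>" "x \<in> X" using cover by blast
    have "X \<inter> ?F = {}"
    proof (rule ccontr)
      assume "X \<inter> ?F \<noteq> {}"
      then obtain y where y: "y \<in> X" "y \<in> ?F" by blast
      then have "x = y" using fixed_orbit[OF X(1) y] X(2) by simp
      then show False using y(2) x by blast
    qed
    then show "x \<in> \<Union> ?C" using X by blast
  next
    fix x assume "x \<in> \<Union> ?C"
    then show "x \<in> E - ?F" using cover by blast
  qed
  moreover have "even (sum card ?C)"
  proof (rule dvd_sum)
    fix X assume X: "X \<in> ?C"
    obtain x where x: "x \<in> E" "X = orbit G \<phi> x" using X by (auto simp: orbits_def)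
    have xX: "x \<in> X" using A.orbit_refl x by simp
    have "card X * card (stabilizer G \<phi> x) = order G"
      unfolding x(2) by (rule A.orbit_stabilizer_theorem[OF x(1)])
    then have "card X dvd 2 ^ n" using ord by (metis dvd_triv_left)
    then obtain i where i: "card X = 2 ^ i" using divides_primepow_nat[of 2 "card X" n] by (metis two_is_prime_nat)
    have "i \<noteq> 0"
    proof
      assume "i = 0"
      then have "X = {x}" using i xX by (metis card_1_singletonE power_0 singletonD)
      then have "act g x = x" if "g \<in> carrier G" for g using orb[OF x(1)] x(2) that by blast
      then show False using X xX x(1) by blast
    qed
    then show "even (card X)" using i by simp
  qed
  moreover have "card (\<Union> ?C) = sum card ?C"
  proof (rule card_Union_disjoint)
    show "pairwise disjnt ?C"
      using A.disjoint_union by (auto simp: pairwise_def disjnt_def)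
    show "finite X" if X: "X \<in> ?C" for X
    proof -
      have "X \<subseteq> E" using X cover by blast
      then show ?thesis using fin(2) finite_subset by blast
    qed
  qed
  ultimately have "even (card (E - ?F))" by simp
  moreover have "card E = card (E - ?F) + card ?F"
    using fin(2) by (subst card_Un_disjoint[symmetric]) (auto intro: arg_cong[where f = card])
  ultimately show ?thesis using even by simp
qed

text \<open>Repeated squaring of x reaches the identity; the last of these powers outside H is
  taken.\<close>

lemma power_of_two_descent:
  assumes ord: "order G = 2 ^ n" and H: "subgroup H G" and x: "x \<in> carrier G" "x \<notin> H"
  obtains j where "x [^] ((2::nat) ^ j) \<notin> H" "x [^] ((2::nat) ^ j) \<otimes> x [^] ((2::nat) ^ j) \<in> H"
proof -
  define P where "P j \<longleftrightarrow> x [^] ((2::nat) ^ j) \<in> H" for j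
  have "x [^] ((2::nat) ^ n) = \<one>" using pow_order_eq_1[OF x(1)] ord by simp
  then have "P n" using subgroup.one_closed[OF H] by (simp add: P_def)
  moreover have "\<not> P 0" using x by (simp add: P_def)
  ultimately obtain j where "\<not> P j" "P (Suc j)" using dec_induct[of 0 n "\<lambda>i. \<not> P i"] by blast
  then show thesis using that[of j] x(1) by (simp add: P_def nat_pow_mult mult_2)
qed

text \<open>H acts on its right cosets, whose number is even. The coset H is fixed, so by parity a
  second coset H x is fixed as well, which means that x normalizes H. A power of x then has its
  square in H. Together with \<open>adjoin_subgroup\<close> this doubles a proper subgroup.\<close>

lemma two_group_subgroup_growth:
  assumes ord: "order G = 2 ^ n" and fin: "finite (carrier G)" and H: "subgroup H G" "H \<noteq> carrier G"
  obtains s where "s \<in> carrier G" "s \<notin> H" "s \<otimes> s \<in> H" "\<And>h. h \<in> H \<Longrightarrow> s \<otimes> h \<otimes> inv s \<in> H"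
proof -
  have HG: "x \<in> carrier G" if "x \<in> H" for x using subgroup.mem_carrier[OF H(1) that] .
  let ?K = "G\<lparr>carrier := H\<rparr>"
  let ?E = "rcosets H"
  interpret K: group ?K by (rule subgroup_imp_group[OF H(1)])
  have lag: "card ?E * card H = 2 ^ n" using lagrange[OF H(1)] ord by simp
  obtain i where i: "card H = 2 ^ i"
    using lag divides_primepow_nat[of 2 "card H" n] by (metis dvd_triv_right two_is_prime_nat)
  obtain j where j: "card ?E = 2 ^ j"
    using lag divides_primepow_nat[of 2 "card ?E" n] by (metis dvd_triv_left two_is_prime_nat)
  have "j \<noteq> 0"
  proof
    assume "j = 0"
    then have "card H = card (carrier G)" using lag j ord by (simp add: order_def)
    then show False using H fin subgroup.subset card_subset_eq by metis
  qed
  then have even: "even (card ?E)" using j by simp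
  have finE: "finite ?E" using j card.infinite by fastforce
  \<comment> \<open>The inverse turns right multiplication into a left action.\<close>
  let ?F = "{C\<in>?E. \<forall>h\<in>carrier ?K. C #> inv h = C}"
  have "even (card ?F)"
  proof (rule K.fixed_points_even[where act = "\<lambda>h C. C #> inv h" and n = i])
    show "order ?K = 2 ^ i" using i by (simp add: order_def)
    show "finite (carrier ?K)" using finite_subset[OF subgroup.subset[OF H(1)] fin] by simp
    fix h C assume hC: "h \<in> carrier ?K" "C \<in> ?E"
    then show "C #> inv h \<in> ?E" using HG subgroup.subset[OF H(1)]
      by (auto simp: RCOSETS_def coset_mult_assoc intro!: bexI)
  next
    fix C assume "C \<in> ?E"
    then show "C #> inv \<one>\<^bsub>?K\<^esub> = C" using subgroup.rcosets_carrier[OF H(1) group_axioms] by simp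
  next
    fix g h C assume gh: "g \<in> carrier ?K" "h \<in> carrier ?K" "C \<in> ?E"
    then show "C #> inv (g \<otimes>\<^bsub>?K\<^esub> h) = C #> inv h #> inv g"
      using HG subgroup.rcosets_carrier[OF H(1) group_axioms gh(3)] by (simp add: coset_mult_assoc inv_mult_group)
  qed (use finE even in auto)
  moreover have HF: "H \<in> ?F"
  proof -
    have "H \<in> ?E" using subgroup.subset[OF H(1)] by (auto simp: RCOSETS_def intro!: bexI[of _ \<one>])
    moreover have "H #> inv h = H" if "h \<in> H" for h
      using that HG H(1) by (intro coset_join2) (auto simp: subgroup.m_inv_closed)
    ultimately show ?thesis by simp
  qed
  moreover have "finite ?F" using finE by simp
  ultimately have "?F \<noteq> {H}" by force
  then obtain C where C: "C \<in> ?F" "C \<noteq> H" using HF by blast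
  then obtain x where x: "x \<in> carrier G" "C = H #> x" by (auto simp: RCOSETS_def)
  have xH: "x \<notin> H" using C(2) x coset_join2[OF x(1) H(1)] by blast
  have norm: "x \<otimes> h \<otimes> inv x \<in> H" if h: "h \<in> H" for h
  proof -
    have "H #> x #> inv (inv h) = H #> x" using C(1) x(2) h subgroup.m_inv_closed[OF H(1)] by auto
    then have "H #> (x \<otimes> h) = H #> x" using HG[OF h] x subgroup.subset[OF H(1)] by (simp add: coset_mult_assoc)
    moreover have "x \<otimes> h \<in> H #> (x \<otimes> h)" using rcos_self[OF _ H(1)] x HG[OF h] by simp
    ultimately obtain k where "k \<in> H" "x \<otimes> h = k \<otimes> x" by (auto simp: r_coset_def)
    then show ?thesis using x HG by (simp add: m_assoc)
  qed
  have pow_norm: "x [^] m \<otimes> h \<otimes> inv (x [^] m) \<in> H" if "h \<in> H" for h and m :: nat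
    using that
  proof (induction m arbitrary: h)
    case 0
    then show ?case using HG by simp
  next
    case (Suc m)
    have "x [^] Suc m \<otimes> h \<otimes> inv (x [^] Suc m) = x [^] m \<otimes> (x \<otimes> h \<otimes> inv x) \<otimes> inv (x [^] m)"
      using x HG[OF Suc.prems] by (simp add: m_assoc inv_mult_group)
    then show ?case using Suc.IH[OF norm[OF Suc.prems]] by simp
  qed
  obtain m where "x [^] ((2::nat) ^ m) \<notin> H" "x [^] ((2::nat) ^ m) \<otimes> x [^] ((2::nat) ^ m) \<in> H"
    using power_of_two_descent[OF ord H(1) x(1) xH] by blast
  then show thesis using that pow_norm x(1) by blast
qed

text \<open>The centre is the fixed-point set of conjugation, hence of even order; squaring a
  nontrivial element of it repeatedly ends in an involution.\<close>

lemma two_group_central_involution: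
  assumes ord: "order G = 2 ^ n" and fin: "finite (carrier G)" and n: "n > 0"
  obtains z where "z \<in> carrier G" "z \<noteq> \<one>" "z \<otimes> z = \<one>" "\<And>x. x \<in> carrier G \<Longrightarrow> x \<otimes> z = z \<otimes> x"
proof -
  let ?F = "{x\<in>carrier G. \<forall>g\<in>carrier G. g \<otimes> x \<otimes> inv g = x}"
  have "even (card ?F)"
    by (rule fixed_points_even[OF ord fin fin]) (use ord n in \<open>auto simp: m_assoc inv_mult_group order_def\<close>)
  moreover have "\<one> \<in> ?F" by simp
  moreover have "finite ?F" using fin by simp
  ultimately have "?F \<noteq> {\<one>}" by force
  then obtain x where x: "x \<in> carrier G" "\<And>g. g \<in> carrier G \<Longrightarrow> g \<otimes> x \<otimes> inv g = x" "x \<noteq> \<one>"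
    using \<open>\<one> \<in> ?F\<close> by blast
  have comm: "x \<otimes> g = g \<otimes> x" if "g \<in> carrier G" for g
  proof -
    have "x \<otimes> g = g \<otimes> x \<otimes> inv g \<otimes> g" using x(2)[OF that] by simp
    then show ?thesis using x(1) that by (simp add: m_assoc)
  qed
  obtain j where "x [^] ((2::nat) ^ j) \<notin> {\<one>}" "x [^] ((2::nat) ^ j) \<otimes> x [^] ((2::nat) ^ j) \<in> {\<one>}"
    using power_of_two_descent[OF ord triv_subgroup x(1)] x(3) by blast
  moreover have "g \<otimes> x [^] ((2::nat) ^ j) = x [^] ((2::nat) ^ j) \<otimes> g" if "g \<in> carrier G" for g
    using group_commutes_pow[OF comm[OF that] x(1) that, of "2 ^ j"] by simp
  ultimately show thesis using that[of "x [^] ((2::nat) ^ j)"] x(1) by blast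
qed

section \<open>2-groups of exponent 4\<close>

lemma card_span42_le: "card (span42 r z) \<le> 8"
  using card_length[of "[\<one>, r, r \<otimes> r, r \<otimes> (r \<otimes> r), z, r \<otimes> z, r \<otimes> (r \<otimes> z), r \<otimes> (r \<otimes> (r \<otimes> z))]"]
  by (simp add: span42_def)

text \<open>An x with x^2 different from 1 and z generates a C4 x C2 with the central involution z,
  and any s that extends it contradicts \<open>centralized_ext42\<close>. So all squares, and with
  them all commutators, lie in {1, z}, and centralizers have at least 16 elements. This leaves room
  for an involution x outside <r> that commutes with r, and for an s outside <r, x> that commutes
  with x; they lead to the same contradiction.\<close>

lemma exponent_four_not_weakly_Schur:
  assumes fin: "finite (carrier G)" and W: "weakly_Schur G" and ord: "order G = 2 ^ n" "order G \<ge> 32"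
    and exp4: "\<And>x. x \<in> carrier G \<Longrightarrow> x \<otimes> x \<otimes> (x \<otimes> x) = \<one>"
    and r: "r \<in> carrier G" "r \<otimes> r \<noteq> \<one>"
  shows False
proof -
  have "n \<noteq> 0" using ord by (intro notI) simp
  then obtain z where z: "z \<in> carrier G" "z \<noteq> \<one>" "z \<otimes> z = \<one>" "\<And>x. x \<in> carrier G \<Longrightarrow> x \<otimes> z = z \<otimes> x"
    using two_group_central_involution[OF ord(1) fin] by blast
  have squares: "x \<otimes> x = \<one> \<or> x \<otimes> x = z" if x: "x \<in> carrier G" for x
  proof (rule ccontr)
    assume *: "\<not> ?thesis"
    have "x \<otimes> (x \<otimes> (x \<otimes> x)) = \<one>" using exp4[OF x] x by (simp add: m_assoc)
    then have xz: "Z4_Z2 x z" unfolding Z4_Z2_def using x z(1-3) z(4)[OF x] * by blast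
    have "card (span42 x z) < card (carrier G)" using card_span42_le[of x z] ord by (simp add: order_def)
    then have "span42 x z \<noteq> carrier G" by auto
    then obtain s where s: "s \<in> carrier G" "s \<notin> span42 x z" "s \<otimes> s \<in> span42 x z"
      "\<And>h. h \<in> span42 x z \<Longrightarrow> s \<otimes> h \<otimes> inv s \<in> span42 x z"
      using two_group_subgroup_growth[OF ord(1) fin span42_subgroup[OF xz]] by blast
    have "x \<in> span42 x z" by (simp add: span42_def)
    then show False
      using centralized_ext42[OF fin W xz s(1,2) z(4)[OF s(1)] s(4) s(3)] exp4[OF s(1)] by blast
  qed
  have twist: "g \<otimes> y = y \<otimes> g \<or> g \<otimes> y = z \<otimes> (y \<otimes> g)" if g: "g \<in> carrier G" and y: "y \<in> carrier G" for g y
  proof -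
    have sq: "x \<otimes> x \<in> {\<one>, z}" "inv (x \<otimes> x) \<in> {\<one>, z}" if "x \<in> carrier G" for x
      using squares[OF that] z(1-3) inv_equality[OF z(3)] by auto
    \<comment> \<open>The commutator becomes a product of squares: (g y)^2 times y^-1 g^-2 y^-1,
      where g^-2 is central.\<close>
    have "g \<otimes> y = (g \<otimes> y) \<otimes> (g \<otimes> y) \<otimes> (inv y \<otimes> inv (g \<otimes> g) \<otimes> inv y) \<otimes> (y \<otimes> g)"
      using g y by (simp add: m_assoc inv_mult_group cancel_assoc)
    also have "inv y \<otimes> inv (g \<otimes> g) \<otimes> inv y = inv (g \<otimes> g) \<otimes> inv (y \<otimes> y)"
    proof -
      have "inv y \<otimes> inv (g \<otimes> g) = inv (g \<otimes> g) \<otimes> inv y" using sq(2)[OF g] z(4)[of "inv y"] y by auto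
      then show ?thesis using g y by (simp add: m_assoc inv_mult_group)
    qed
    finally have e: "g \<otimes> y = ((g \<otimes> y) \<otimes> (g \<otimes> y) \<otimes> (inv (g \<otimes> g) \<otimes> inv (y \<otimes> y))) \<otimes> (y \<otimes> g)" .
    have "(g \<otimes> y) \<otimes> (g \<otimes> y) \<otimes> (inv (g \<otimes> g) \<otimes> inv (y \<otimes> y)) \<in> {\<one>, z}"
      using sq(1)[of "g \<otimes> y"] sq(2)[OF g] sq(2)[OF y] g y z(1,3) by auto
    then show ?thesis using e g y by auto
  qed
  have large: "card (carrier G) \<le> 2 * card {x\<in>carrier G. x \<otimes> y = y \<otimes> x}" (is "_ \<le> 2 * card ?C")
    if y: "y \<in> carrier G" for y
  proof (cases "?C = carrier G")
    case False
    then obtain g where g: "g \<in> carrier G" "g \<otimes> y \<noteq> y \<otimes> g" by blast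
    then have gy: "g \<otimes> y = z \<otimes> (y \<otimes> g)" using twist y by blast
    \<comment> \<open>If g and h both fail to commute with y, each contributes one factor z, and
      these cancel in g^-1 h.\<close>
    have "carrier G \<subseteq> ?C \<union> (\<lambda>x. g \<otimes> x) ` ?C"
    proof
      fix h assume h: "h \<in> carrier G"
      show "h \<in> ?C \<union> (\<lambda>x. g \<otimes> x) ` ?C"
      proof (cases "h \<otimes> y = y \<otimes> h")
        case False
        then have hy: "h \<otimes> y = z \<otimes> (y \<otimes> h)" using twist h y by blast
        have "g \<otimes> ((inv g \<otimes> h) \<otimes> y) = h \<otimes> y" using g h y by (simp add: m_assoc cancel_assoc)
        also have "\<dots> = z \<otimes> (y \<otimes> g) \<otimes> (inv g \<otimes> h)"
          unfolding hy using g h y z(1) by (simp add: m_assoc cancel_assoc)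
        also have "\<dots> = g \<otimes> (y \<otimes> (inv g \<otimes> h))" unfolding gy[symmetric] using g h y by (simp add: m_assoc)
        finally have "(inv g \<otimes> h) \<otimes> y = y \<otimes> (inv g \<otimes> h)" using g h y by simp
        then have "inv g \<otimes> h \<in> ?C" using g h by simp
        moreover have "h = g \<otimes> (inv g \<otimes> h)" using g h by (simp add: cancel_assoc)
        ultimately show ?thesis by blast
      qed (use h in simp)
    qed
    then have "card (carrier G) \<le> card (?C \<union> (\<lambda>x. g \<otimes> x) ` ?C)"
      using fin by (intro card_mono) auto
    also have "\<dots> \<le> card ?C + card ?C"
      using card_Un_le[of ?C "(\<lambda>x. g \<otimes> x) ` ?C"] card_image_le[of ?C "\<lambda>x. g \<otimes> x"] fin by simp
    finally show ?thesis by simp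
  qed simp
  have outside: "\<exists>x\<in>carrier G. x \<otimes> y = y \<otimes> x \<and> x \<notin> B" if y: "y \<in> carrier G" and B: "card B \<le> 8" "finite B" for y B
  proof (rule ccontr)
    assume "\<not> ?thesis"
    then have "{x\<in>carrier G. x \<otimes> y = y \<otimes> x} \<subseteq> B" by blast
    then have "card {x\<in>carrier G. x \<otimes> y = y \<otimes> x} \<le> 8" using card_mono[OF B(2)] B(1) order_trans by blast
    then show False using large[OF y] ord by (simp add: order_def)
  qed
  have rr: "r \<otimes> r = z" using squares r by blast
  define B where "B = {\<one>, r, r \<otimes> r, r \<otimes> (r \<otimes> r)}"
  have "card B \<le> 8" using card_length[of "[\<one>, r, r \<otimes> r, r \<otimes> (r \<otimes> r)]"] by (simp add: B_def)
  then obtain t where t: "t \<in> carrier G" "t \<otimes> r = r \<otimes> t" "t \<notin> B" using outside[OF r(1), of B] by (auto simp: B_def)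
  have r4: "r \<otimes> (r \<otimes> (r \<otimes> r)) = \<one>" using exp4[OF r(1)] r by (simp add: m_assoc)
  have r4x: "r \<otimes> (r \<otimes> (r \<otimes> (r \<otimes> x))) = x" if "x \<in> carrier G" for x
  proof -
    have "r \<otimes> (r \<otimes> (r \<otimes> (r \<otimes> x))) = r \<otimes> (r \<otimes> (r \<otimes> r)) \<otimes> x" using r(1) that by (simp add: m_assoc)
    then show ?thesis using r4 that by simp
  qed
  \<comment> \<open>If t is not an involution, then t^2 = z = r^2, and t r is one because t and r
    commute.\<close>
  obtain x where x: "x \<in> carrier G" "x \<otimes> r = r \<otimes> x" "x \<notin> B" "x \<otimes> x = \<one>"
  proof (cases "t \<otimes> t = \<one>")
    case True
    then show thesis using that t by blast
  next
    case False
    then have tt: "t \<otimes> t = z" using squares t by blast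
    have trx: "t \<otimes> (r \<otimes> x) = r \<otimes> (t \<otimes> x)" if "x \<in> carrier G" for x using that t(1,2) r by (simp flip: m_assoc)
    have "t \<otimes> r \<notin> B"
    proof
      assume "t \<otimes> r \<in> B"
      then have "t \<otimes> r \<otimes> (r \<otimes> (r \<otimes> r)) \<in> B"
        unfolding B_def using r(1) r4 r4x by (elim insertE emptyE) (simp_all add: m_assoc)
      moreover have "t \<otimes> r \<otimes> (r \<otimes> (r \<otimes> r)) = t" using t(1) r(1) r4 by (simp add: m_assoc)
      ultimately show False using t(3) by simp
    qed
    moreover have "t \<otimes> r \<otimes> (t \<otimes> r) = \<one>"
      using t(1,2) r trx tt rr z(1-3) by (simp add: m_assoc) (simp flip: m_assoc)
    ultimately show thesis using that[of "t \<otimes> r"] t r trx by (simp add: m_assoc)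
  qed
  have rx: "Z4_Z2 r x" unfolding Z4_Z2_def using x r r4 by (auto simp: B_def)
  have "finite (span42 r x)" by (simp add: span42_def)
  then obtain s where s: "s \<in> carrier G" "s \<otimes> x = x \<otimes> s" "s \<notin> span42 r x"
    using outside[OF x(1) card_span42_le] by blast
  have "s \<otimes> s \<in> span42 r x" using squares[OF s(1)] rr by (auto simp: span42_def)
  moreover have "s \<otimes> r \<otimes> inv s \<in> span42 r x"
  proof -
    have "s \<otimes> r \<otimes> inv s = r \<or> s \<otimes> r \<otimes> inv s = z \<otimes> r"
      using twist[OF s(1) r(1)]
    proof
      assume e: "s \<otimes> r = r \<otimes> s"
      show ?thesis unfolding e using s(1) r(1) by (simp add: m_assoc)
    next
      assume e: "s \<otimes> r = z \<otimes> (r \<otimes> s)"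
      show ?thesis unfolding e using s(1) r(1) z(1) by (simp add: m_assoc)
    qed
    moreover have "z \<otimes> r = r \<otimes> (r \<otimes> r)" unfolding rr[symmetric] using r(1) by (simp add: m_assoc)
    ultimately show ?thesis by (auto simp: span42_def)
  qed
  ultimately show False using centralized_ext42[OF fin W rx s(1,3,2)] exp4[OF s(1)] by blast
qed

end


section \<open>Cyclic subgroups of index two\<close>

text \<open>With t = 2 u + 1 the number t^2 - 1 is 4 u (u + 1), and only one of u and u + 1 is even,
  so this one carries the whole power of 2.\<close>

lemma square_one_mod_power_of_two:
  fixes t :: int
  assumes "2 ^ (k + 2) dvd t * t - 1"
  shows "2 ^ (k + 1) dvd t - 1 \<or> 2 ^ (k + 1) dvd t + 1"
proof -
  have "(2::int) dvd 2 ^ (k + 2)" by simp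
  then have "2 dvd t * t - 1" using assms dvd_trans by blast
  then have "odd t" by auto
  then obtain u where u: "t = 2 * u + 1" by (elim oddE)
  have "t * t - 1 = 4 * (u * (u + 1))" by (simp add: u algebra_simps)
  then have "4 * 2 ^ k dvd 4 * (u * (u + 1))" using assms by simp
  then have d: "2 ^ k dvd u * (u + 1)" by (metis dvd_mult_cancel_left zero_neq_numeral)
  show ?thesis
  proof (cases "even u")
    case True
    then have "coprime (2 ^ k) (u + 1)" by simp
    then have "2 ^ k dvd u" using d by (simp add: coprime_dvd_mult_left_iff)
    then have "2 * 2 ^ k dvd 2 * u" by (rule mult_dvd_mono[OF dvd_refl])
    then show ?thesis by (simp add: u)
  next
    case False
    then have "coprime (2 ^ k) u" by simp
    then have "2 ^ k dvd u + 1" using d by (simp add: coprime_dvd_mult_right_iff)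
    then have "2 * 2 ^ k dvd 2 * (u + 1)" by (rule mult_dvd_mono[OF dvd_refl])
    then show ?thesis by (simp add: u algebra_simps)
  qed
qed

section \<open>Groups with a cyclic subgroup of index 2 and order at least 8\<close>

abbreviation (in group) cyc :: "'a \<Rightarrow> 'a set" where
  "cyc a \<equiv> range (\<lambda>i::int. a [^] i)"

context group
begin

lemma cyc_eq_generate: "a \<in> carrier G \<Longrightarrow> cyc a = generate G {a}"
  by (auto simp: generate_pow)

lemma cyc_subgroup: "a \<in> carrier G \<Longrightarrow> subgroup (cyc a) G"
  using generate_is_subgroup[of "{a}"] by (simp add: cyc_eq_generate)

lemma card_cyc: "a \<in> carrier G \<Longrightarrow> card (cyc a) = ord a"
  by (simp add: cyc_eq_generate generate_pow_card)

lemma cyc_self: "a \<in> carrier G \<Longrightarrow> a \<in> cyc a"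
  by (rule image_eqI[of _ _ 1]) simp_all

lemma ord_power_of_two:
  assumes x: "x \<in> carrier G" and 1: "x [^] ((2::nat) ^ Suc m) = \<one>" and 2: "x [^] ((2::nat) ^ m) \<noteq> \<one>"
  shows "ord x = 2 ^ Suc m"
proof -
  have "ord x dvd 2 ^ Suc m" using 1 x by (simp add: pow_eq_id)
  then obtain i where i: "i \<le> Suc m" "ord x = 2 ^ i"
    using divides_primepow_nat[OF two_is_prime_nat] by blast
  have "\<not> i \<le> m"
  proof
    assume "i \<le> m"
    then have "ord x dvd 2 ^ m" using i(2) by (simp add: le_imp_power_dvd)
    then show False using 2 x by (simp add: pow_eq_id)
  qed
  then show ?thesis using i le_Suc_eq by auto
qed

lemma cyclic_ext8_not_weakly_Schur:
  assumes fin: "finite (carrier G)" and W: "weakly_Schur G"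
    and a: "a \<in> carrier G" "ord a = 8" and s: "s \<in> carrier G" "s \<notin> cyc a"
    and sa: "s \<otimes> a = a [^] (p::int) \<otimes> s" and ss: "s \<otimes> s = a [^] (v::int)"
    and check: "ext_not_Schur 8 1 p 0 v 0 c x y g h"
    and xygh: "x \<in> {0..15}" "y \<in> {0..15}" "g \<in> {0..15}" "h \<in> {0..15}"
  shows False
proof (rule ext_not_weakly_Schur[where r = a and z = \<one>, OF fin W _ _ _ a(1) one_closed s(1) _ _ _ _ _ _ _ _ check xygh])
  show "8 dvd i \<and> 1 dvd j" if "a [^] i \<otimes> \<one> [^] j = \<one>" for i j :: int
    using that a by (simp add: int_pow_eq_id)
  show "s \<noteq> a [^] i \<otimes> \<one> [^] j" for i j :: int
    using s(2) a(1) by auto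
  show "a [^] (8::int) = \<one>" using a by (simp add: int_pow_eq_id)
qed (use a s sa ss in simp_all)

lemma cyclic_ext_pow:
  assumes a: "a \<in> carrier G" and s: "s \<in> carrier G" and sa: "s \<otimes> a = a [^] (t::int) \<otimes> s"
    and ss: "s \<otimes> s = a [^] (v::int)"
  shows "s \<otimes> a [^] (i::int) = a [^] (t * i) \<otimes> s"
    and "(s \<otimes> a [^] i) \<otimes> (s \<otimes> a [^] i) = a [^] (t * i + v + i)"
    and "(s \<otimes> a [^] i) \<otimes> a = a [^] t \<otimes> (s \<otimes> a [^] i)"
proof -
  show 1: "s \<otimes> a [^] i = a [^] (t * i) \<otimes> s" for i
    using semiconj_int_pow[OF sa s a, of i] a by (simp add: int_pow_pow)
  have "(s \<otimes> a [^] i) \<otimes> (s \<otimes> a [^] i) = s \<otimes> a [^] i \<otimes> s \<otimes> a [^] i"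
    using a s by (simp add: m_assoc)
  also have "\<dots> = a [^] (t * i) \<otimes> (s \<otimes> s) \<otimes> a [^] i"
    unfolding 1 using a s by (simp add: m_assoc)
  finally have "(s \<otimes> a [^] i) \<otimes> (s \<otimes> a [^] i) = a [^] (t * i) \<otimes> (s \<otimes> s) \<otimes> a [^] i" .
  then show "(s \<otimes> a [^] i) \<otimes> (s \<otimes> a [^] i) = a [^] (t * i + v + i)"
    unfolding ss using a by (simp add: int_pow_mult)
  have "(s \<otimes> a [^] i) \<otimes> a = s \<otimes> (a [^] i \<otimes> a)" using a s by (simp add: m_assoc)
  also have "a [^] i \<otimes> a = a \<otimes> a [^] i" using commute_int_pow[of a a i 1] a by simp
  also have "s \<otimes> (a \<otimes> a [^] i) = s \<otimes> a \<otimes> a [^] i" using a s by (simp add: m_assoc)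
  also have "\<dots> = a [^] t \<otimes> (s \<otimes> a [^] i)" unfolding sa using a s by (simp add: m_assoc)
  finally show "(s \<otimes> a [^] i) \<otimes> a = a [^] t \<otimes> (s \<otimes> a [^] i)" .
qed

lemma mult_cyc_notin:
  assumes "a \<in> carrier G" "s \<in> carrier G" "s \<notin> cyc a"
  shows "s \<otimes> a [^] (i::int) \<notin> cyc a"
proof
  assume "s \<otimes> a [^] i \<in> cyc a"
  then have "s \<otimes> a [^] i \<otimes> inv (a [^] i) \<in> cyc a"
    by (rule subgroup.m_closed[OF cyc_subgroup[OF assms(1)] _ subgroup.m_inv_closed[OF cyc_subgroup[OF assms(1)] rangeI]])
  then show False using assms by (simp add: m_assoc)
qed

text \<open>The power b of order 8 generates together with s a generalized quaternion subgroup of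
  order 16.\<close>

lemma quaternion_not_weakly_Schur:
  assumes fin: "finite (carrier G)" and W: "weakly_Schur G"
    and a: "a \<in> carrier G" "ord a = 2 ^ (k + 3)" and s: "s \<in> carrier G" "s \<notin> cyc a"
    and sa: "s \<otimes> a = a [^] (-1::int) \<otimes> s" and ss: "s \<otimes> s = a [^] ((2::int) ^ (k + 2))"
  shows False
proof -
  define b where "b = a [^] ((2::nat) ^ k)"
  have b: "b \<in> carrier G" "b = a [^] ((2::int) ^ k)"
    using a by (simp_all add: b_def flip: int_pow_int)
  have "ord b = 8" unfolding b_def
    using a ord_pow[OF a(1), of "2 ^ k"] by (simp add: power_add)
  moreover have "s \<notin> cyc b" using s(2) a(1) by (auto simp: b(2) int_pow_pow)
  moreover have "s \<otimes> b = b [^] (7::int) \<otimes> s"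
  proof -
    have "s \<otimes> b = a [^] (-1 * (2::int) ^ k) \<otimes> s"
      unfolding b(2) using cyclic_ext_pow(1)[OF a(1) s(1) sa ss] by simp
    \<comment> \<open>-1 and 7 agree modulo 8, hence the exponents agree modulo 2^(k+3).\<close>
    moreover have "a [^] (-1 * (2::int) ^ k) = a [^] ((2::int) ^ k * 7)"
      using a by (simp add: int_pow_eq power_add)
    ultimately show ?thesis using a(1) by (simp add: b(2) int_pow_pow)
  qed
  moreover have "s \<otimes> s = b [^] (4::int)" using ss a(1) by (simp add: b(2) int_pow_pow power_add mult.commute)
  ultimately show False
    by (intro cyclic_ext8_not_weakly_Schur[OF fin W b(1) _ s(1) _ _ _ quaternion16_not_Schur]) simp_all
qed

text \<open>The element z = a^h is a central involution of <a, s>, and {1, z, s, z s} is a normal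
  four-group that a does not centralize. If a has order at least 16, then h >= 8 keeps a^4 outside
  this four-group. If a has order 8, then h = 4 and a^4 = z, so the table for order 16 takes
  over.\<close>

lemma modular_not_weakly_Schur:
  assumes fin: "finite (carrier G)" and W: "weakly_Schur G"
    and a: "a \<in> carrier G" "ord a = 2 ^ (k + 3)" and s: "s \<in> carrier G" "s \<notin> cyc a"
    and sa: "s \<otimes> a = a [^] (1 + (2::int) ^ (k + 2)) \<otimes> s" and ss: "s \<otimes> s = \<one>"
  shows False
proof (cases k)
  case 0
  then show False
    using a s sa ss by (intro cyclic_ext8_not_weakly_Schur[OF fin W a(1) _ s(1) s(2) _ _ modular16_not_Schur]) simp_all
next
  case (Suc l)
  define h where "h = (2::int) ^ (k + 2)"
  have q: "int (ord a) = 2 * h" using a by (simp add: h_def power_add)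
  have eq: "a [^] i = a [^] j \<longleftrightarrow> 2 * h dvd j - i" for i j :: int
    using a q by (simp add: int_pow_eq)
  have ss': "s \<otimes> s = a [^] (0::int)" using ss by simp
  note rel = cyclic_ext_pow[OF a(1) s(1) sa ss']
  define z where "z = a [^] h"
  have z: "z \<in> carrier G" "z \<otimes> z = \<one>"
    using a eq[of "h + h" 0] by (simp_all add: z_def flip: int_pow_mult)
  have h8: "h \<ge> 8" using Suc by (simp add: h_def)
  have "\<not> 2 * h dvd h" using h8 zdvd_imp_le[of "2 * h" h] by linarith
  then have z1: "z \<noteq> \<one>" using eq[of h 0] by (simp add: z_def)
  \<comment> \<open>The four-group argument makes demands on all elements of the group, hence the
    passage to the subgroup <a, s>.\<close>
  define L where "L = cyc a \<union> (\<lambda>x. s \<otimes> x) ` cyc a"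
  have norm: "s \<otimes> x \<otimes> inv s \<in> cyc a" if "x \<in> cyc a" for x
    using that rel(1) a(1) s(1) by (auto simp: m_assoc)
  have "s \<otimes> s \<in> cyc a" unfolding ss' by (rule rangeI)
  then have L: "subgroup L G"
    unfolding L_def by (intro adjoin_subgroup(1)[OF fin cyc_subgroup[OF a(1)] s]) (simp, rule norm)
  have even_h: "even h" by (simp add: h_def)
  have sz: "s \<otimes> z = z \<otimes> s"
  proof -
    have "2 * h dvd h - (1 + h) * h" using even_h by (auto simp: algebra_simps elim!: evenE)
    then have "a [^] ((1 + h) * h) = z" using eq by (simp add: z_def)
    then show ?thesis using rel(1)[of h] by (simp add: z_def h_def)
  qed
  have az: "a [^] i \<otimes> z = z \<otimes> a [^] i" for i :: int
    unfolding z_def using commute_int_pow[of a a] a(1) by simp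
  have sap: "s \<otimes> a [^] i = (if even i then a [^] i \<otimes> s else z \<otimes> (a [^] i \<otimes> s))" for i :: int
  proof (cases "even i")
    case True
    then have "2 * h dvd i - (1 + h) * i" by (auto simp: algebra_simps elim!: evenE)
    then have "a [^] ((1 + h) * i) = a [^] i" using eq by simp
    then show ?thesis using rel(1)[of i] True by (simp add: h_def)
  next
    case False
    then have "2 * h dvd (h + i) - (1 + h) * i" by (auto simp: algebra_simps elim!: oddE)
    then have "a [^] ((1 + h) * i) = z \<otimes> a [^] i" using eq a(1) by (simp add: z_def flip: int_pow_mult)
    then show ?thesis using rel(1)[of i] False a(1) s(1) z(1) by (simp add: h_def m_assoc)
  qed
  have zz: "z \<otimes> (z \<otimes> x) = x" if "x \<in> carrier G" for x using z that by (simp flip: m_assoc)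
  have asp: "a [^] i \<otimes> s = s \<otimes> a [^] i \<or> a [^] i \<otimes> s = z \<otimes> s \<otimes> a [^] i" for i :: int
    using sap[of i] a(1) s(1) z(1) zz by (auto simp: m_assoc split: if_splits)
  have La: "x \<in> L \<Longrightarrow> (\<exists>i::int. x = a [^] i \<or> x = s \<otimes> a [^] i)" for x by (auto simp: L_def)
  have xz: "x \<otimes> z = z \<otimes> x" if x: "x \<in> L" for x
  proof -
    obtain i :: int where "x = a [^] i \<or> x = s \<otimes> a [^] i" using La[OF x] by blast
    then show ?thesis
    proof
      assume "x = s \<otimes> a [^] i"
      then have "x \<otimes> z = s \<otimes> z \<otimes> a [^] i" using a(1) s(1) z(1) az by (simp add: m_assoc)
      then show ?thesis unfolding sz using a(1) s(1) z(1) \<open>x = _\<close> by (simp add: m_assoc)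
    qed (use az in simp)
  qed
  have xs: "x \<otimes> s = s \<otimes> x \<or> x \<otimes> s = z \<otimes> s \<otimes> x" if x: "x \<in> L" for x
  proof -
    obtain i :: int where "x = a [^] i \<or> x = s \<otimes> a [^] i" using La[OF x] by blast
    then show ?thesis
    proof
      assume e: "x = s \<otimes> a [^] i"
      from asp[of i] show ?thesis
      proof
        assume 1: "a [^] i \<otimes> s = s \<otimes> a [^] i"
        have "x \<otimes> s = s \<otimes> (a [^] i \<otimes> s)" using e a(1) s(1) by (simp add: m_assoc)
        then show ?thesis using 1 e by simp
      next
        assume 1: "a [^] i \<otimes> s = z \<otimes> s \<otimes> a [^] i"
        have "x \<otimes> s = s \<otimes> (a [^] i \<otimes> s)" using e a(1) s(1) by (simp add: m_assoc)
        also have "\<dots> = s \<otimes> z \<otimes> (s \<otimes> a [^] i)" unfolding 1 using a(1) s(1) z(1) by (simp add: m_assoc)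
        finally show ?thesis unfolding sz using e by simp
      qed
    qed (use asp in simp)
  qed
  have cL: "a [^] i \<in> L" "s \<otimes> a [^] i \<in> L" for i :: int by (auto simp: L_def)
  have "a \<in> L" "s \<in> L" using cL(1)[of 1] cL(2)[of 0] a(1) s(1) by simp_all
  interpret K: group "G\<lparr>carrier := L\<rparr>" by (rule subgroup_imp_group[OF L])
  have WK: "weakly_Schur (G\<lparr>carrier := L\<rparr>)" by (rule weakly_Schur_subgroup[OF fin W L])
  have finK: "finite (carrier (G\<lparr>carrier := L\<rparr>))"
    using finite_subset[OF subgroup.subset[OF L] fin] by simp
  have a4: "a \<otimes> a \<otimes> (a \<otimes> a) = a [^] (4::int)" using a(1) by (simp add: int_pow_numerals m_assoc)
  have "a [^] (4::int) \<notin> {\<one>, z, s, z \<otimes> s}"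
  proof
    assume "a [^] (4::int) \<in> {\<one>, z, s, z \<otimes> s}"
    moreover have "a [^] (4::int) \<noteq> \<one>"
      using eq[of 4 0] h8 zdvd_imp_le[of "2 * h" 4] by auto
    moreover have "a [^] (4::int) \<noteq> z"
      using eq[of 4 h] h8 zdvd_imp_le[of "2 * h" "h - 4"] by (auto simp: z_def)
    moreover have "a [^] (4::int) \<noteq> s" using s(2) by auto
    moreover have "s \<otimes> z \<notin> cyc a" unfolding z_def by (rule mult_cyc_notin[OF a(1) s])
    then have "z \<otimes> s \<notin> cyc a" using sz by simp
    ultimately show False by (metis empty_iff insert_iff rangeI)
  qed
  moreover have "a \<otimes> s \<noteq> s \<otimes> a"
  proof
    assume "a \<otimes> s = s \<otimes> a"
    then have "a \<otimes> s = z \<otimes> (a \<otimes> s)" using sap[of 1] a(1) by simp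
    then have "z = \<one>" using a(1) s(1) z(1) by (metis m_closed r_cancel_one')
    then show False using z1 by simp
  qed
  moreover have "s \<noteq> \<one>" "s \<noteq> z" using s(2) a(1) by (auto simp: z_def) (metis int_pow_0 rangeI)
  ultimately have ne: "a [^] (4::int) \<notin> {\<one>, z, s, z \<otimes> s}" "a \<otimes> s \<noteq> s \<otimes> a" "s \<noteq> \<one>" "s \<noteq> z" by blast+
  show False
  proof (rule K.normal_four_group_not_weakly_Schur[OF finK WK, of a s z])
    show "a \<otimes>\<^bsub>G\<lparr>carrier := L\<rparr>\<^esub> a \<otimes>\<^bsub>G\<lparr>carrier := L\<rparr>\<^esub> (a \<otimes>\<^bsub>G\<lparr>carrier := L\<rparr>\<^esub> a)
        \<notin> {\<one>\<^bsub>G\<lparr>carrier := L\<rparr>\<^esub>, z, s, z \<otimes>\<^bsub>G\<lparr>carrier := L\<rparr>\<^esub> s}"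
      using ne(1) by (simp add: a4)
    show "z \<in> carrier (G\<lparr>carrier := L\<rparr>)" using cL(1)[of h] by (simp add: z_def)
  qed (use \<open>a \<in> L\<close> \<open>s \<in> L\<close> z(2) z1 ss xz xs ne in simp_all)
qed

text \<open>Conjugation by s raises a to a power t with t^2 = 1 modulo ord a = 4g, so t is 1, -1, 1
  + 2g or -1 + 2g up to multiples of 4g. These values give the abelian, the dihedral or quaternion,
  the modular and the semidihedral extensions.\<close>

theorem cyclic_ext_relations:
  assumes fin: "finite (carrier G)" and W: "weakly_Schur G"
    and a: "a \<in> carrier G" "ord a = 2 ^ (k + 3)" and s: "s \<in> carrier G" "s \<notin> cyc a"
    and conj: "s \<otimes> a \<otimes> inv s \<in> cyc a" and ss: "s \<otimes> s \<in> cyc a"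
  shows "s \<otimes> a = a \<otimes> s \<or> (s \<otimes> a = inv a \<otimes> s \<and> s \<otimes> s = \<one>)"
proof -
  define g where "g = (2::int) ^ (k + 1)"
  have g: "even g" by (simp add: g_def)
  have q: "int (ord a) = 4 * g" using a by (simp add: g_def power_add)
  have eq: "a [^] i = a [^] j \<longleftrightarrow> 4 * g dvd j - i" for i j :: int
    using a q by (simp add: int_pow_eq)
  obtain v where v: "s \<otimes> s = a [^] (v::int)" using ss by blast
  obtain t0 where "s \<otimes> a \<otimes> inv s = a [^] (t0::int)" using conj by blast
  then have t0: "s \<otimes> a = a [^] t0 \<otimes> s" using a s by (metis inv_solve_right int_pow_closed m_closed)
  have "4 * g dvd t0 * t0 - 1"
  proof -
    have "s \<otimes> (s \<otimes> a) = a [^] (t0 * t0) \<otimes> s \<otimes> s"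
      using cyclic_ext_pow(1)[OF a(1) s(1) t0 v, of t0] t0 a(1) s(1) by (simp flip: m_assoc)
    then have "a [^] v \<otimes> a = a [^] (t0 * t0) \<otimes> a [^] v" using v a(1) s(1) by (simp add: m_assoc) (simp flip: m_assoc)
    then have "a [^] (v + 1) = a [^] (t0 * t0 + v)" using a(1) by (simp add: int_pow_mult)
    then show ?thesis using eq by simp
  qed
  then have "2 * g dvd t0 - 1 \<or> 2 * g dvd t0 + 1"
    using square_one_mod_power_of_two[of "k + 1" t0] by (simp add: g_def)
  moreover have "4 * g dvd e - t0 \<or> 4 * g dvd (e + 2 * g) - t0" if d: "2 * g dvd t0 - e" for e
  proof -
    from d obtain c where "t0 - e = 2 * g * c" by (elim dvdE)
    then have c: "t0 = e + 2 * g * c" by simp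
    show ?thesis by (cases "even c") (auto simp: c algebra_simps elim!: evenE oddE)
  qed
  from this[of 1] this[of "-1"] calculation
  have "\<exists>t\<in>{1, -1, 1 + 2 * g, -1 + 2 * g}. 4 * g dvd t - t0" by auto
  then obtain t where t: "t \<in> {1, -1, 1 + 2 * g, -1 + 2 * g}" "s \<otimes> a = a [^] t \<otimes> s"
    using t0 eq by metis
  note rel = cyclic_ext_pow[OF a(1) s(1) t(2) v]
  \<comment> \<open>Because s commutes with its own square a^v, the exponents t v and v agree modulo
    4g; this restricts v in every case.\<close>
  have tv: "4 * g dvd v - t * v"
  proof -
    have "s \<otimes> a [^] v = a [^] v \<otimes> s" unfolding v[symmetric] using s(1) by (simp add: m_assoc)
    then have "a [^] (t * v) = a [^] v" using rel(1)[of v] a(1) s(1) by simp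
    then show ?thesis using eq by simp
  qed
  from t(1) consider "t = 1" | "t = -1" | "t = 1 + 2 * g" | "t = -1 + 2 * g" by blast
  then show ?thesis
  proof cases
    case 1
    then show ?thesis using t(2) a(1) by simp
  next
    case 2
    have "2 * g dvd v" using tv 2 by (auto elim!: dvdE)
    then obtain c where c: "v = 2 * g * c" by (elim dvdE)
    show ?thesis
    proof (cases "even c")
      case True
      then have "a [^] v = \<one>" using eq[of v 0] c by (auto elim!: evenE)
      then show ?thesis using v t(2) 2 a(1) by (simp add: int_pow_neg)
    next
      case False
      then have "4 * g dvd 2 * g - v" using c by (auto simp: algebra_simps elim!: oddE)
      then have "s \<otimes> s = a [^] ((2::int) ^ (k + 2))" using v eq by (simp add: g_def)
      then show ?thesis using quaternion_not_weakly_Schur[OF fin W a s] t(2) 2 by simp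
    qed
  next
    case 3
    have "even v"
    proof -
      have "2 * g * 2 dvd 2 * g * v" using tv 3 by (simp add: algebra_simps)
      then show ?thesis using g_def by (metis dvd_mult_cancel_left mult_eq_0_iff power_eq_0_iff zero_neq_numeral)
    qed
    then obtain u where u: "v = 2 * u" by (elim evenE)
    \<comment> \<open>The square of s a^j has exponent (2 + 2g) j + 2u. This j turns it into -2u g
      (2 + g), a multiple of 4g since g is even.\<close>
    let ?j = "- (u * (1 + g))"
    have "t * ?j + v + ?j = - (2 * u * (g * (2 + g)))" using 3 u by (simp add: algebra_simps)
    moreover have "4 * g dvd 2 * u * (g * (2 + g))" using g by (auto simp: algebra_simps elim!: evenE)
    ultimately have "(s \<otimes> a [^] ?j) \<otimes> (s \<otimes> a [^] ?j) = \<one>"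
      using rel(2)[of ?j] eq[of "t * ?j + v + ?j" 0] by simp
    moreover have "(s \<otimes> a [^] ?j) \<otimes> a = a [^] (1 + (2::int) ^ (k + 2)) \<otimes> (s \<otimes> a [^] ?j)"
      using rel(3)[of ?j] 3 by (simp add: g_def)
    ultimately show ?thesis
      using modular_not_weakly_Schur[OF fin W a _ mult_cyc_notin[OF a(1) s], of ?j] a(1) s(1) by simp
  next
    case 4
    have "2 * g dvd v"
    proof -
      have "2 * (2 * g) dvd 2 * ((g - 1) * v)" using tv 4 by (simp add: algebra_simps) (metis dvd_minus_iff minus_diff_eq)
      then have "2 * g dvd (g - 1) * v" by (metis dvd_mult_cancel_left zero_neq_numeral)
      moreover have "coprime (2 ^ (k + 2)) (g - 1)"
        using g by (simp only: coprime_power_left_iff coprime_left_2_iff_odd) simp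
      then have "coprime (2 * g) (g - 1)" by (simp add: g_def)
      ultimately show ?thesis by (simp add: coprime_dvd_mult_right_iff)
    qed
    then obtain c where c: "v = 2 * g * c" by (elim dvdE)
    \<comment> \<open>Here the square of s a^j has exponent 2g (j + c) modulo 4g, so j only has to
      match the parity of c.\<close>
    obtain j where j: "4 * g dvd t * j + v + j"
    proof (cases "even c")
      case True
      then show thesis using that[of 0] c by (auto elim!: evenE)
    next
      case False
      then show thesis using that[of 1] c 4 by (auto simp: algebra_simps elim!: oddE)
    qed
    have j': "4 * g dvd - (t * j) - v - j" using j dvd_minus_iff[of "4 * g" "t * j + v + j"] by simp
    define y where "y = s \<otimes> a [^] j"
    have y: "y \<in> carrier G" "y \<notin> cyc a" "y \<otimes> y = a [^] (0::int)" "y \<otimes> a = a [^] t \<otimes> y"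
      using a(1) s(1) mult_cyc_notin[OF a(1) s] rel(2)[of j] rel(3)[of j] eq[of "t * j + v + j" 0] j'
      by (simp_all add: y_def)
    have False
    proof (cases k)
      case 0
      then show False
        using a y 4 by (intro cyclic_ext8_not_weakly_Schur[OF fin W a(1) _ y(1,2) _ _ semidihedral16_not_Schur])
          (simp_all add: g_def)
    next
      case (Suc l)
      \<comment> \<open>In a larger semidihedral group, y a and a^2 generate a generalized
        quaternion group: (y a)^2 = a^(2g), and y a inverts a^2 since 2t = -2 modulo 4g.\<close>
      define b where "b = a [^] (2::int)"
      define x where "x = y \<otimes> a [^] (1::int)"
      note rel' = cyclic_ext_pow[OF a(1) y(1,4,3), of 1]
      have b: "b \<in> carrier G" using a by (simp add: b_def)
      have "ord (a [^] (2::nat)) = 2 ^ (l + 3)" using ord_pow[OF a(1), of 2] a(2) Suc by (simp add: power_add)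
      then have ob: "ord b = 2 ^ (l + 3)" by (simp add: b_def flip: int_pow_int)
      have x: "x \<in> carrier G" "x \<notin> cyc b"
        using y(1) a(1) mult_cyc_notin[OF a(1) y(1,2), of 1] by (auto simp: x_def b_def int_pow_pow simp del: int_pow_1)
      have xx: "x \<otimes> x = a [^] (2 * g)" using rel'(2) 4 by (simp add: x_def)
      have "x \<otimes> x = b [^] ((2::int) ^ (l + 2))" using xx a(1) Suc by (simp add: b_def int_pow_pow g_def)
      moreover have "x \<otimes> b = b [^] (-1::int) \<otimes> x"
      proof -
        have "x \<otimes> a = a [^] t \<otimes> x" using rel'(3) by (simp add: x_def)
        from cyclic_ext_pow(1)[OF a(1) x(1) this xx, of 2]
        have "x \<otimes> b = a [^] (t * 2) \<otimes> x" by (simp add: b_def)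
        moreover have "a [^] (t * 2) = a [^] (2 * (-1) :: int)" using eq 4 by simp
        ultimately show ?thesis using a(1) by (simp add: b_def int_pow_pow)
      qed
      ultimately show False using quaternion_not_weakly_Schur[OF fin W b ob x] by simp
    qed
    then show ?thesis by simp
  qed
qed

text \<open>Let s^2 = a^v. If v is even, multiplying s by a^(-v/2) makes its square trivial. If v is
  odd, s^2 has the order of a, so s has twice that order.\<close>

lemma commuting_ext_cases:
  assumes a: "a \<in> carrier G" "ord a = 2 ^ (k + 3)" and s: "s \<in> carrier G" "s \<notin> cyc a"
    and comm: "s \<otimes> a = a \<otimes> s" and ss: "s \<otimes> s \<in> cyc a"
  obtains "ord s = 2 ^ (k + 4)"
  | i :: int where "(s \<otimes> a [^] i) \<otimes> (s \<otimes> a [^] i) = \<one>"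
proof -
  obtain v where v: "s \<otimes> s = a [^] (v::int)" using ss by blast
  have q: "int (ord a) = 2 ^ (k + 3)" using a by simp
  have sa: "s \<otimes> a = a [^] (1::int) \<otimes> s" using comm a by simp
  show thesis
  proof (cases "even v")
    case True
    then obtain u where u: "v = 2 * u" by (elim evenE)
    have "(s \<otimes> a [^] (-u)) \<otimes> (s \<otimes> a [^] (-u)) = \<one>"
      using cyclic_ext_pow(2)[OF a(1) s(1) sa v, of "-u"] u by simp
    then show thesis using that(2) by blast
  next
    case False
    have pow: "s [^] ((2::nat) ^ Suc n) = a [^] (v * 2 ^ n)" for n
    proof -
      have "s [^] ((2::nat) ^ Suc n) = (s [^] (2::nat)) [^] ((2::nat) ^ n)" using s(1) by (simp add: nat_pow_pow)
      also have "s [^] (2::nat) = a [^] v" using v s(1) by (simp add: numeral_2_eq_2)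
      also have "(a [^] v) [^] ((2::nat) ^ n) = a [^] (v * 2 ^ n)"
        using a(1) int_pow_pow[OF a(1), of v "2 ^ n"] by (simp flip: int_pow_int)
      finally show ?thesis .
    qed
    have "s [^] ((2::nat) ^ Suc (k + 3)) = \<one>" unfolding pow using a by (simp add: int_pow_eq_id)
    have "\<not> (2 ^ (k + 3) :: int) dvd v * 2 ^ (k + 2)"
    proof
      assume "(2 ^ (k + 3) :: int) dvd v * 2 ^ (k + 2)"
      moreover have "(2::int) ^ (k + 3) = 2 ^ (k + 2) * 2" by (simp add: power_add)
      ultimately have "2 ^ (k + 2) * 2 dvd 2 ^ (k + 2) * v" by (simp only: mult.commute[of v])
      then have "2 dvd v" by (metis dvd_mult_cancel_left power_eq_0_iff zero_neq_numeral)
      then show False using False by simp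
    qed
    moreover have "s [^] ((2::nat) ^ (k + 3)) = a [^] (v * 2 ^ (k + 2))"
      using pow[of "k + 2"] by (simp only: add_2_eq_Suc' add_Suc_right numeral_3_eq_3 One_nat_def add_0_right Suc_1[symmetric])
    ultimately have "s [^] ((2::nat) ^ (k + 3)) \<noteq> \<one>"
      using a(1) q by (simp only: int_pow_eq_id not_False_eq_True)
    with \<open>s [^] ((2::nat) ^ Suc (k + 3)) = \<one>\<close> have "ord s = 2 ^ Suc (k + 3)" using ord_power_of_two[OF s(1)] by blast
    then show thesis using that(1) by simp
  qed
qed

section \<open>Doubling the order of a cyclic subgroup\<close>

lemma nat_pow_two_int_pow: "s [^] ((2::nat) ^ m) = s [^] ((2::int) ^ m)"
  by (metis int_pow_int of_nat_numeral of_nat_power)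

text \<open>The abelian group M = <a> x <z> has index 2 in L. Conjugates of a have the form a^i z^j,
  whose fourth powers lose z, so N = <a^4> is normal in L with a quotient of order 16. There
  \<open>centralized_ext42\<close> gives s^4 outside N for s outside M. As s^2 = a^u z^v, this makes
  u odd and the order of s twice that of a.\<close>

lemma commuting_ext_index_two:
  assumes fin: "finite (carrier G)" and W: "weakly_Schur G" and L: "subgroup L G"
    and a: "a \<in> L" "ord a = 2 ^ (k + 3)" and z: "z \<in> L" "z \<notin> cyc a" "z \<otimes> a = a \<otimes> z" "z \<otimes> z = \<one>"
    and card: "card L = 4 * 2 ^ (k + 3)"
  shows "\<exists>b\<in>L. ord b = 2 ^ (k + 4)"
proof -
  have LG: "x \<in> carrier G" if "x \<in> L" for x using subgroup.mem_carrier[OF L that] .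
  have Lm: "x \<otimes> y \<in> L" "inv x \<in> L" if "x \<in> L" "y \<in> L" for x y
    using subgroup.m_closed[OF L] subgroup.m_inv_closed[OF L] that by auto
  have aG: "a \<in> carrier G" and zG: "z \<in> carrier G" using LG a z by auto
  have L_pow: "x [^] (i::int) \<in> L" if "x \<in> L" for x i using subgroup_int_pow_closed[OF L that] .
  have az: "a [^] (i::int) \<otimes> z [^] (j::int) = z [^] j \<otimes> a [^] i" for i j
    using commute_int_pow[of a z] z(3) aG zG by simp
  have z_even: "z [^] (2 * j :: int) = \<one>" for j
    using int_pow_pow[OF zG, of 2 j] z(4) zG by (simp add: int_pow_numerals)
  define M where "M = cyc a \<union> (\<lambda>x. z \<otimes> x) ` cyc a"
  have norm: "z \<otimes> x \<otimes> inv z \<in> cyc a" if xa: "x \<in> cyc a" for x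
  proof -
    obtain i :: int where x: "x = a [^] i" using xa by blast
    have "z \<otimes> x = x \<otimes> z" unfolding x using az[of i 1] zG by simp
    then have "z \<otimes> x \<otimes> inv z = x" using x aG zG by (simp add: m_assoc)
    then show ?thesis using xa by simp
  qed
  have "z \<otimes> z \<in> cyc a" using z(4) subgroup.one_closed[OF cyc_subgroup[OF aG]] by simp
  then have M: "subgroup M G" "card M = 2 * card (cyc a)"
    unfolding M_def by (intro adjoin_subgroup[OF fin cyc_subgroup[OF aG] zG z(2) _ norm]; simp)+
  have MG: "x \<in> carrier G" if "x \<in> M" for x using subgroup.mem_carrier[OF M(1) that] .
  have Mm: "x \<otimes> y \<in> M" "inv x \<in> M" if "x \<in> M" "y \<in> M" for x y
    using subgroup.m_closed[OF M(1)] subgroup.m_inv_closed[OF M(1)] that by auto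
  have M_L: "M \<subseteq> L" unfolding M_def using L_pow[OF a(1)] Lm z(1) by auto
  have aM: "a \<in> M" unfolding M_def using cyc_self[OF aG] by blast
  have "z \<otimes> \<one> \<in> M" unfolding M_def using subgroup.one_closed[OF cyc_subgroup[OF aG]] by blast
  then have zM: "z \<in> M" using zG by simp
  have oneM: "\<one> \<in> M" using subgroup.one_closed[OF M(1)] .
  have M_form: "\<exists>i j. x = a [^] (i::int) \<otimes> z [^] (j::int)" if "x \<in> M" for x
  proof -
    from that obtain i :: int where "x = a [^] i \<or> x = z \<otimes> a [^] i" unfolding M_def by blast
    then show ?thesis
    proof
      assume "x = a [^] i"
      then have "x = a [^] i \<otimes> z [^] (0::int)" using aG by simp
      then show ?thesis by blast
    next
      assume "x = z \<otimes> a [^] i"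
      then have "x = a [^] i \<otimes> z [^] (1::int)" using az[of i 1] zG by simp
      then show ?thesis by blast
    qed
  qed
  have M_pow: "(a [^] i \<otimes> z [^] j) [^] (n::int) = a [^] (i * n) \<otimes> z [^] (j * n)" for i j n :: int
    using int_pow_mult_distrib[OF az, of i j n] aG zG by (simp add: int_pow_pow)
  have card_M: "card L = 2 * card M" using card M(2) card_cyc[OF aG] a(2) by simp
  have "finite L" using fin subgroup.subset[OF L] finite_subset by blast
  have "M \<noteq> L" using card_M card by auto
  then obtain s where s: "s \<in> L" "s \<notin> M" using M_L by blast
  have sG: "s \<in> carrier G" using LG s by blast
  note idx = index_two[OF fin M(1) L M_L card_M]
  have conj_M: "x \<otimes> a \<otimes> inv x \<in> M" if "x \<in> L" for x
    using idx(3)[OF that _ aM] Mm aM by (cases "x \<in> M") auto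
  \<comment> \<open>Modulo \<open>a\<^sup>4\<close> the element \<open>s\<close> centralizes \<open>z\<close>, so that \<open>s\<^sup>2\<close> has to be an odd power of \<open>a\<close> times
    a power of \<open>z\<close>.\<close>
  define N where "N = range (\<lambda>n::int. a [^] (4 * n))"
  have N_iff: "a [^] (i::int) \<in> N \<longleftrightarrow> 4 dvd i" for i
  proof
    assume "a [^] i \<in> N"
    then obtain n where "a [^] i = a [^] (4 * n :: int)" unfolding N_def by blast
    then have "int (ord a) dvd 4 * n - i" using aG by (simp add: int_pow_eq)
    moreover have "(4::int) dvd int (ord a)" by (simp add: a(2) power_add)
    ultimately have "4 dvd 4 * n - i" using dvd_trans by blast
    then show "4 dvd i" by (metis dvd_diff_right_iff dvd_triv_left)
  next
    assume "4 dvd i"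
    then show "a [^] i \<in> N" unfolding N_def by (auto elim!: dvdE)
  qed
  have "N = cyc (a [^] (4::int))" unfolding N_def using aG by (simp add: int_pow_pow)
  then have N: "subgroup N G" using cyc_subgroup[of "a [^] (4::int)"] aG by simp
  have N_cyc: "N \<subseteq> cyc a" unfolding N_def by blast
  then have NM: "N \<subseteq> M" unfolding M_def by blast
  let ?K = "G\<lparr>carrier := L\<rparr>"
  interpret K: group ?K by (rule subgroup_imp_group[OF L])
  have NK: "subgroup N ?K" using subgroup_incl[OF N L] NM M_L by blast
  have "N \<lhd> ?K"
    unfolding K.normal_inv_iff
  proof (intro conjI ballI NK)
    fix x h assume x: "x \<in> carrier ?K" and h: "h \<in> N"
    have xL: "x \<in> L" and xG: "x \<in> carrier G" using x LG by auto
    obtain n where n: "h = a [^] (4 * n :: int)" using h unfolding N_def by blast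
    obtain i j where ij: "x \<otimes> a \<otimes> inv x = a [^] (i::int) \<otimes> z [^] (j::int)" using M_form[OF conj_M[OF xL]] by blast
    have "x \<otimes> a = (a [^] i \<otimes> z [^] j) \<otimes> x" unfolding ij[symmetric] using xG aG by (simp add: m_assoc)
    then have "x \<otimes> h = (a [^] i \<otimes> z [^] j) [^] (4 * n) \<otimes> x"
      unfolding n using semiconj_int_pow[of x a "a [^] i \<otimes> z [^] j"] xG aG zG by simp
    also have "(a [^] i \<otimes> z [^] j) [^] (4 * n) = a [^] (4 * (i * n))"
      unfolding M_pow using z_even[of "2 * (j * n)"] aG by (simp add: algebra_simps)
    finally have "x \<otimes> h \<otimes> inv x = a [^] (4 * (i * n))" using xG aG by (simp add: m_assoc)
    then show "x \<otimes>\<^bsub>?K\<^esub> h \<otimes>\<^bsub>?K\<^esub> inv\<^bsub>?K\<^esub> x \<in> N"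
      using m_inv_consistent[OF L xL] by (simp add: N_iff)
  qed
  then interpret N: normal N ?K .
  let ?Q = "?K Mod N"
  define \<phi> where "\<phi> x = N #>\<^bsub>?K\<^esub> x" for x
  have hom: "\<phi> \<in> hom ?K ?Q" using N.r_coset_hom_Mod unfolding \<phi>_def .
  interpret Q: group ?Q by (rule N.factorgroup_is_group)
  interpret h: group_hom ?K ?Q \<phi> by unfold_locales (rule hom)
  have surj: "\<phi> ` carrier ?K = carrier ?Q" by (simp add: carrier_FactGroup \<phi>_def)
  have finK: "finite (carrier ?K)" using \<open>finite L\<close> by simp
  then have finQ: "finite (carrier ?Q)" unfolding surj[symmetric] by simp
  have WQ: "weakly_Schur ?Q"
    by (rule weakly_Schur_hom_image[OF K.group_axioms Q.group_axioms finK weakly_Schur_subgroup[OF fin W L] hom surj])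
  have ker: "\<phi> x = \<one>\<^bsub>?Q\<^esub> \<longleftrightarrow> x \<in> N" if "x \<in> L" for x
    using K.coset_join1[of N x] K.coset_join2[of x N] NK that N.subset by (auto simp: \<phi>_def)
  have hm: "\<phi> x \<otimes>\<^bsub>?Q\<^esub> \<phi> y = \<phi> (x \<otimes> y)" if "x \<in> L" "y \<in> L" for x y
    using h.hom_mult[of x y] that by simp
  have \<phi>c: "\<phi> x \<in> carrier ?Q" if "x \<in> L" for x using h.hom_closed[of x] that by simp
  have \<phi>_eq: "\<phi> x = \<phi> y \<longleftrightarrow> x \<otimes> inv y \<in> N" if "x \<in> L" "y \<in> L" for x y
  proof -
    have "\<phi> (x \<otimes> inv y) \<otimes>\<^bsub>?Q\<^esub> \<phi> y = \<phi> x" using hm[of "x \<otimes> inv y" y] that Lm LG by (simp add: m_assoc)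
    then show ?thesis
      using ker[of "x \<otimes> inv y"] that Lm \<phi>c[OF that(1)] \<phi>c[OF that(2)] \<phi>c[of "x \<otimes> inv y"]
      by (metis Q.l_one Q.r_cancel_one Q.r_cancel_one')
  qed
  have \<phi>_pow: "\<phi> (x [^] (i::int)) = \<phi> x [^]\<^bsub>?Q\<^esub> i" if "x \<in> L" for x i
    using h.hom_int_pow[of x i] that int_pow_consistent[OF L that] by simp
  have a_pow: "a \<otimes> a = a [^] (2::int)" "a \<otimes> (a \<otimes> (a \<otimes> a)) = a [^] (4::int)"
    using aG by (simp_all add: int_pow_numerals)
  have aaL: "a \<otimes> a \<in> L" "a \<otimes> (a \<otimes> a) \<in> L" "a \<otimes> (a \<otimes> (a \<otimes> a)) \<in> L" using a Lm by auto
  have Z: "Q.Z4_Z2 (\<phi> a) (\<phi> z)"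
    unfolding Q.Z4_Z2_def
  proof (intro conjI)
    show "\<phi> a \<in> carrier ?Q" "\<phi> z \<in> carrier ?Q" using \<phi>c a z by auto
    show "\<phi> a \<otimes>\<^bsub>?Q\<^esub> \<phi> z = \<phi> z \<otimes>\<^bsub>?Q\<^esub> \<phi> a" using hm a z by simp
    have "a \<otimes> (a \<otimes> (a \<otimes> a)) \<in> N" unfolding a_pow(2) by (simp add: N_iff)
    then show "\<phi> a \<otimes>\<^bsub>?Q\<^esub> (\<phi> a \<otimes>\<^bsub>?Q\<^esub> (\<phi> a \<otimes>\<^bsub>?Q\<^esub> \<phi> a)) = \<one>\<^bsub>?Q\<^esub>" using hm a aaL ker by simp
    have "a \<otimes> a \<notin> N" unfolding a_pow(1) by (simp add: N_iff)
    then show "\<phi> a \<otimes>\<^bsub>?Q\<^esub> \<phi> a \<noteq> \<one>\<^bsub>?Q\<^esub>" using hm a aaL ker by simp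
    show "\<phi> z \<otimes>\<^bsub>?Q\<^esub> \<phi> z = \<one>\<^bsub>?Q\<^esub>" using hm z(1,4) ker[of \<one>] subgroup.one_closed[OF N] subgroup.one_closed[OF L] by simp
    show "\<phi> z \<noteq> \<one>\<^bsub>?Q\<^esub>" using ker[OF z(1)] z(2) N_cyc by blast
    show "\<phi> z \<noteq> \<phi> a \<otimes>\<^bsub>?Q\<^esub> \<phi> a"
    proof
      assume "\<phi> z = \<phi> a \<otimes>\<^bsub>?Q\<^esub> \<phi> a"
      then have "z \<otimes> inv (a \<otimes> a) \<in> N" using hm a z aaL \<phi>_eq by simp
      then have "z \<otimes> a [^] (-2::int) \<in> cyc a" using N_cyc a_pow(1) aG by (auto simp: int_pow_neg)
      then show False using mult_cyc_notin[OF aG zG z(2)] by blast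
    qed
  qed
  have span: "Q.span42 (\<phi> a) (\<phi> z) = \<phi> ` M"
  proof (intro equalityI subsetI)
    fix y assume "y \<in> Q.span42 (\<phi> a) (\<phi> z)"
    moreover have "\<one>\<^bsub>?Q\<^esub> = \<phi> \<one>" using h.hom_one by simp
    ultimately have "y \<in> \<phi> ` {\<one>, a, a \<otimes> a, a \<otimes> (a \<otimes> a), z, a \<otimes> z, a \<otimes> (a \<otimes> z), a \<otimes> (a \<otimes> (a \<otimes> z))}"
      unfolding Q.span42_def using a(1) z(1) aaL Lm by (simp add: hm del: mult_FactGroup one_FactGroup)
    moreover have "{\<one>, a, a \<otimes> a, a \<otimes> (a \<otimes> a), z, a \<otimes> z, a \<otimes> (a \<otimes> z), a \<otimes> (a \<otimes> (a \<otimes> z))} \<subseteq> M"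
      using aM zM oneM Mm by auto
    ultimately show "y \<in> \<phi> ` M" by blast
  next
    fix y assume "y \<in> \<phi> ` M"
    then obtain i j where "y = \<phi> (a [^] (i::int) \<otimes> z [^] (j::int))" using M_form by blast
    then have "y = \<phi> a [^]\<^bsub>?Q\<^esub> i \<otimes>\<^bsub>?Q\<^esub> \<phi> z [^]\<^bsub>?Q\<^esub> j"
      using hm[OF L_pow[OF a(1)] L_pow[OF z(1)]] \<phi>_pow a z by simp
    then show "y \<in> Q.span42 (\<phi> a) (\<phi> z)" using Q.Z4_Z2_int_pow(1)[OF Z] by simp
  qed
  have s_span: "\<phi> s \<notin> Q.span42 (\<phi> a) (\<phi> z)"
  proof
    assume "\<phi> s \<in> Q.span42 (\<phi> a) (\<phi> z)"
    then obtain m where m: "m \<in> M" "\<phi> s = \<phi> m" unfolding span by blast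
    then have "s \<otimes> inv m \<in> M" using \<phi>_eq s(1) M_L NM by blast
    then have "s \<otimes> inv m \<otimes> m \<in> M" using Mm m by blast
    then show False using s(2) sG MG[OF m(1)] by (simp add: m_assoc)
  qed
  obtain i j where ij: "s \<otimes> z \<otimes> inv s = a [^] (i::int) \<otimes> z [^] (j::int)" using M_form idx(3)[OF s zM] by blast
  have "(s \<otimes> z \<otimes> inv s) \<otimes> (s \<otimes> z \<otimes> inv s) = \<one>"
    using sG zG z(4) by (simp add: m_assoc cancel_assoc) (simp flip: m_assoc)
  then have "(a [^] i \<otimes> z [^] j) [^] (2::int) = \<one>" unfolding ij using aG zG by (simp add: int_pow_numerals)
  then have "a [^] (i * 2) = \<one>" unfolding M_pow using z_even[of j] aG by (simp add: mult.commute)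
  then have "int (ord a) dvd i * 2" using aG by (simp add: int_pow_eq_id)
  then have "2 * 2 ^ (k + 2) dvd 2 * i" by (simp add: a(2) power_add mult.commute)
  then have i4: "2 ^ (k + 2) dvd i" by (metis dvd_mult_cancel_left zero_neq_numeral)
  then have "(4::int) dvd i" by (metis dvd_mult_left mult.commute power_add power2_eq_square numeral_Bit0_eq_double mult_2 one_add_one)
  then have aiN: "a [^] i \<in> N" by (simp add: N_iff)
  \<comment> \<open>For even j the conjugate s z s^-1 would be a power of a with even exponent.
    Conjugating back sends even powers of a into <a>, since the factors z disappear, and z would lie
    in <a>.\<close>
  have "odd j"
  proof
    assume "even j"
    then have "s \<otimes> z \<otimes> inv s = a [^] i" unfolding ij using z_even aG by (auto elim!: evenE)
    moreover from i4 obtain c where c: "i = 2 * (2 ^ (k + 1) * c)" by (elim dvdE) (simp add: power_add algebra_simps)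
    ultimately have sz: "s \<otimes> z = a [^] i \<otimes> s" using sG zG aG by (metis inv_solve_right int_pow_closed m_closed)
    have si: "inv s \<in> L" "inv s \<notin> M" using s Lm Mm sG by (blast, metis Mm(2) inv_inv)
    obtain i' j' where ij': "inv s \<otimes> a \<otimes> inv (inv s) = a [^] (i'::int) \<otimes> z [^] (j'::int)"
      using M_form idx(3)[OF si aM] by blast
    have "inv s \<otimes> a = (a [^] i' \<otimes> z [^] j') \<otimes> inv s" unfolding ij'[symmetric] using sG aG by (simp add: m_assoc)
    then have "inv s \<otimes> a [^] i = (a [^] i' \<otimes> z [^] j') [^] i \<otimes> inv s"
      using semiconj_int_pow[of "inv s" a "a [^] i' \<otimes> z [^] j'"] sG aG zG by simp
    also have "(a [^] i' \<otimes> z [^] j') [^] i = a [^] (i' * i)"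
      unfolding M_pow using z_even[of "j' * (2 ^ (k + 1) * c)"] aG c by (simp add: algebra_simps)
    finally have "inv s \<otimes> a [^] i \<otimes> s = a [^] (i' * i)" using sG aG by (simp add: m_assoc)
    moreover have "inv s \<otimes> a [^] i \<otimes> s = z" using sz sG zG aG by (simp add: m_assoc cancel_assoc flip: sz)
    ultimately show False using z(2) by blast
  qed
  then obtain e where "j = 2 * e + 1" by (elim oddE)
  then have "z [^] j = z" using z_even[of e] zG by (simp add: int_pow_mult)
  then have szs: "s \<otimes> z \<otimes> inv s = a [^] i \<otimes> z" using ij by simp
  have comm: "\<phi> s \<otimes>\<^bsub>?Q\<^esub> \<phi> z = \<phi> z \<otimes>\<^bsub>?Q\<^esub> \<phi> s"
  proof -
    have "s \<otimes> z \<otimes> inv (z \<otimes> s) = (s \<otimes> z \<otimes> inv s) \<otimes> inv z" using sG zG by (simp add: m_assoc inv_mult_group)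
    also have "\<dots> = a [^] i" unfolding szs using aG zG by (simp add: m_assoc)
    finally show ?thesis using aiN s z hm \<phi>_eq Lm by simp
  qed
  have conj: "\<phi> s \<otimes>\<^bsub>?Q\<^esub> \<phi> a \<otimes>\<^bsub>?Q\<^esub> inv\<^bsub>?Q\<^esub> \<phi> s \<in> Q.span42 (\<phi> a) (\<phi> z)"
  proof -
    have "inv\<^bsub>?Q\<^esub> \<phi> s = \<phi> (inv s)" using h.hom_inv[of s] s(1) m_inv_consistent[OF L s(1)] by simp
    then have "\<phi> s \<otimes>\<^bsub>?Q\<^esub> \<phi> a \<otimes>\<^bsub>?Q\<^esub> inv\<^bsub>?Q\<^esub> \<phi> s = \<phi> (s \<otimes> a \<otimes> inv s)" using s a hm Lm by simp
    then show ?thesis unfolding span using conj_M[OF s(1)] by blast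
  qed
  have ss: "\<phi> s \<otimes>\<^bsub>?Q\<^esub> \<phi> s \<in> Q.span42 (\<phi> a) (\<phi> z)"
    unfolding span using hm[OF s(1) s(1)] idx(2)[OF s] by auto
  have "\<phi> s \<otimes>\<^bsub>?Q\<^esub> \<phi> s \<otimes>\<^bsub>?Q\<^esub> (\<phi> s \<otimes>\<^bsub>?Q\<^esub> \<phi> s) \<noteq> \<one>\<^bsub>?Q\<^esub>"
    by (rule Q.centralized_ext42[OF finQ WQ Z \<phi>c[OF s(1)] s_span comm conj ss])
  then have s4: "s \<otimes> s \<otimes> (s \<otimes> s) \<notin> N" using s(1) hm Lm ker by simp
  obtain u v where uv: "s \<otimes> s = a [^] (u::int) \<otimes> z [^] (v::int)" using M_form idx(2)[OF s] by blast
  have s_pow: "s [^] (2 * n :: int) = a [^] (u * n) \<otimes> z [^] (v * n)" for n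
    using int_pow_pow[OF sG, of 2 n] uv sG M_pow by (simp add: int_pow_numerals)
  have "s \<otimes> s \<otimes> (s \<otimes> s) = s [^] (2 * 2 :: int)" using sG by (simp add: int_pow_numerals m_assoc)
  also have "\<dots> = a [^] (u * 2)" unfolding s_pow using z_even[of v] aG by (simp add: mult.commute)
  finally have "\<not> 4 dvd u * 2" using s4 by (simp add: N_iff)
  then have u: "odd u" by (auto elim!: evenE)
  have "s [^] ((2::nat) ^ Suc (k + 3)) = a [^] (u * 2 ^ (k + 3))"
  proof -
    have "s [^] ((2::nat) ^ Suc (k + 3)) = s [^] (2 * (2::int) ^ (k + 3))"
      by (subst nat_pow_two_int_pow) (simp only: power_Suc)
    then show ?thesis
      using z_even[of "v * 2 ^ (k + 2)"] aG by (simp only: s_pow) (simp add: power_add algebra_simps)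
  qed
  also have "\<dots> = \<one>" using aG a(2) by (simp add: int_pow_eq_id)
  finally have 1: "s [^] ((2::nat) ^ Suc (k + 3)) = \<one>" .
  have "s [^] ((2::nat) ^ Suc (k + 2)) = a [^] (u * 2 ^ (k + 2))"
  proof -
    have "s [^] ((2::nat) ^ Suc (k + 2)) = s [^] (2 * (2::int) ^ (k + 2))"
      by (subst nat_pow_two_int_pow) (simp only: power_Suc)
    then show ?thesis
      using z_even[of "v * 2 ^ (k + 1)"] aG by (simp only: s_pow) (simp add: power_add algebra_simps)
  qed
  moreover have "\<not> int (ord a) dvd u * 2 ^ (k + 2)"
  proof
    assume "int (ord a) dvd u * 2 ^ (k + 2)"
    moreover have "int (ord a) = 2 ^ (k + 2) * 2" by (simp add: a(2) power_add)
    ultimately have "(2::int) ^ (k + 2) * 2 dvd 2 ^ (k + 2) * u" by (simp only: mult.commute[of u])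
    then have "2 dvd u" by (metis dvd_mult_cancel_left power_eq_0_iff zero_neq_numeral)
    then show False using u by simp
  qed
  ultimately have "s [^] ((2::nat) ^ Suc (k + 2)) \<noteq> \<one>" using aG by (simp only: int_pow_eq_id not_False_eq_True)
  moreover have "Suc (k + 2) = k + 3" by simp
  ultimately have "ord s = 2 ^ Suc (k + 3)" using ord_power_of_two[OF sG 1] by metis
  then show ?thesis using s(1) by (intro bexI[of _ s]) simp_all
qed

text \<open>The exponent k + 3 keeps the cyclic subgroup at order at least 8, where
  \<open>cyclic_ext_relations\<close> applies.\<close>

definition cyclic_index_le_two :: "'a set \<Rightarrow> bool" where
  "cyclic_index_le_two L \<longleftrightarrow> (\<exists>a\<in>L. \<exists>k. ord a = 2 ^ (k + 3) \<and> (card L = 2 ^ (k + 3) \<or> card L = 2 ^ (k + 4)))"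

text \<open>Here <a> has index 4 in L. Either s has twice the order of a already, or it can be
  corrected to an involution commuting with a, and then \<open>commuting_ext_index_two\<close>
  supplies an element of twice the order.\<close>

lemma commuting_ext_cyclic_index_le_two:
  assumes fin: "finite (carrier G)" and W: "weakly_Schur G" and L: "subgroup L G"
    and a: "a \<in> L" "ord a = 2 ^ (k + 3)" and s: "s \<in> L" "s \<notin> cyc a" "s \<otimes> a = a \<otimes> s" "s \<otimes> s \<in> cyc a"
    and card: "card L = 2 ^ (k + 5)"
  shows "cyclic_index_le_two L"
proof -
  have aG: "a \<in> carrier G" and sG: "s \<in> carrier G" using subgroup.mem_carrier[OF L] a s by auto
  have "\<exists>b\<in>L. ord b = 2 ^ (k + 4)"
  proof (rule commuting_ext_cases[OF aG a(2) sG s(2,3,4)])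
    assume "ord s = 2 ^ (k + 4)"
    then show ?thesis using s(1) by blast
  next
    fix i :: int
    let ?z = "s \<otimes> a [^] i"
    assume zz: "?z \<otimes> ?z = \<one>"
    have "?z \<in> L" using subgroup.m_closed[OF L s(1)] subgroup_int_pow_closed[OF L a(1)] by simp
    moreover have "?z \<otimes> a = a \<otimes> ?z"
    proof -
      have "?z \<otimes> a = s \<otimes> (a [^] i \<otimes> a)" using aG sG by (simp add: m_assoc)
      also have "a [^] i \<otimes> a = a \<otimes> a [^] i" using commute_int_pow[of a a i 1] aG by simp
      also have "s \<otimes> (a \<otimes> a [^] i) = s \<otimes> a \<otimes> a [^] i" using aG sG by (simp add: m_assoc)
      also have "\<dots> = a \<otimes> ?z" unfolding s(3) using aG sG by (simp add: m_assoc)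
      finally show ?thesis .
    qed
    moreover have "card L = 4 * 2 ^ (k + 3)" using card by (simp add: power_add)
    ultimately show ?thesis
      using commuting_ext_index_two[OF fin W L a _ mult_cyc_notin[OF aG sG s(2)] _ zz] by blast
  qed
  then obtain b where "b \<in> L" "ord b = 2 ^ (Suc k + 3)" by (auto simp: eval_nat_numeral)
  moreover have "card L = 2 ^ (Suc k + 4)" using card by (simp add: power_add)
  ultimately show ?thesis unfolding cyclic_index_le_two_def by blast
qed

text \<open>The case to treat is <a> of index 2 in H. An abelian H gives an element of twice the
  order at once. If H is dihedral, an element t of L outside H normalizes <a> and has its square in
  <a>; it centralizes a or inverts it, and in the second case s t centralizes a.\<close>

lemma cyclic_index_le_two_step:
  assumes fin: "finite (carrier G)" and W: "weakly_Schur G" and H: "subgroup H G" and L: "subgroup L G"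
    and HL: "H \<subseteq> L" and card: "card L = 2 * card H" and T: "cyclic_index_le_two H"
  shows "cyclic_index_le_two L"
proof -
  obtain a k where a: "a \<in> H" "ord a = 2 ^ (k + 3)" and cH: "card H = 2 ^ (k + 3) \<or> card H = 2 ^ (k + 4)"
    using T unfolding cyclic_index_le_two_def by blast
  have HG: "x \<in> carrier G" if "x \<in> H" for x using subgroup.mem_carrier[OF H that] .
  have LG: "x \<in> carrier G" if "x \<in> L" for x using subgroup.mem_carrier[OF L that] .
  have aG: "a \<in> carrier G" and aL: "a \<in> L" using a HG HL by auto
  show ?thesis
  proof (cases "card H = 2 ^ (k + 3)")
    case True
    then have "card L = 2 ^ (k + 4)" using card by (simp add: power_add)
    then show ?thesis unfolding cyclic_index_le_two_def using aL a(2) by blast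
  next
    case False
    then have cH: "card H = 2 ^ (k + 4)" using cH by blast
    have cL: "card L = 2 ^ (k + 5)" using card cH by (simp add: power_add)
    have ca: "card (cyc a) = 2 ^ (k + 3)" using card_cyc[OF aG] a(2) by simp
    have aH: "cyc a \<subseteq> H" using subgroup_int_pow_closed[OF H a(1)] by blast
    have cH2: "card H = 2 * card (cyc a)" using cH ca by (simp add: power_add)
    have "cyc a \<noteq> H" using cH2 ca by auto
    then obtain s where s: "s \<in> H" "s \<notin> cyc a" using aH by blast
    have sG: "s \<in> carrier G" using HG s by blast
    note idx = index_two[OF fin cyc_subgroup[OF aG] H aH cH2 s]
    from cyclic_ext_relations[OF fin W aG a(2) sG s(2) idx(3)[OF cyc_self[OF aG]] idx(2)]
    show ?thesis
    proof
      assume "s \<otimes> a = a \<otimes> s"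
      then show ?thesis
        using commuting_ext_cyclic_index_le_two[OF fin W L aL a(2) _ s(2) _ idx(2) cL] s HL by blast
    next
      assume sa: "s \<otimes> a = inv a \<otimes> s \<and> s \<otimes> s = \<one>"
      have sa': "s \<otimes> a = a [^] (-1::int) \<otimes> s" and ss': "s \<otimes> s = a [^] (0::int)"
        using sa aG by (simp_all add: int_pow_neg)
      note rel = cyclic_ext_pow[OF aG sG sa' ss']
      have "H \<noteq> L" using card cH by auto
      then obtain t where t: "t \<in> L" "t \<notin> H" using HL by blast
      have aa: "a \<otimes> a \<noteq> \<one>"
      proof
        assume "a \<otimes> a = \<one>"
        then have "a [^] (2::nat) = \<one>" using aG by (simp add: numeral_2_eq_2)
        then have "ord a dvd 2" using aG by (simp add: pow_eq_id)
        then have "ord a \<le> 2" by (rule dvd_imp_le) simp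
        moreover have "ord a = 8 * 2 ^ k" by (simp add: a(2) power_add)
        moreover have "(1::nat) \<le> 2 ^ k" by simp
        ultimately show False by linarith
      qed
      \<comment> \<open>Elements of H outside <a> are involutions, which a conjugate of a is
        not.\<close>
      have conj: "t \<otimes> a \<otimes> inv t \<in> cyc a" if t: "t \<in> L" "t \<notin> H" for t
      proof (rule ccontr)
        assume n: "t \<otimes> a \<otimes> inv t \<notin> cyc a"
        have tG: "t \<in> carrier G" using LG t by blast
        have "t \<otimes> a \<otimes> inv t \<in> H" using index_two(3)[OF fin H L HL card t a(1)] .
        then obtain i :: int where i: "t \<otimes> a \<otimes> inv t = s \<otimes> a [^] i" using idx(1) n by blast
        have "(t \<otimes> a \<otimes> inv t) \<otimes> (t \<otimes> a \<otimes> inv t) = \<one>" unfolding i using rel(2)[of i] by simp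
        then have "t \<otimes> (a \<otimes> a) \<otimes> inv t = \<one>" using tG aG by (simp add: m_assoc cancel_assoc)
        then have "a \<otimes> a = inv t \<otimes> t" using tG aG by (metis inv_solve_left inv_solve_right inv_closed m_closed one_closed l_one r_one)
        then show False using aa tG by simp
      qed
      \<comment> \<open>If t^2 were some s a^i, it would invert a. With t raising a to the power c
        this reads c^2 = -1 modulo ord a, impossible already modulo 4.\<close>
      have sq: "t \<otimes> t \<in> cyc a" if t: "t \<in> L" "t \<notin> H" for t
      proof (rule ccontr)
        assume n: "t \<otimes> t \<notin> cyc a"
        have tG: "t \<in> carrier G" using LG t by blast
        have "t \<otimes> t \<in> H" using index_two(2)[OF fin H L HL card t] .
        then obtain i :: int where i: "t \<otimes> t = s \<otimes> a [^] i" using idx(1) n by blast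
        obtain c where "t \<otimes> a \<otimes> inv t = a [^] (c::int)" using conj[OF t] by blast
        then have c: "t \<otimes> a = a [^] c \<otimes> t" using tG aG by (metis inv_solve_right int_pow_closed m_closed)
        have "t \<otimes> (t \<otimes> a) = t \<otimes> a [^] c \<otimes> t" unfolding c using tG aG by (simp add: m_assoc)
        also have "t \<otimes> a [^] c = a [^] (c * c) \<otimes> t"
          using semiconj_int_pow[OF c tG aG, of c] aG by (simp add: int_pow_pow)
        finally have "a [^] (-1::int) \<otimes> (t \<otimes> t) = a [^] (c * c) \<otimes> (t \<otimes> t)"
          using rel(3)[of i] tG aG by (simp add: m_assoc flip: i)
        then have "a [^] (-1::int) = a [^] (c * c)" using tG aG by simp
        then have "int (ord a) dvd c * c + 1" using aG by (simp add: int_pow_eq)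
        moreover have "(4::int) dvd int (ord a)" by (simp add: a(2) power_add)
        ultimately have d: "4 dvd c * c + 1" using dvd_trans by blast
        show False
        proof (cases "even c")
          case True
          then obtain b where "c = 2 * b" by (elim evenE)
          then have "c * c + 1 = 4 * (b * b) + 1" by (simp add: algebra_simps)
          then show False using d by presburger
        next
          case False
          then obtain b where "c = 2 * b + 1" by (elim oddE)
          then have "c * c + 1 = 4 * (b * b + b) + 2" by (simp add: algebra_simps)
          then show False using d by presburger
        qed
      qed
      have out: "t \<notin> cyc a" if "t \<notin> H" for t using that aH by blast
      have tG: "t \<in> carrier G" using LG t by blast
      from cyclic_ext_relations[OF fin W aG a(2) tG out[OF t(2)] conj[OF t] sq[OF t]]
      show ?thesis
      proof
        assume "t \<otimes> a = a \<otimes> t"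
        then show ?thesis
          using commuting_ext_cyclic_index_le_two[OF fin W L aL a(2) t(1) out[OF t(2)] _ sq[OF t] cL] by blast
      next
        assume ta: "t \<otimes> a = inv a \<otimes> t \<and> t \<otimes> t = \<one>"
        \<comment> \<open>Both s and t invert a, so their product centralizes it.\<close>
        let ?t = "s \<otimes> t"
        have tL: "?t \<in> L" using s(1) t(1) HL subgroup.m_closed[OF L] by blast
        have tH: "?t \<notin> H"
        proof
          assume "?t \<in> H"
          then have "inv s \<otimes> ?t \<in> H" using subgroup.m_closed[OF H] subgroup.m_inv_closed[OF H] s(1) by blast
          then show False using t(2) tG sG by (simp add: cancel_assoc)
        qed
        have "?t \<otimes> a = s \<otimes> a [^] (-1::int) \<otimes> t" using ta tG sG aG by (simp add: m_assoc int_pow_neg)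
        also have "s \<otimes> a [^] (-1::int) = a \<otimes> s" using rel(1)[of "-1"] aG by simp
        finally have "?t \<otimes> a = a \<otimes> ?t" using tG sG aG by (simp add: m_assoc)
        then show ?thesis
          using commuting_ext_cyclic_index_le_two[OF fin W L aL a(2) tL out[OF tH] _ sq[OF tL tH] cL] by blast
      qed
    qed
  qed
qed

lemma cyclic_index_le_two_carrier:
  assumes fin: "finite (carrier G)" and W: "weakly_Schur G" and ord: "order G = 2 ^ n"
    and L: "subgroup L G" "cyclic_index_le_two L"
  shows "cyclic_index_le_two (carrier G)"
  using L
proof (induction "card (carrier G) - card L" arbitrary: L rule: less_induct)
  case less
  show ?case
  proof (cases "L = carrier G")
    case False
    then obtain s where s: "s \<in> carrier G" "s \<notin> L" "s \<otimes> s \<in> L" "\<And>h. h \<in> L \<Longrightarrow> s \<otimes> h \<otimes> inv s \<in> L"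
      using two_group_subgroup_growth[OF ord fin less.prems(1)] by blast
    let ?L = "L \<union> (\<lambda>h. s \<otimes> h) ` L"
    have L': "subgroup ?L G" "card ?L = 2 * card L"
      using adjoin_subgroup[OF fin less.prems(1) s] by blast+
    have T: "cyclic_index_le_two ?L"
      by (rule cyclic_index_le_two_step[OF fin W less.prems(1) L'(1) _ L'(2) less.prems(2)]) blast
    have "card L > 0" using subgroup.finite_imp_card_positive[OF less.prems(1) fin] .
    moreover have "card ?L \<le> card (carrier G)" by (rule card_mono[OF fin subgroup.subset[OF L'(1)]])
    ultimately show ?thesis using less.hyps[OF _ L'(1) T] L'(2) by simp
  qed (use less in simp)
qed

section \<open>Recognizing the dihedral group\<close>

lemma dihedral_of_relations:
  assumes fin: "finite (carrier G)" and a: "a \<in> carrier G" "ord a = m" "m \<ge> 1"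
    and s: "s \<in> carrier G" "s \<notin> cyc a" and card: "order G = 2 * m"
    and sa: "s \<otimes> a = inv a \<otimes> s" and ss: "s \<otimes> s = \<one>"
  shows "dihedral G"
proof -
  have gen: "subgroup (generate G {a, s}) G" by (rule generate_is_subgroup) (use a s in simp)
  have aA: "a \<in> generate G {a, s}" "s \<in> generate G {a, s}" by (auto intro: generate.incl)
  have "carrier G = cyc a \<union> (\<lambda>h. s \<otimes> h) ` cyc a"
    by (rule index_two(1)[OF fin cyc_subgroup[OF a(1)] subgroup_self _ _ s(1) s(2)])
       (use a card in \<open>auto simp: card_cyc order_def\<close>)
  moreover have "cyc a \<subseteq> generate G {a, s}" using subgroup_int_pow_closed[OF gen aA(1)] by blast
  ultimately have "carrier G \<subseteq> generate G {a, s}"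
    using subgroup.m_closed[OF gen aA(2)] by blast
  then have "generate G {a, s} = carrier G" using subgroup.subset[OF gen] by blast
  moreover have "s \<otimes> a \<otimes> s = inv a" using a s ss by (simp add: sa m_assoc)
  moreover have "a [^] m = \<one>" using a by auto
  moreover have "s [^] (2::nat) = \<one>" using s ss by (simp add: numeral_2_eq_2)
  ultimately show ?thesis
    unfolding dihedral_def using group_axioms a s card by blast
qed

theorem weakly_Schur_two_group_dihedral:
  assumes fin: "finite (carrier G)" and W: "weakly_Schur G" and ord: "order G = 2 ^ n" "order G \<ge> 32"
    and nonab: "\<not> comm_group G"
  shows "dihedral G"
proof -
  have noncomm: "\<exists>x\<in>carrier G. \<exists>y\<in>carrier G. x \<otimes> y \<noteq> y \<otimes> x"
    using nonab group_comm_groupI by blast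
  \<comment> \<open>Were all squares trivial, the group would be abelian; hence
    \<open>exponent_four_not_weakly_Schur\<close> applies and yields an element of order at least
    8.\<close>
  have "\<exists>r\<in>carrier G. r \<otimes> r \<noteq> \<one>"
  proof (rule ccontr)
    assume "\<not> ?thesis"
    then have inv: "inv x = x" if "x \<in> carrier G" for x using that inv_equality by blast
    have "x \<otimes> y = y \<otimes> x" if "x \<in> carrier G" "y \<in> carrier G" for x y
      using inv_mult_group[OF that] inv[of "x \<otimes> y"] inv[of x] inv[of y] that by simp
    then show False using noncomm by blast
  qed
  then obtain x where x: "x \<in> carrier G" "x \<otimes> x \<otimes> (x \<otimes> x) \<noteq> \<one>"
    using exponent_four_not_weakly_Schur[OF fin W ord] by blast
  have "ord x dvd 2 ^ n" using ord_dvd_group_order[OF x(1)] ord(1) by simp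
  then obtain i where i: "ord x = 2 ^ i" using divides_primepow_nat[OF two_is_prime_nat] by blast
  have "\<not> i \<le> 2"
  proof
    assume "i \<le> 2"
    then have "ord x dvd 2 ^ 2" unfolding i by (rule le_imp_power_dvd)
    then have "x [^] (4::int) = \<one>" using x(1) by (simp add: int_pow_eq_id) (metis of_nat_dvd_iff of_nat_numeral)
    then show False using x by (simp add: int_pow_numerals m_assoc)
  qed
  then have "i = (i - 3) + 3" by simp
  then have "cyclic_index_le_two (cyc x)"
    unfolding cyclic_index_le_two_def using cyc_self[OF x(1)] card_cyc[OF x(1)] i by metis
  then have "cyclic_index_le_two (carrier G)"
    using cyclic_index_le_two_carrier[OF fin W ord(1) cyc_subgroup[OF x(1)]] by blast
  then obtain a k where a: "a \<in> carrier G" "ord a = 2 ^ (k + 3)"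
    and card: "card (carrier G) = 2 ^ (k + 3) \<or> card (carrier G) = 2 ^ (k + 4)"
    unfolding cyclic_index_le_two_def by blast
  have sub: "cyc a \<subseteq> carrier G" using a(1) by auto
  have comm_a: "u \<otimes> v = v \<otimes> u" if "u \<in> cyc a" "v \<in> cyc a" for u v
    using that commute_int_pow[of a a] a(1) by auto
  have "cyc a \<noteq> carrier G" using noncomm comm_a by metis
  then have card2: "card (carrier G) = 2 * card (cyc a)"
    using card card_cyc[OF a(1)] a(2) card_subset_eq[OF fin sub] by (auto simp: power_add)
  obtain s where s: "s \<in> carrier G" "s \<notin> cyc a" using \<open>cyc a \<noteq> carrier G\<close> sub by blast
  note idx = index_two[OF fin cyc_subgroup[OF a(1)] subgroup_self sub card2 s]
  from cyclic_ext_relations[OF fin W a s idx(3)[OF cyc_self[OF a(1)]] idx(2)]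
  show ?thesis
  proof
    assume sa: "s \<otimes> a = a \<otimes> s"
    \<comment> \<open>If s centralizes a, all elements are products of powers of two commuting
      elements, contrary to noncommutativity.\<close>
    have form: "\<exists>i j. x = s [^] (i::int) \<otimes> a [^] (j::int)" if x: "x \<in> carrier G" for x
    proof -
      have "x \<in> cyc a \<union> (\<lambda>h. s \<otimes> h) ` cyc a" using x idx(1) by simp
      then obtain j :: int where "x = s [^] (0::int) \<otimes> a [^] j \<or> x = s [^] (1::int) \<otimes> a [^] j"
        using a(1) s(1) by auto
      then show ?thesis by blast
    qed
    have "x \<otimes> y = y \<otimes> x" if xy: "x \<in> carrier G" "y \<in> carrier G" for x y
    proof -
      obtain i j l m where "x = s [^] (i::int) \<otimes> a [^] (j::int)" "y = s [^] (l::int) \<otimes> a [^] (m::int)"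
        using form[OF xy(1)] form[OF xy(2)] by blast
      then show ?thesis by (simp add: commuting_pow_mult[OF sa s(1) a(1)] add.commute)
    qed
    then show ?thesis using noncomm by blast
  next
    assume sa: "s \<otimes> a = inv a \<otimes> s \<and> s \<otimes> s = \<one>"
    show ?thesis
      by (rule dihedral_of_relations[OF fin a(1) a(2) _ s]) (use sa card2 card_cyc[OF a(1)] a(2) in \<open>auto simp: order_def\<close>)
  qed
qed

end

theorem theorem1p2:
  fixes G :: "('a, 'b) monoid_scheme"
  assumes "group G" and "finite (carrier G)"
    and "\<exists>k::nat. order G = 2 ^ k"
    and "\<not> comm_group G"
    and "order G \<ge> 32"
    and "Schur_group G"
  shows "dihedral G"
proof -
  interpret group G by fact
  show ?thesis
    using assms weakly_Schur_two_group_dihedral Schur_group_imp_weakly_Schur by blast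
qed

end
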